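(* Let $a,p,r,k,\lambda,\mu$ be integers with $a>1$, $p\geq 1$, $r\geq 1$, $k\geq 1$, $\lambda\geq 0$, $\mu\geq 1$ and $\lambda\neq\mu$. Let $G=K(a^{(p)};\lambda,\mu)$, let a $k$-edge-coloring of $G$ be given, and let $\omega_j=\omega(G(j))$ for $1\leq j\leq k$. For $1\leq j\leq k$ define $s_j$ to be the integer with $s_j\equiv\omega_j \pmod r$ and $1\leq s_j\leq r$, and suppose that $$\sum_{j=1}^k s_j\;\geq\; kr-\mu a^2\binom{r}{2}.$$ Then the $k$-edge-coloring of $G$ can be embedded into a Hamiltonian decomposition of $G^*=K(a^{(p+r)};\lambda,\mu)$ if and only if all of the following hold: (i) $k=\big(\lambda(a-1)+\mu a(p+r-1)\big)/2$; (ii) $\lambda\leq\mu a(p+r-1)$; (iii) every component of $G(j)$ is a path (possibly of length $0$) for $1\leq j\leq k$; and (iv) $\omega_j\leq ar$ for $1\leq j\leq k$.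
   Context: $K(a^{(p)};\lambda,\mu)$ denotes the loopless multigraph whose vertex set is partitioned into $p$ parts, each of size $a$, in which every two distinct vertices in the same part are joined by exactly $\lambda$ edges and every two vertices in different parts are joined by exactly $\mu$ edges. $K(a^{(p)};\lambda,\mu)$ is regarded as the subgraph of $K(a^{(p+r)};\lambda,\mu)$ induced by the vertices of $p$ of its $p+r$ parts. A $k$-edge-coloring of a graph $G$ is a map $E(G)\to\{1,\dots,k\}$ (no properness is required; it need not be surjective). $G(j)$ is the spanning subgraph of $G$ with vertex set $V(G)$ and edge set the edges colored $j$ (so vertices incident with no edge of color $j$ are components of $G(j)$, i.e. paths of length $0$). $\omega(H)$ denotes the number of connected components of a graph $H$. A Hamiltonian decomposition of a graph is a partition of its edge set into edge sets of Hamiltonian cycles. A $k$-edge-coloring of $G$ is embedded into a Hamiltonian decomposition of a supergraph $G^*$ if it extends to a $k$-edge-coloring of $G^*$ (edges of $G$ keep their colors) in which each of the $k$ color classes is a Hamiltonian cycle of $G^*$. By convention $\binom{1}{2}=0$. *)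

theory Defs
  imports Complex_Main "HOL-Number_Theory.Cong"
begin

text \<open>
  Multigraphs are represented with explicit edge identities, so that parallel edges
  can be coloured differently; \<open>ends e\<close> is the set of end vertices of the edge \<open>e\<close>.
\<close>

record ('v, 'e) multigraph =
  vertices :: "'v set"
  edges :: "'e set"
  ends :: "'e \<Rightarrow> 'v set"

definition loopless :: "('v, 'e) multigraph \<Rightarrow> bool" where
  "loopless G \<longleftrightarrow> (\<forall>e\<in>edges G. ends G e \<subseteq> vertices G \<and> card (ends G e) = 2)"

definition induced_subgraph :: "('v, 'e) multigraph \<Rightarrow> 'v set \<Rightarrow> ('v, 'e) multigraph" where
  "induced_subgraph G W =
     G\<lparr>vertices := vertices G \<inter> W, edges := {e \<in> edges G. ends G e \<subseteq> W}\<rparr>"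

definition connectedness :: "('v, 'e) multigraph \<Rightarrow> ('v \<times> 'v) set" where
  "connectedness G =
     {(u, v). u \<in> vertices G \<and> v \<in> vertices G \<and>
        (u, v) \<in> {(x, y). \<exists>e\<in>edges G. ends G e = {x, y}}\<^sup>*}"

definition components_of :: "('v, 'e) multigraph \<Rightarrow> ('v, 'e) multigraph set" where
  "components_of G = induced_subgraph G ` (vertices G // connectedness G)"

definition num_components :: "('v, 'e) multigraph \<Rightarrow> nat" where
  "num_components G = card (components_of G)"

text \<open>A single vertex without edges is a path (of length 0).\<close>

definition is_path_graph :: "('v, 'e) multigraph \<Rightarrow> bool" where
  "is_path_graph H \<longleftrightarrow>
     (\<exists>vs es. vs \<noteq> [] \<and> distinct vs \<and> set vs = vertices H \<and>
        distinct es \<and> set es = edges H \<and> length vs = length es + 1 \<and>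
        (\<forall>i<length es. ends H (es ! i) = {vs ! i, vs ! (i + 1)}))"

text \<open>
  Two parallel edges form a cycle of length 2; a single edge does not, because the
  edges of the list \<open>es\<close> are distinct.
\<close>

definition is_cycle_graph :: "('v, 'e) multigraph \<Rightarrow> bool" where
  "is_cycle_graph H \<longleftrightarrow>
     (\<exists>vs es. 2 \<le> length vs \<and> distinct vs \<and> set vs = vertices H \<and>
        distinct es \<and> set es = edges H \<and> length vs = length es \<and>
        (\<forall>i<length es. ends H (es ! i) = {vs ! i, vs ! ((i + 1) mod length vs)}))"

definition edge_coloring :: "('v, 'e) multigraph \<Rightarrow> nat \<Rightarrow> ('e \<Rightarrow> nat) \<Rightarrow> bool" where
  "edge_coloring G k c \<longleftrightarrow> (\<forall>e\<in>edges G. c e \<in> {1..k})"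

definition color_class ::
  "('v, 'e) multigraph \<Rightarrow> ('e \<Rightarrow> nat) \<Rightarrow> nat \<Rightarrow> ('v, 'e) multigraph" where
  "color_class G c j = G\<lparr>edges := {e \<in> edges G. c e = j}\<rparr>"

text \<open>
  Colour classes are spanning subgraphs, so a colour class that is a cycle is a
  Hamiltonian cycle of the whole graph.
\<close>

definition embeds_into_ham_decomposition ::
  "('v, 'e) multigraph \<Rightarrow> nat \<Rightarrow> ('e \<Rightarrow> nat) \<Rightarrow> ('v, 'e) multigraph \<Rightarrow> bool" where
  "embeds_into_ham_decomposition G k c G' \<longleftrightarrow>
     (\<exists>c'. edge_coloring G' k c' \<and> (\<forall>e\<in>edges G. c' e = c e) \<and>
        (\<forall>j\<in>{1..k}. is_cycle_graph (color_class G' c' j)))"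

text \<open>
  The multigraph with \<open>p\<close> parts of size \<open>a\<close>, in which two vertices are joined by
  \<open>lam\<close> edges if they are in the same part and by \<open>mu\<close> edges otherwise: the vertex \<open>(i, x)\<close> is the \<open>x\<close>-th vertex
  of the \<open>i\<close>-th part, and the edge \<open>({u, v}, n)\<close> is the \<open>n\<close>-th edge joining
  \<open>u\<close> and \<open>v\<close>.
\<close>

definition K ::
  "nat \<Rightarrow> nat \<Rightarrow> nat \<Rightarrow> nat \<Rightarrow> (nat \<times> nat, (nat \<times> nat) set \<times> nat) multigraph" where
  "K a p lam mu =
     \<lparr>vertices = {..<p} \<times> {..<a},
      edges = {({u, v}, n) | u v n.
        u \<in> {..<p} \<times> {..<a} \<and> v \<in> {..<p} \<times> {..<a} \<and> u \<noteq> v \<and>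
        n < (if fst u = fst v then lam else mu)},
      ends = fst\<rparr>"

lemma edges_K:
  "edges (K a p lam mu) = {({u, v}, n) | u v n.
     u \<in> {..<p} \<times> {..<a} \<and> v \<in> {..<p} \<times> {..<a} \<and> u \<noteq> v \<and>
     n < (if fst u = fst v then lam else mu)}"
  by (simp add: K_def)

lemma loopless_K: "loopless (K a p lam mu)"
  unfolding loopless_def edges_K by (auto simp: K_def card_insert_if)

lemma multiplicity_K:
  assumes "u \<in> vertices (K a p lam mu)" "v \<in> vertices (K a p lam mu)" "u \<noteq> v"
  shows "card {e \<in> edges (K a p lam mu). ends (K a p lam mu) e = {u, v}} =
           (if fst u = fst v then lam else mu)"
proof -
  have "{e \<in> edges (K a p lam mu). ends (K a p lam mu) e = {u, v}} =
          Pair {u, v} ` {..<(if fst u = fst v then lam else mu)}" (is "?L = ?R")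
  proof (intro equalityI subsetI)
    fix e assume "e \<in> ?L"
    then have e: "e \<in> edges (K a p lam mu)" "fst e = {u, v}" by (simp_all add: K_def)
    from e(1) obtain x y n where xy: "e = ({x, y}, n)"
      "n < (if fst x = fst y then lam else mu)"
      unfolding edges_K by blast
    with e(2) have "{x, y} = {u, v}" by simp
    then have "(fst x = fst y) = (fst u = fst v)" unfolding doubleton_eq_iff by auto
    with xy \<open>{x, y} = {u, v}\<close> show "e \<in> ?R" by simp
  next
    fix e assume "e \<in> ?R"
    then obtain n where n: "e = ({u, v}, n)" "n < (if fst u = fst v then lam else mu)"
      by blast
    have "u \<in> {..<p} \<times> {..<a}" "v \<in> {..<p} \<times> {..<a}"
      using assms(1,2) by (simp_all add: K_def)
    with n assms(3) have "e \<in> edges (K a p lam mu)" unfolding edges_K by blast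
    with n show "e \<in> ?L" by (simp add: K_def)
  qed
  moreover have "inj_on (Pair {u, v}) {..<(if fst u = fst v then lam else mu)}"
    by (simp add: inj_on_def)
  ultimately show ?thesis
    by (simp only: card_image card_lessThan)
qed

lemma K_induced_subgraph:
  "K a p lam mu = induced_subgraph (K a (p + r) lam mu) ({..<p} \<times> {..<a})"
proof -
  have "edges (K a p lam mu) =
          {e \<in> edges (K a (p + r) lam mu). fst e \<subseteq> {..<p} \<times> {..<a}}"
  proof (intro equalityI subsetI)
    fix e assume "e \<in> edges (K a p lam mu)"
    then obtain u v n where e: "e = ({u, v}, n)" "u \<in> {..<p} \<times> {..<a}"
      "v \<in> {..<p} \<times> {..<a}" "u \<noteq> v" "n < (if fst u = fst v then lam else mu)"
      unfolding edges_K by blast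
    have "{..<p} \<times> {..<a} \<subseteq> {..<p + r} \<times> {..<a}" by auto
    with e have "u \<in> {..<p + r} \<times> {..<a}" "v \<in> {..<p + r} \<times> {..<a}" by blast+
    with e have "e \<in> edges (K a (p + r) lam mu)" unfolding edges_K by blast
    with e show "e \<in> {e \<in> edges (K a (p + r) lam mu). fst e \<subseteq> {..<p} \<times> {..<a}}"
      by simp
  next
    fix e assume "e \<in> {e \<in> edges (K a (p + r) lam mu). fst e \<subseteq> {..<p} \<times> {..<a}}"
    then obtain u v n where e: "e = ({u, v}, n)" "{u, v} \<subseteq> {..<p} \<times> {..<a}"
      "u \<noteq> v" "n < (if fst u = fst v then lam else mu)"
      unfolding edges_K by force
    then show "e \<in> edges (K a p lam mu)" unfolding edges_K by blast
  qed
  moreover have "{..<p} \<times> {..<a} = ({..<p + r} \<times> {..<a}) \<inter> ({..<p} \<times> {..<a})"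
    by auto
  ultimately show ?thesis
    by (simp add: induced_subgraph_def K_def)
qed

end

theory Submission
  imports Defs
begin

text \<open>
  Necessity is counting: a Hamiltonian cycle meets each proper set of vertices in a linear forest,
  and each vertex has degree two in each color.

  For sufficiency, amalgamate all \<open>a r\<close> new vertices into a single vertex \<open>\<alpha>\<close>. In color \<open>j\<close>, joining
  \<open>\<alpha>\<close> to each old vertex until that vertex has degree two uses \<open>2 \<omega>\<^sub>j\<close> edges, and \<open>a r - \<omega>\<^sub>j\<close> loops
  at \<open>\<alpha>\<close> are left. The condition on the \<open>s\<^sub>j\<close> allows one to declare \<open>r x\<^sub>j\<close> of these loops to be edges
  inside new parts, \<open>x\<^sub>j \<le> a - 1\<close> for each part, so that the declared loops have the right total
  number. Without them, \<open>\<alpha>\<close> is split into \<open>r\<close> vertices, one for each new part; then \<open>x\<^sub>j\<close> loops are put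
  back at each of them, and each is split into \<open>a\<close> vertices.

  Vertices are split off one at a time. The half-edges moved to the new vertex are chosen from an
  equitable partition of the half-edges at \<open>\<alpha>\<close> with respect to two laminar families: colors, refined by the
  components of the color class minus \<open>\<alpha>\<close>, and the other end vertices. Equity makes all degrees
  and multiplicities right, and it keeps color classes connected because all degrees are even.
  At the end every color class is connected and 2-regular, hence a Hamiltonian cycle.
\<close>

section \<open>Equitable colorings for two laminar families\<close>

text \<open>Equitable splitting treats all vertices amalgamated in one vertex alike, so a single
  pass cannot give multiplicity \<open>lam\<close> inside the new parts and \<open>mu\<close>
  between them. In the first pass each new vertex therefore stands for a whole part, two of them
  being joined by \<open>mu * a ^ 2\<close> edges, and the edges inside parts are held back. The
  degree of \<open>\<alpha>\<close> in each color has to be shared equally among the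
  \<open>r\<close> parts, so color j holds back the same number \<open>x j\<close> for each part,
  that is \<open>r * x j\<close> loops, and the sum of the \<open>x j\<close> must be
  \<open>lam * a * (a - 1) / 2\<close>. The largest possible \<open>x j\<close> is
  \<open>(a r - \<omega>\<^sub>j) div r\<close>; as \<open>\<omega>\<^sub>j\<close> and
  \<open>s\<^sub>j\<close> are congruent, the remainder of this division is
  \<open>r - s\<^sub>j\<close>, and comparing the sum of these quotients with the number of loops
  gives exactly the hypothesis on the \<open>s\<^sub>j\<close>. A part keeps degree
  \<open>2 * (a - x j)\<close> in color j, which is even, and positive because
  \<open>\<omega>\<^sub>j\<close> is at least 1. The partitions use two laminar families because
  each of them is served by one matching, and the union of two matchings is bipartite, while three
  could contain odd cycles.\<close>

definition matching_on :: "'a set \<Rightarrow> ('a \<Rightarrow> 'a \<Rightarrow> bool) \<Rightarrow> bool" where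
  "matching_on X M \<longleftrightarrow> (\<forall>x y. M x y \<longrightarrow> x \<in> X \<and> y \<in> X \<and> x \<noteq> y \<and> M y x) \<and>
     (\<forall>x y z. M x y \<longrightarrow> M x z \<longrightarrow> y = z)"

text \<open>The components of a union of two matchings are paths and cycles whose pairs alternate
  between the matchings, so all cycles are even. Induction on the cardinality avoids following these
  paths.\<close>

lemma two_matchings_colouring:
  assumes "finite X" "matching_on X M" "matching_on X N"
  shows "\<exists>\<chi> :: 'a \<Rightarrow> bool. \<forall>x y. M x y \<or> N x y \<longrightarrow> \<chi> x \<noteq> \<chi> y"
proof -
  have "\<forall>M N. card X = n \<longrightarrow> finite X \<longrightarrow> matching_on X M \<longrightarrow> matching_on X N \<longrightarrow>
     (\<exists>\<chi> :: 'a \<Rightarrow> bool. \<forall>x y. M x y \<or> N x y \<longrightarrow> \<chi> x \<noteq> \<chi> y)" for n and X :: "'a set"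
  proof (induction n arbitrary: X rule: less_induct)
    case (less n X)
    have step: "\<exists>\<chi> :: 'a \<Rightarrow> bool. \<forall>x y. M x y \<or> N x y \<longrightarrow> \<chi> x \<noteq> \<chi> y"
      if n: "card X = n" and fin: "finite X" and M: "matching_on X M" and N: "matching_on X N"
        and xy: "M x y" for M N x y
    proof -
      let ?X = "X - {x, y}"
      \<comment> \<open>Remove the pair \<open>x, y\<close> and match the \<open>N\<close>-partners of \<open>x\<close> and \<open>y\<close> with each other: they then
        get different colors, so \<open>x\<close> and \<open>y\<close> can each take the opposite of its partner's color.\<close>
      define M' where "M' u v \<longleftrightarrow> M u v \<and> u \<in> ?X \<and> v \<in> ?X" for u v
      define N' where "N' u v \<longleftrightarrow> u \<in> ?X \<and> v \<in> ?X \<and>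
        (N u v \<or> N u x \<and> N y v \<or> N u y \<and> N x v)" for u v
      have xyX: "x \<in> X" "y \<in> X" "x \<noteq> y" "M y x" using M xy unfolding matching_on_def by blast+
      have Ns: "N u v \<Longrightarrow> N v u" "N u v \<Longrightarrow> u \<noteq> v" "N u v \<Longrightarrow> v \<in> X" "N u v \<Longrightarrow> N u v' \<Longrightarrow> v = v'" for u v v'
        using N unfolding matching_on_def by blast+
      have M1: "matching_on ?X M'" using M unfolding matching_on_def M'_def by blast
      have "N' u v \<Longrightarrow> u \<in> ?X \<and> v \<in> ?X" for u v unfolding N'_def by blast
      moreover have "N' u v \<Longrightarrow> N' v u" for u v unfolding N'_def using Ns(1) by blast
      moreover have "N' u v \<Longrightarrow> u \<noteq> v" for u v unfolding N'_def using Ns(1,2) Ns(4)[of u x y] xyX(3) by blast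
      moreover have "N' u v \<Longrightarrow> N' u z \<Longrightarrow> v = z" for u v z
        unfolding N'_def using Ns(4)[of u] Ns(4)[of x] Ns(4)[of y] xyX(3) by blast
      ultimately have N1: "matching_on ?X N'" unfolding matching_on_def by blast
      have "card ?X < n" unfolding n[symmetric] using fin xyX by (intro psubset_card_mono) auto
      from less.IH[OF this] M1 N1 fin obtain \<chi> :: "'a \<Rightarrow> bool"
        where \<chi>: "\<And>u v. M' u v \<or> N' u v \<Longrightarrow> \<chi> u \<noteq> \<chi> v" by (metis finite_Diff)
      \<comment> \<open>If only one of \<open>x\<close>, \<open>y\<close> has a partner under
        \<open>N\<close> outside the pair, the other one takes the color of that partner; if neither
        has, the colors are \<open>True\<close> and \<open>False\<close>.\<close>
      define \<psi> where "\<psi> z = (if z = x then (if \<exists>v. v \<noteq> y \<and> N x v then \<not> \<chi> (THE v. N x v)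
           else if \<exists>v. v \<noteq> x \<and> N y v then \<chi> (THE v. N y v) else True)
         else if z = y then (if \<exists>v. v \<noteq> x \<and> N y v then \<not> \<chi> (THE v. N y v)
           else if \<exists>v. v \<noteq> y \<and> N x v then \<chi> (THE v. N x v) else False) else \<chi> z)" for z
      have The: "(THE v. N u v) = v" if "N u v" for u v using that Ns by blast
      have NX: "N x v \<Longrightarrow> v \<noteq> y \<Longrightarrow> \<psi> x = (\<not> \<chi> v) \<and> \<psi> v = \<chi> v" for v
        unfolding \<psi>_def using The[of x v] Ns xyX by (smt (verit))
      have NY: "N y v \<Longrightarrow> v \<noteq> x \<Longrightarrow> \<psi> y = (\<not> \<chi> v) \<and> \<psi> v = \<chi> v" for v
        unfolding \<psi>_def using The[of y v] Ns xyX by (smt (verit))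
      have neq: "\<psi> x \<noteq> \<psi> y"
      proof (cases "\<exists>v. v \<noteq> y \<and> N x v")
        case True
        then obtain v where v: "v \<noteq> y" "N x v" by blast
        show ?thesis
        proof (cases "\<exists>u. u \<noteq> x \<and> N y u")
          case True
          then obtain u where u: "u \<noteq> x" "N y u" by blast
          have "N' v u" unfolding N'_def using u v Ns by (smt (verit) Diff_iff insert_iff singletonD)
          then show ?thesis using NX[of v] NY[of u] u v \<chi>[of v u] by simp
        next
          case False
          then show ?thesis using NX[of v] v The[of x v] xyX unfolding \<psi>_def by auto
        qed
      next
        case nx: False
        show ?thesis
        proof (cases "\<exists>u. u \<noteq> x \<and> N y u")
          case True
          then show ?thesis using nx xyX unfolding \<psi>_def by auto
        next
          case False
          then show ?thesis using nx xyX unfolding \<psi>_def by auto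
        qed
      qed
      have "\<psi> u \<noteq> \<psi> v" if uv: "M u v \<or> N u v" for u v
      proof (cases "u \<in> {x,y} \<or> v \<in> {x,y}")
        case False
        then have "M' u v \<or> N' u v" using uv M N unfolding M'_def N'_def matching_on_def by blast
        then show ?thesis using \<chi> False unfolding \<psi>_def by auto
      next
        case True
        show ?thesis
        proof (cases "{u,v} = {x,y}")
          case True
          then show ?thesis using neq by (auto simp: doubleton_eq_iff)
        next
          case False
          then have "\<not> M u v" using True M xy xyX unfolding matching_on_def by blast
          then have "N u v" "N v u" using uv Ns by blast+
          then show ?thesis using True False NX[of u] NX[of v] NY[of u] NY[of v] by auto
        qed
      qed
      then show ?thesis by blast
    qed
    show ?case
    proof (intro allI impI)
      fix M N assume a: "card X = n" "finite X" "matching_on X M" "matching_on X N"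
      \<comment> \<open>If \<open>M\<close> is empty the roles of \<open>M\<close> and
        \<open>N\<close> are exchanged; if both are empty any coloring will do.\<close>
      show "\<exists>\<chi> :: 'a \<Rightarrow> bool. \<forall>x y. M x y \<or> N x y \<longrightarrow> \<chi> x \<noteq> \<chi> y"
        using step[OF a] step[OF a(1,2,4,3)] by metis
    qed
  qed
  with assms show ?thesis by blast
qed

text \<open>Pairing off elements inside the fibres of \<open>f\<close> as long as possible leaves at
  most one of each fibre unmatched; the last clause says this for two elements at a time.\<close>

lemma ex_fibre_matching:
  assumes "finite X"
  shows "\<exists>M. matching_on X M \<and> (\<forall>x y. M x y \<longrightarrow> f x = f y) \<and>
    (\<forall>x\<in>X. \<forall>y\<in>X. f x = f y \<longrightarrow> x \<noteq> y \<longrightarrow> (\<exists>z. M x z) \<or> (\<exists>z. M y z))"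
  using assms
proof (induction "card X" arbitrary: X rule: less_induct)
  case less
  show ?case
  proof (cases "\<exists>x\<in>X. \<exists>y\<in>X. x \<noteq> y \<and> f x = f y")
    case True
    then obtain x y where xy: "x \<in> X" "y \<in> X" "x \<noteq> y" "f x = f y" by blast
    have "card (X - {x, y}) < card X" using less.prems xy by (intro psubset_card_mono) auto
    from less.hyps[OF this] less.prems obtain M where
      M: "matching_on (X - {x, y}) M" "\<And>x y. M x y \<Longrightarrow> f x = f y"
      "\<And>u v. u \<in> X - {x, y} \<Longrightarrow> v \<in> X - {x, y} \<Longrightarrow> f u = f v \<Longrightarrow> u \<noteq> v \<Longrightarrow> (\<exists>z. M u z) \<or> (\<exists>z. M v z)"
      by blast
    let ?M = "\<lambda>u v. M u v \<or> u = x \<and> v = y \<or> u = y \<and> v = x"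
    have "matching_on X ?M" using M(1) xy unfolding matching_on_def by blast
    moreover have "\<forall>u v. ?M u v \<longrightarrow> f u = f v" using M(2) xy by auto
    moreover have "\<forall>u\<in>X. \<forall>v\<in>X. f u = f v \<longrightarrow> u \<noteq> v \<longrightarrow> (\<exists>z. ?M u z) \<or> (\<exists>z. ?M v z)"
      using M(3) by blast
    ultimately show ?thesis by (intro exI[of _ ?M]) blast
  next
    case False
    then show ?thesis by (intro exI[of _ "\<lambda>_ _. False"]) (auto simp: matching_on_def)
  qed
qed

section \<open>Halving a set evenly with respect to two laminar families\<close>

definition balanced :: "nat \<Rightarrow> nat \<Rightarrow> bool" where
  "balanced m n \<longleftrightarrow> m \<le> n + 1 \<and> n \<le> m + 1"

text \<open>Pairs matched inside \<open>Z\<close> contribute one element to each color, and the set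
  \<open>R\<close> of the others has at most one element.\<close>

lemma balanced_if_matched:
  assumes "finite Z" and M: "matching_on X M" and \<chi>: "\<And>x y. M x y \<Longrightarrow> \<chi> x \<noteq> \<chi> y"
    and one: "\<And>x y. x \<in> Z \<Longrightarrow> y \<in> Z \<Longrightarrow> x \<noteq> y \<Longrightarrow> (\<exists>z\<in>Z. M x z) \<or> (\<exists>z\<in>Z. M y z)"
  shows "balanced (card {z\<in>Z. \<chi> z}) (card {z\<in>Z. \<not> \<chi> z})"
proof -
  define R where "R = {z\<in>Z. \<not> (\<exists>y\<in>Z. M z y)}"
  have finR: "finite R" using assms(1) unfolding R_def by simp
  have R: "card R \<le> 1"
  proof -
    have "x = y" if "x \<in> R" "y \<in> R" for x y using that one[of x y] unfolding R_def by blast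
    then show ?thesis using card_le_Suc0_iff_eq[OF finR] by simp
  qed
  define f where "f x = (THE y. M x y)" for x
  have f: "f x = y" if "M x y" for x y using that M unfolding f_def matching_on_def by blast
  have "bij_betw f {z\<in>Z-R. \<chi> z} {z\<in>Z-R. \<not> \<chi> z}"
  proof (rule bij_betw_byWitness[where f' = f])
    have *: "\<exists>y\<in>Z. M x y \<and> M y x \<and> f x = y \<and> f y = x \<and> \<chi> x \<noteq> \<chi> y \<and> y \<notin> R" if "x \<in> Z - R" for x
    proof -
      from that obtain y where y: "y \<in> Z" "M x y" unfolding R_def by blast
      moreover have "M y x" using y M unfolding matching_on_def by blast
      ultimately show ?thesis using f \<chi> that unfolding R_def by blast
    qed
    show "\<forall>a\<in>{z \<in> Z - R. \<chi> z}. f (f a) = a" "\<forall>a\<in>{z \<in> Z - R. \<not> \<chi> z}. f (f a) = a"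
      "f ` {z \<in> Z - R. \<chi> z} \<subseteq> {z \<in> Z - R. \<not> \<chi> z}" "f ` {z \<in> Z - R. \<not> \<chi> z} \<subseteq> {z \<in> Z - R. \<chi> z}"
      using * by (fastforce dest!: *)+
  qed
  then have eq: "card {z\<in>Z-R. \<chi> z} = card {z\<in>Z-R. \<not> \<chi> z}" by (rule bij_betw_same_card)
  have "card {z\<in>Z. P z} = card {z\<in>Z-R. P z} + card {z\<in>R. P z}" for P
  proof -
    have "{z\<in>Z. P z} = {z\<in>Z-R. P z} \<union> {z\<in>R. P z}" unfolding R_def by blast
    then show ?thesis using assms(1) finR by (simp add: card_Un_disjoint disjoint_iff)
  qed
  from this[of \<chi>] this[of "\<lambda>z. \<not> \<chi> z"] eq
  have "card {z\<in>Z. \<chi> z} + card {z\<in>R. \<not> \<chi> z} = card {z\<in>Z. \<not> \<chi> z} + card {z\<in>R. \<chi> z}" by simp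
  moreover have "card {z\<in>R. P z} \<le> 1" for P
    by (rule order_trans[OF card_mono[OF finR] R]) blast
  from this[of \<chi>] this[of "\<lambda>z. \<not> \<chi> z"]
  have "card {z\<in>R. \<chi> z} \<le> 1" "card {z\<in>R. \<not> \<chi> z} \<le> 1" .
  ultimately show ?thesis unfolding balanced_def by linarith
qed

text \<open>\<open>M1\<close> pairs elements inside blocks and \<open>M2\<close> pairs the leftovers
  inside colors. As blocks refine colors, together they form a single matching that misses at most
  one element of each color, while its part \<open>M1\<close> misses at most one of each block. The
  second matching \<open>N\<close> does the same for vertices, so a coloring proper for both
  matchings is balanced on all three kinds of sets.\<close>

lemma balanced_halving:
  assumes "finite X" and ref: "\<And>x y. x \<in> X \<Longrightarrow> y \<in> X \<Longrightarrow> blk x = blk y \<Longrightarrow> col x = col y"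
  shows "\<exists>\<chi>. \<forall>Z. (\<exists>b. Z = {x\<in>X. blk x = b}) \<or> (\<exists>b. Z = {x\<in>X. col x = b}) \<or> (\<exists>b. Z = {x\<in>X. vtx x = b})
    \<longrightarrow> balanced (card {z\<in>Z. \<chi> z}) (card {z\<in>Z. \<not> \<chi> z})"
proof -
  from ex_fibre_matching[OF assms(1), of blk] obtain M1 where
    M1: "matching_on X M1" "\<And>x y. M1 x y \<Longrightarrow> blk x = blk y"
      "\<And>x y. x \<in> X \<Longrightarrow> y \<in> X \<Longrightarrow> blk x = blk y \<Longrightarrow> x \<noteq> y \<Longrightarrow> (\<exists>z. M1 x z) \<or> (\<exists>z. M1 y z)"
    by blast
  define Y where "Y = {x\<in>X. \<not> (\<exists>z. M1 x z)}"
  have "finite Y" using assms(1) unfolding Y_def by simp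
  from ex_fibre_matching[OF this, of col] obtain M2 where
    M2: "matching_on Y M2" "\<And>x y. M2 x y \<Longrightarrow> col x = col y"
      "\<And>x y. x \<in> Y \<Longrightarrow> y \<in> Y \<Longrightarrow> col x = col y \<Longrightarrow> x \<noteq> y \<Longrightarrow> (\<exists>z. M2 x z) \<or> (\<exists>z. M2 y z)"
    by blast
  from ex_fibre_matching[OF assms(1), of vtx] obtain N where
    N: "matching_on X N" "\<And>x y. N x y \<Longrightarrow> vtx x = vtx y"
      "\<And>x y. x \<in> X \<Longrightarrow> y \<in> X \<Longrightarrow> vtx x = vtx y \<Longrightarrow> x \<noteq> y \<Longrightarrow> (\<exists>z. N x z) \<or> (\<exists>z. N y z)"
    by blast
  let ?M = "\<lambda>x y. M1 x y \<or> M2 x y"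
  have M: "matching_on X ?M" using M1(1) M2(1) unfolding matching_on_def Y_def by blast
  from two_matchings_colouring[OF assms(1) M N(1)] obtain \<chi> :: "'a \<Rightarrow> bool"
    where \<chi>: "\<And>x y. ?M x y \<Longrightarrow> \<chi> x \<noteq> \<chi> y" "\<And>x y. N x y \<Longrightarrow> \<chi> x \<noteq> \<chi> y" by blast
  have MX: "M1 x y \<Longrightarrow> x \<in> X \<and> y \<in> X" "M2 x y \<Longrightarrow> x \<in> X \<and> y \<in> X" "N x y \<Longrightarrow> x \<in> X \<and> y \<in> X" for x y
    using M1(1) M2(1) N(1) unfolding matching_on_def Y_def by blast+
  have "balanced (card {z\<in>Z. \<chi> z}) (card {z\<in>Z. \<not> \<chi> z})"
    if "(\<exists>b. Z = {x\<in>X. blk x = b}) \<or> (\<exists>b. Z = {x\<in>X. col x = b}) \<or> (\<exists>b. Z = {x\<in>X. vtx x = b})" for Z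
  proof -
    have fin: "finite Z" using that assms(1) by auto
    from that consider b where "Z = {x\<in>X. blk x = b}" | b where "Z = {x\<in>X. col x = b}" | b where "Z = {x\<in>X. vtx x = b}"
      by blast
    then show ?thesis
    proof cases
      case 1
      show ?thesis
        by (rule balanced_if_matched[OF fin M \<chi>(1)], assumption)
          (unfold 1, use M1(2,3) MX(1) in \<open>(simp, metis)\<close>)
    next
      case 2
      have "(\<exists>z\<in>Z. ?M x z) \<or> (\<exists>z\<in>Z. ?M y z)" if "x \<in> Z" "y \<in> Z" "x \<noteq> y" for x y
      proof -
        have *: "\<exists>z\<in>Z. ?M u z" if "u \<in> Z" "?M u z" for u z
          using that M1(2)[of u z] M2(2)[of u z] MX[of u z] ref[of u z] unfolding 2 by auto
        have "(\<exists>z. ?M x z) \<or> (\<exists>z. ?M y z)"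
          using that M2(3)[of x y] unfolding 2 Y_def by auto
        with * that show ?thesis by blast
      qed
      then show ?thesis using balanced_if_matched[where \<chi> = \<chi>, OF fin M \<chi>(1)] by blast
    next
      case 3
      show ?thesis
        by (rule balanced_if_matched[OF fin N(1) \<chi>(2)], assumption)
          (unfold 3, use N(2,3) MX(3) in \<open>(simp, metis)\<close>)
    qed
  qed
  then show ?thesis by blast
qed

section \<open>From halves to equitable partitions into \<open>h\<close> classes\<close>

lemma balanced_squares_int:
  fixes a b a' b' :: int
  assumes sum: "a + b = a' + b'" and d: "\<bar>a' - b'\<bar> \<le> 1"
  shows "a'\<^sup>2 + b'\<^sup>2 \<le> a\<^sup>2 + b\<^sup>2" and "b + 2 \<le> a \<Longrightarrow> a'\<^sup>2 + b'\<^sup>2 < a\<^sup>2 + b\<^sup>2"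
proof -
  \<comment> \<open>By this identity a sum of two squares depends, for a fixed sum of the bases,
    only on their difference.\<close>
  have "2 * (x\<^sup>2 + y\<^sup>2) = (x + y)\<^sup>2 + (x - y)\<^sup>2" for x y :: int
    by (simp add: power2_eq_square algebra_simps)
  from this[of a b] this[of a' b']
  have id: "2 * (a\<^sup>2 + b\<^sup>2) = (a' + b')\<^sup>2 + (a - b)\<^sup>2" "2 * (a'\<^sup>2 + b'\<^sup>2) = (a' + b')\<^sup>2 + (a' - b')\<^sup>2"
    unfolding sum .
  have le: "2 * x = s + u \<Longrightarrow> 2 * y = s + v \<Longrightarrow> v \<le> u \<Longrightarrow> y \<le> x"
    and less: "2 * x = s + u \<Longrightarrow> 2 * y = s + v \<Longrightarrow> v < u \<Longrightarrow> y < x" for x y s u v :: int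
    by linarith+
  \<comment> \<open>Equal sums give differences of the same parity, and an absolute value of at most
    1 is the smallest of its parity.\<close>
  have "\<bar>a' - b'\<bar> \<le> \<bar>a - b\<bar>"
  proof -
    have eq: "a - b = (a' - b') + 2 * (a - a')" using sum by simp
    from d have "a' - b' = -1 \<or> a' - b' = 0 \<or> a' - b' = 1" by linarith
    moreover have "a - a' = 0 \<or> a - a' \<ge> 1 \<or> a - a' \<le> -1" by linarith
    ultimately show ?thesis unfolding eq by (elim disjE) simp_all
  qed
  then have "(a' - b')\<^sup>2 \<le> (a - b)\<^sup>2" by (simp only: abs_le_square_iff)
  with id show "a'\<^sup>2 + b'\<^sup>2 \<le> a\<^sup>2 + b\<^sup>2" by (rule le)
  assume "b + 2 \<le> a"
  then have "\<bar>a' - b'\<bar> < \<bar>a - b\<bar>" using d by linarith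
  then have "(a' - b')\<^sup>2 < (a - b)\<^sup>2" 
    unfolding linorder_not_le[symmetric] abs_le_square_iff .
  with id show "a'\<^sup>2 + b'\<^sup>2 < a\<^sup>2 + b\<^sup>2" by (rule less)
qed

lemma balanced_squares:
  fixes a b a' b' :: nat
  assumes "a' + b' = a + b" "balanced a' b'"
  shows "a'\<^sup>2 + b'\<^sup>2 \<le> a\<^sup>2 + b\<^sup>2" and "b + 2 \<le> a \<Longrightarrow> a'\<^sup>2 + b'\<^sup>2 < a\<^sup>2 + b\<^sup>2"
proof -
  have sum: "int a + int b = int a' + int b'" using arg_cong[OF assms(1), of int] by simp
  have d: "\<bar>int a' - int b'\<bar> \<le> 1" using assms(2) unfolding balanced_def by linarith
  show "a'\<^sup>2 + b'\<^sup>2 \<le> a\<^sup>2 + b\<^sup>2" using balanced_squares_int(1)[OF sum d]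
    by (simp only: of_nat_power[symmetric] of_nat_add[symmetric] of_nat_le_iff)
  assume "b + 2 \<le> a"
  then have "int b + 2 \<le> int a" by linarith
  from balanced_squares_int(2)[OF sum d this] show "a'\<^sup>2 + b'\<^sup>2 < a\<^sup>2 + b\<^sup>2"
    by (simp only: of_nat_power[symmetric] of_nat_add[symmetric] of_nat_less_iff)
qed

text \<open>Halving the union of two classes anew keeps, in every member of \<open>F\<close>, the
  sum of the two class sizes. The sum of their squares then cannot grow, and it drops in a member
  where the sizes differed by at least 2.\<close>

lemma equitable_colouring:
  fixes F :: "'a set set" and h :: nat
  assumes finF: "finite F" and finX: "finite X" and sub: "\<And>Z. Z \<in> F \<Longrightarrow> Z \<subseteq> X" and h: "h \<ge> 1"
    and halving: "\<And>Y. Y \<subseteq> X \<Longrightarrow> \<exists>\<chi>. \<forall>Z\<in>F. balanced (card {z \<in> Z \<inter> Y. \<chi> z}) (card {z \<in> Z \<inter> Y. \<not> \<chi> z})"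
  shows "\<exists>\<psi>. (\<forall>x. \<psi> x < h) \<and> (\<forall>Z\<in>F. \<forall>i<h. \<forall>j<h. card {z\<in>Z. \<psi> z = i} \<le> card {z\<in>Z. \<psi> z = j} + 1)"
proof -
  \<comment> \<open>In a coloring minimizing \<open>\<Phi>\<close>, two unbalanced classes could be halved anew to decrease \<open>\<Phi>\<close>.\<close>
  define \<Phi> where "\<Phi> \<psi> = (\<Sum>Z\<in>F. \<Sum>i<h. (card {z\<in>Z. \<psi> z = i})\<^sup>2)" for \<psi> :: "'a \<Rightarrow> nat"
  have "\<exists>\<psi>. (\<forall>x. \<psi> x < h) \<and> (\<forall>\<psi>'. (\<forall>x. \<psi>' x < h) \<longrightarrow> \<Phi> \<psi> \<le> \<Phi> \<psi>')"
    by (rule ex_has_least_nat[of "\<lambda>\<psi>. \<forall>x. \<psi> x < h" "\<lambda>_. 0"]) (use h in simp)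
  then obtain \<psi> where \<psi>: "\<And>x. \<psi> x < h" "\<And>\<psi>'. (\<And>x. \<psi>' x < h) \<Longrightarrow> \<Phi> \<psi> \<le> \<Phi> \<psi>'" by blast
  have "card {z\<in>Z. \<psi> z = i} \<le> card {z\<in>Z. \<psi> z = j} + 1" if Z: "Z \<in> F" and ij: "i < h" "j < h" for Z i j
  proof (rule ccontr)
    assume neg: "\<not> ?thesis"
    then have "i \<noteq> j" by auto
    define Y where "Y = {x\<in>X. \<psi> x = i \<or> \<psi> x = j}"
    from halving[of Y] obtain \<chi> where
      \<chi>: "\<And>Z. Z \<in> F \<Longrightarrow> balanced (card {z \<in> Z \<inter> Y. \<chi> z}) (card {z \<in> Z \<inter> Y. \<not> \<chi> z})"
      unfolding Y_def by blast
    define \<psi>' where "\<psi>' x = (if x \<in> Y then (if \<chi> x then i else j) else if x \<in> X then \<psi> x else 0)" for x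
    have \<psi>': "\<psi>' x < h" for x unfolding \<psi>'_def using \<psi>(1) ij h by auto
    have split: "(\<Sum>l<h. f l) = f i + f j + (\<Sum>l\<in>{..<h}-{i,j}. f l)" for f :: "nat \<Rightarrow> nat"
      using ij \<open>i \<noteq> j\<close> by (subst sum.subset_diff[of "{i,j}"]) auto
    have rest: "{z\<in>W. \<psi>' z = l} = {z\<in>W. \<psi> z = l}" if "W \<in> F" "l \<in> {..<h}-{i,j}" for W l
      using sub[OF that(1)] that(2) unfolding \<psi>'_def Y_def by auto
    have wi: "{z\<in>W. \<psi>' z = i} = {z \<in> W \<inter> Y. \<chi> z}" if "W \<in> F" for W
      using sub[OF that] \<open>i \<noteq> j\<close> unfolding \<psi>'_def Y_def by auto
    have wj: "{z\<in>W. \<psi>' z = j} = {z \<in> W \<inter> Y. \<not> \<chi> z}" if "W \<in> F" for W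
      using sub[OF that] \<open>i \<noteq> j\<close> unfolding \<psi>'_def Y_def by auto
    have tot: "card {z\<in>W. \<psi>' z = i} + card {z\<in>W. \<psi>' z = j} = card {z\<in>W. \<psi> z = i} + card {z\<in>W. \<psi> z = j}"
      if "W \<in> F" for W
    proof -
      have "finite W" using sub[OF that] finX finite_subset by blast
      then have "card {z\<in>W. \<psi>' z = i} + card {z\<in>W. \<psi>' z = j} = card ({z\<in>W. \<psi>' z = i} \<union> {z\<in>W. \<psi>' z = j})"
        "card {z\<in>W. \<psi> z = i} + card {z\<in>W. \<psi> z = j} = card ({z\<in>W. \<psi> z = i} \<union> {z\<in>W. \<psi> z = j})"
        using \<open>i \<noteq> j\<close> by (subst card_Un_disjoint; force)+
      moreover have "{z\<in>W. \<psi>' z = i} \<union> {z\<in>W. \<psi>' z = j} = {z\<in>W. \<psi> z = i} \<union> {z\<in>W. \<psi> z = j}"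
        unfolding wi[OF that] wj[OF that] using sub[OF that] unfolding Y_def by auto
      ultimately show ?thesis by simp
    qed
    have le: "(\<Sum>l<h. (card {z\<in>W. \<psi>' z = l})\<^sup>2) \<le> (\<Sum>l<h. (card {z\<in>W. \<psi> z = l})\<^sup>2)" if "W \<in> F" for W
      unfolding split using balanced_squares(1)[OF tot[OF that]] \<chi>[OF that] rest[OF that]
      by (simp add: wi[OF that] wj[OF that])
    have "(\<Sum>l<h. (card {z\<in>Z. \<psi>' z = l})\<^sup>2) < (\<Sum>l<h. (card {z\<in>Z. \<psi> z = l})\<^sup>2)"
      unfolding split using balanced_squares(2)[OF tot[OF Z]] \<chi>[OF Z] rest[OF Z] neg
      by (simp add: wi[OF Z] wj[OF Z])
    then have "\<Phi> \<psi>' < \<Phi> \<psi>" unfolding \<Phi>_def using le Z finF by (intro sum_strict_mono_ex1) auto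
    moreover have "\<Phi> \<psi> \<le> \<Phi> \<psi>'" by (rule \<psi>(2)) (rule \<psi>')
    ultimately show False by simp
  qed
  with \<psi>(1) show ?thesis by blast
qed

text \<open>\<open>S\<close> is one of \<open>h\<close> equitable classes. The two strict
  inequalities say that \<open>card (Z \<inter> S)\<close> is \<open>card Z / h\<close> rounded up
  or down, written without division.\<close>

lemma equitable_subset:
  fixes h :: nat
  assumes finX: "finite X" and ref: "\<And>x y. x \<in> X \<Longrightarrow> y \<in> X \<Longrightarrow> blk x = blk y \<Longrightarrow> col x = col y" and h: "h \<ge> 1"
  shows "\<exists>S\<subseteq>X. \<forall>Z. (\<exists>b. Z = {x\<in>X. blk x = b}) \<or> (\<exists>b. Z = {x\<in>X. col x = b}) \<or> (\<exists>b. Z = {x\<in>X. vtx x = b})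
    \<longrightarrow> h * card (Z \<inter> S) < card Z + h \<and> card Z < h * card (Z \<inter> S) + h"
proof -
  define F where "F = {Z. Z \<subseteq> X \<and> ((\<exists>b. Z = {x\<in>X. blk x = b}) \<or> (\<exists>b. Z = {x\<in>X. col x = b}) \<or> (\<exists>b. Z = {x\<in>X. vtx x = b}))}"
  have finF: "finite F" by (rule finite_subset[of _ "Pow X"]) (auto simp: F_def finX)
  have sub: "Z \<subseteq> X" if "Z \<in> F" for Z using that unfolding F_def by blast
  have halv: "\<exists>\<chi>. \<forall>Z\<in>F. balanced (card {z \<in> Z \<inter> Y. \<chi> z}) (card {z \<in> Z \<inter> Y. \<not> \<chi> z})" if "Y \<subseteq> X" for Y
  proof -
    have finY: "finite Y" using that finX finite_subset by blast
    have refY: "\<And>x y. x \<in> Y \<Longrightarrow> y \<in> Y \<Longrightarrow> blk x = blk y \<Longrightarrow> col x = col y" using ref that by blast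
    from balanced_halving[where X = Y and blk = blk and col = col and vtx = vtx, OF finY refY] obtain \<chi> where
      \<chi>: "\<And>Z. (\<exists>b. Z = {x\<in>Y. blk x = b}) \<or> (\<exists>b. Z = {x\<in>Y. col x = b}) \<or> (\<exists>b. Z = {x\<in>Y. vtx x = b})
       \<Longrightarrow> balanced (card {z\<in>Z. \<chi> z}) (card {z\<in>Z. \<not> \<chi> z})" by blast
    have "balanced (card {z \<in> Z \<inter> Y. \<chi> z}) (card {z \<in> Z \<inter> Y. \<not> \<chi> z})" if "Z \<in> F" for Z
    proof (rule \<chi>)
      have "{x\<in>X. P x} \<inter> Y = {x\<in>Y. P x}" for P using \<open>Y \<subseteq> X\<close> by blast
      then show "(\<exists>b. Z \<inter> Y = {x\<in>Y. blk x = b}) \<or> (\<exists>b. Z \<inter> Y = {x\<in>Y. col x = b}) \<or> (\<exists>b. Z \<inter> Y = {x\<in>Y. vtx x = b})"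
        using that unfolding F_def by auto
    qed
    then show ?thesis by blast
  qed
  from equitable_colouring[OF finF finX sub h halv] obtain \<psi> where
    \<psi>: "\<And>x. \<psi> x < h" "\<And>Z i j. Z \<in> F \<Longrightarrow> i < h \<Longrightarrow> j < h \<Longrightarrow> card {z\<in>Z. \<psi> z = i} \<le> card {z\<in>Z. \<psi> z = j} + 1"
    by blast
  define S where "S = {x\<in>X. \<psi> x = 0}"
  have "h * card (Z \<inter> S) < card Z + h \<and> card Z < h * card (Z \<inter> S) + h" if "Z \<in> F" for Z
  proof -
    let ?n = "\<lambda>i. card {z\<in>Z. \<psi> z = i}"
    have fin: "finite Z" using sub[OF that] finX finite_subset by blast
    have "Z = (\<Union>i<h. {z\<in>Z. \<psi> z = i})" using \<psi>(1) by auto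
    then have "card Z = card (\<Union>i<h. {z\<in>Z. \<psi> z = i})" by simp
    also have "\<dots> = (\<Sum>i<h. ?n i)" by (rule card_UN_disjoint) (use fin in auto)
    also have "\<dots> = ?n 0 + (\<Sum>i\<in>{1..<h}. ?n i)"
      using h by (simp add: lessThan_atLeast0 sum.atLeast_Suc_lessThan)
    finally have tot: "card Z = ?n 0 + (\<Sum>i\<in>{1..<h}. ?n i)" .
    have Z0: "Z \<inter> S = {z\<in>Z. \<psi> z = 0}" using sub[OF that] unfolding S_def by auto
    define T where "T = (\<Sum>i\<in>{1..<h}. ?n i)"
    have "T \<le> (\<Sum>i\<in>{1..<h}. ?n 0 + 1)" unfolding T_def
      by (rule sum_mono) (use \<psi>(2)[OF that] h in auto)
    also have "\<dots> = (h - 1) * ?n 0 + (h - 1)" by simp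
    finally have T1: "T \<le> (h - 1) * ?n 0 + (h - 1)" .
    have "(h - 1) * ?n 0 = (\<Sum>i\<in>{1..<h}. ?n 0)" by simp
    also have "\<dots> \<le> (\<Sum>i\<in>{1..<h}. ?n i + 1)"
      by (rule sum_mono) (use \<psi>(2)[OF that] h in auto)
    also have "\<dots> = T + (h - 1)" unfolding T_def by (subst sum.distrib) simp
    finally have T2: "(h - 1) * ?n 0 \<le> T + (h - 1)" .
    have "h * ?n 0 = (h - 1) * ?n 0 + ?n 0" using h by (cases h) auto
    with T1 T2 tot h show ?thesis unfolding Z0 T_def[symmetric] by linarith
  qed
  moreover have SX: "S \<subseteq> X" unfolding S_def by blast
  moreover have "Z \<in> F" if "(\<exists>b. Z = {x\<in>X. blk x = b}) \<or> (\<exists>b. Z = {x\<in>X. col x = b}) \<or> (\<exists>b. Z = {x\<in>X. vtx x = b})" for Z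
    using that unfolding F_def by auto
  ultimately have "\<forall>Z. (\<exists>b. Z = {x\<in>X. blk x = b}) \<or> (\<exists>b. Z = {x\<in>X. col x = b}) \<or> (\<exists>b. Z = {x\<in>X. vtx x = b})
    \<longrightarrow> h * card (Z \<inter> S) < card Z + h \<and> card Z < h * card (Z \<inter> S) + h" by simp
  with SX show ?thesis by (intro exI[of _ S] conjI)
qed

text \<open>The entry \<open>W j v\<close> is replaced by \<open>W j v\<close> distinct units, from
  which an equitable subset is taken; \<open>y j v\<close> counts the chosen units. Rows (colors),
  split further into blocks, form one laminar family and columns (vertices) the other. Row and
  column sums divisible by \<open>h\<close> are divided exactly; blocks need only the upper
  bound.\<close>

lemma equitable_matrix:
  fixes W :: "'j \<Rightarrow> 'v \<Rightarrow> nat" and blk :: "'j \<Rightarrow> 'v \<Rightarrow> 'b" and h :: nat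
  assumes "finite J" "finite V" "h \<ge> 1"
  obtains y where "\<And>j v. j \<in> J \<Longrightarrow> v \<in> V \<Longrightarrow> y j v \<le> W j v"
    and "\<And>j q. j \<in> J \<Longrightarrow> (\<Sum>v\<in>V. W j v) = h * q \<Longrightarrow> (\<Sum>v\<in>V. y j v) = q"
    and "\<And>v q. v \<in> V \<Longrightarrow> (\<Sum>j\<in>J. W j v) = h * q \<Longrightarrow> (\<Sum>j\<in>J. y j v) = q"
    and "\<And>j b. j \<in> J \<Longrightarrow> h * (\<Sum>v\<in>{v\<in>V. blk j v = b}. y j v) < (\<Sum>v\<in>{v\<in>V. blk j v = b}. W j v) + h"
proof -
  define X where "X = (SIGMA j:J. SIGMA v:V. {..<W j v})"
  \<comment> \<open>A block label includes the color, since blocks must refine colors and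
    \<open>blk\<close> may take the same value in different rows.\<close>
  let ?col = "fst :: 'j \<times> 'v \<times> nat \<Rightarrow> 'j" and ?vtx = "\<lambda>x :: 'j \<times> 'v \<times> nat. fst (snd x)"
    and ?blk = "\<lambda>x :: 'j \<times> 'v \<times> nat. (fst x, blk (fst x) (fst (snd x)))"
  have finX: "finite X" unfolding X_def using assms by auto
  have ref: "\<And>x y. x \<in> X \<Longrightarrow> y \<in> X \<Longrightarrow> ?blk x = ?blk y \<Longrightarrow> ?col x = ?col y" by simp
  from equitable_subset[where X = X and blk = ?blk and col = ?col and vtx = ?vtx, OF finX ref assms(3)]
  obtain S where S: "S \<subseteq> X" and SZ: "\<And>Z. (\<exists>b. Z = {x\<in>X. ?blk x = b}) \<or> (\<exists>b. Z = {x\<in>X. ?col x = b}) \<or> (\<exists>b. Z = {x\<in>X. ?vtx x = b})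
    \<Longrightarrow> h * card (Z \<inter> S) < card Z + h \<and> card Z < h * card (Z \<inter> S) + h" by blast
  define y where "y j v = card {i. (j, v, i) \<in> S}" for j v
  have fin: "finite {i. (j, v, i) \<in> S}" for j v
    by (rule finite_subset[of _ "{..<W j v}"]) (use S in \<open>auto simp: X_def\<close>)
  have cS: "card ({x\<in>X. P (fst x) (fst (snd x))} \<inter> S) = (\<Sum>j\<in>J. \<Sum>v\<in>{v\<in>V. P j v}. y j v)" for P
  proof -
    have "{x\<in>X. P (fst x) (fst (snd x))} \<inter> S = (SIGMA j:J. SIGMA v:{v\<in>V. P j v}. {i. (j, v, i) \<in> S})"
      using S unfolding X_def by auto
    then show ?thesis using assms(1,2) fin by (simp add: y_def)
  qed
  have cX: "card {x\<in>X. P (fst x) (fst (snd x))} = (\<Sum>j\<in>J. \<Sum>v\<in>{v\<in>V. P j v}. W j v)" for P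
  proof -
    have "{x\<in>X. P (fst x) (fst (snd x))} = (SIGMA j:J. SIGMA v:{v\<in>V. P j v}. {..<W j v})"
      unfolding X_def by auto
    then show ?thesis using assms(1,2) by simp
  qed
  have row: "(\<Sum>j\<in>J. \<Sum>v\<in>{v\<in>V. j = j0 \<and> Q j v}. f j v) = (\<Sum>v\<in>{v\<in>V. Q j0 v}. f j0 v)" if "j0 \<in> J" for j0 Q and f :: "'j \<Rightarrow> 'v \<Rightarrow> nat"
  proof -
    have "(\<Sum>j\<in>J. \<Sum>v\<in>{v\<in>V. j = j0 \<and> Q j v}. f j v) = (\<Sum>j\<in>J. if j = j0 then (\<Sum>v\<in>{v\<in>V. Q j0 v}. f j0 v) else 0)"
      by (rule sum.cong) auto
    then show ?thesis using that assms(1) by simp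
  qed
  have gen: "h * (\<Sum>j\<in>J. \<Sum>v\<in>{v\<in>V. P j v}. y j v) < (\<Sum>j\<in>J. \<Sum>v\<in>{v\<in>V. P j v}. W j v) + h \<and>
      (\<Sum>j\<in>J. \<Sum>v\<in>{v\<in>V. P j v}. W j v) < h * (\<Sum>j\<in>J. \<Sum>v\<in>{v\<in>V. P j v}. y j v) + h"
    if "(\<exists>b. {x\<in>X. P (fst x) (fst (snd x))} = {x\<in>X. ?blk x = b}) \<or>
      (\<exists>b. {x\<in>X. P (fst x) (fst (snd x))} = {x\<in>X. ?col x = b}) \<or>
      (\<exists>b. {x\<in>X. P (fst x) (fst (snd x))} = {x\<in>X. ?vtx x = b})" for P
    using SZ[OF that] unfolding cS cX .
  \<comment> \<open>Rounding a multiple of \<open>h\<close> after division by \<open>h\<close>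
    changes nothing.\<close>
  have exact: "n = q" if "h * n < N + h" "N < h * n + h" "N = h * q" for n N q :: nat
  proof -
    have "h * n < h * (q + 1)" "h * q < h * (n + 1)" using that by simp_all
    then have "n < q + 1" "q < n + 1" using mult_less_cancel1 by blast+
    then show ?thesis by simp
  qed
  show ?thesis
  proof (rule that[of y])
    fix j v assume "j \<in> J" "v \<in> V"
    have "y j v \<le> card {..<W j v}" unfolding y_def
      by (rule card_mono) (use S in \<open>auto simp: X_def\<close>)
    then show "y j v \<le> W j v" by simp
  next
    fix j q assume j: "j \<in> J" and eq: "(\<Sum>v\<in>V. W j v) = h * q"
    have "h * (\<Sum>v\<in>{v\<in>V. True}. y j v) < (\<Sum>v\<in>{v\<in>V. True}. W j v) + h \<and>
      (\<Sum>v\<in>{v\<in>V. True}. W j v) < h * (\<Sum>v\<in>{v\<in>V. True}. y j v) + h"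
      unfolding row[OF j, where Q = "\<lambda>_ _. True", symmetric]
      by (rule gen) (intro disjI2 disjI1 exI[of _ j], simp)
    then have "h * (\<Sum>v\<in>V. y j v) < (\<Sum>v\<in>V. W j v) + h \<and> (\<Sum>v\<in>V. W j v) < h * (\<Sum>v\<in>V. y j v) + h" by simp
    then show "(\<Sum>v\<in>V. y j v) = q" using exact eq by blast
  next
    fix v q assume v: "v \<in> V" and eq: "(\<Sum>j\<in>J. W j v) = h * q"
    have one: "{u\<in>V. u = v} = {v}" using v by auto
    have "h * (\<Sum>j\<in>J. \<Sum>u\<in>{u\<in>V. u = v}. y j u) < (\<Sum>j\<in>J. \<Sum>u\<in>{u\<in>V. u = v}. W j u) + h \<and>
      (\<Sum>j\<in>J. \<Sum>u\<in>{u\<in>V. u = v}. W j u) < h * (\<Sum>j\<in>J. \<Sum>u\<in>{u\<in>V. u = v}. y j u) + h"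
      by (rule gen) (intro disjI2 exI[of _ v], simp)
    then have "h * (\<Sum>j\<in>J. y j v) < (\<Sum>j\<in>J. W j v) + h \<and> (\<Sum>j\<in>J. W j v) < h * (\<Sum>j\<in>J. y j v) + h"
      unfolding one by simp
    then show "(\<Sum>j\<in>J. y j v) = q" using exact eq by blast
  next
    fix j b assume j: "j \<in> J"
    have "h * (\<Sum>v\<in>{v\<in>V. blk j v = b}. y j v) < (\<Sum>v\<in>{v\<in>V. blk j v = b}. W j v) + h \<and>
      (\<Sum>v\<in>{v\<in>V. blk j v = b}. W j v) < h * (\<Sum>v\<in>{v\<in>V. blk j v = b}. y j v) + h"
      unfolding row[OF j, where Q = "\<lambda>j v. blk j v = b", symmetric]
      by (rule gen) (intro disjI1 exI[of _ "(j, b)"], auto)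
    then show "h * (\<Sum>v\<in>{v\<in>V. blk j v = b}. y j v) < (\<Sum>v\<in>{v\<in>V. blk j v = b}. W j v) + h" by blast
  qed
qed

section \<open>Detaching amalgamated vertices\<close>

definition adj :: "'v set \<Rightarrow> ('v \<Rightarrow> 'v \<Rightarrow> nat) \<Rightarrow> ('v \<times> 'v) set" where
  "adj V w = {(u, v). u \<in> V \<and> v \<in> V \<and> w u v > 0}"

definition connected_on :: "'v set \<Rightarrow> ('v \<Rightarrow> 'v \<Rightarrow> nat) \<Rightarrow> bool" where
  "connected_on V w \<longleftrightarrow> (\<forall>u\<in>V. \<forall>v\<in>V. (u, v) \<in> (adj V w)\<^sup>*)"

text \<open>
  A multigraph is given by the number \<open>w u v\<close> of half-edges at \<open>u\<close> whose other half is at \<open>v\<close>,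
  so \<open>w u u\<close> is twice the number of loops at \<open>u\<close> and the degree of \<open>u\<close> is \<open>\<Sum>v\<in>V. w u v\<close>.
\<close>

definition multiplicity_fun :: "'v set \<Rightarrow> ('v \<Rightarrow> 'v \<Rightarrow> nat) \<Rightarrow> bool" where
  "multiplicity_fun V w \<longleftrightarrow> (\<forall>u\<in>V. \<forall>v\<in>V. w u v = w v u) \<and> (\<forall>u\<in>V. even (w u u))"

text \<open>The invariant of a color class during all splittings. Evenness of the degrees is part of
  it because preserving connectedness depends on it.\<close>

definition connected_even :: "'v set \<Rightarrow> ('v \<Rightarrow> 'v \<Rightarrow> nat) \<Rightarrow> bool" where
  "connected_even V w \<longleftrightarrow> multiplicity_fun V w \<and> (\<forall>u\<in>V. even (\<Sum>v\<in>V. w u v)) \<and> connected_on V w"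

text \<open>Entries off the diagonal occur in equal pairs and those on it are even. Applied to a set
  of vertices, this shows that the number of edges leaving it has the parity of its degree
  sum.\<close>

lemma even_sum_symmetric:
  assumes "finite C" "multiplicity_fun C w"
  shows "even (\<Sum>u\<in>C. \<Sum>v\<in>C. w u v)"
  using assms
proof (induction C)
  case (insert x C)
  have "multiplicity_fun C w" using insert.prems unfolding multiplicity_fun_def by blast
  then have "even (\<Sum>u\<in>C. \<Sum>v\<in>C. w u v)" by (rule insert.IH)
  moreover have "(\<Sum>u\<in>C. w u x) = (\<Sum>u\<in>C. w x u)"
    by (rule sum.cong[OF refl]) (use insert.prems in \<open>unfold multiplicity_fun_def, blast\<close>)
  moreover have "even (w x x)" using insert.prems unfolding multiplicity_fun_def by blast
  ultimately show ?case using insert.hyps by (simp add: sum.distrib)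
qed simp

lemma sym_adj: "multiplicity_fun V w \<Longrightarrow> sym (adj V w)"
  unfolding multiplicity_fun_def adj_def sym_def by auto

text \<open>
  \<open>y v\<close> half-edges leading to \<open>v\<close> move from \<open>\<alpha>\<close> to \<open>\<beta>\<close>. A loop with one moved half becomes an edge
  between \<open>\<alpha>\<close> and \<open>\<beta>\<close>, hence the loss of \<open>2 * y \<alpha>\<close> half-edges in loops.
\<close>

definition split_vertex :: "'v \<Rightarrow> 'v \<Rightarrow> ('v \<Rightarrow> nat) \<Rightarrow> ('v \<Rightarrow> 'v \<Rightarrow> nat) \<Rightarrow> 'v \<Rightarrow> 'v \<Rightarrow> nat" where
  "split_vertex \<alpha> \<beta> y w u v =
    (if u = \<beta> then (if v = \<beta> then 0 else y v)
     else if v = \<beta> then y u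
     else if u = \<alpha> then (if v = \<alpha> then w \<alpha> \<alpha> - 2 * y \<alpha> else w \<alpha> v - y v)
     else if v = \<alpha> then w u \<alpha> - y u else w u v)"

text \<open>Only the connection between \<open>\<alpha>\<close> and \<open>\<beta>\<close> is at
  risk. The hypothesis \<open>link\<close> asks that every component of the graph without
  \<open>\<alpha>\<close> that sends an edge to \<open>\<beta>\<close> also keeps one to
  \<open>\<alpha>\<close>.\<close>

lemma connected_even_split_vertex:
  fixes w :: "'v \<Rightarrow> 'v \<Rightarrow> nat"
  assumes "finite V" and \<alpha>: "\<alpha> \<in> V" and \<beta>: "\<beta> \<notin> V" and w: "connected_even V w"
    and le: "\<And>v. v \<in> V \<Longrightarrow> y v \<le> w \<alpha> v" and le2: "2 * y \<alpha> \<le> w \<alpha> \<alpha>"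
    and d: "(\<Sum>v\<in>V. y v) = d" "d \<ge> 1" "even d"
    and link: "\<And>v. v \<in> V - {\<alpha>} \<Longrightarrow> y v > 0 \<Longrightarrow> \<exists>u\<in>V - {\<alpha>}. (v, u) \<in> (adj (V - {\<alpha>}) w)\<^sup>* \<and> y u < w \<alpha> u"
  defines "w' \<equiv> split_vertex \<alpha> \<beta> y w"
  shows "connected_even (insert \<beta> V) w'"
    and "\<And>u. u \<in> V - {\<alpha>} \<Longrightarrow> w' u \<alpha> + w' u \<beta> = w u \<alpha>"
    and "(\<Sum>v\<in>insert \<beta> V. w' \<beta> v) = d" and "(\<Sum>v\<in>insert \<beta> V. w' \<alpha> v) + d = (\<Sum>v\<in>V. w \<alpha> v)"
proof -
  have ab: "\<alpha> \<noteq> \<beta>" using \<alpha> \<beta> by blast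
  have wsym: "\<And>u v. u \<in> V \<Longrightarrow> v \<in> V \<Longrightarrow> w u v = w v u" and wev: "\<And>u. u \<in> V \<Longrightarrow> even (w u u)"
    and wdeg: "\<And>u. u \<in> V \<Longrightarrow> even (\<Sum>v\<in>V. w u v)" and wconn: "\<And>u v. u \<in> V \<Longrightarrow> v \<in> V \<Longrightarrow> (u, v) \<in> (adj V w)\<^sup>*"
    using w unfolding connected_even_def multiplicity_fun_def connected_on_def by blast+
  have sumV: "(\<Sum>v\<in>insert \<beta> V. f v) = f \<beta> + f \<alpha> + (\<Sum>v\<in>V-{\<alpha>}. f v)" for f :: "'v \<Rightarrow> nat"
    using assms(1) \<alpha> \<beta> by (simp add: sum.remove)
  have sumV': "(\<Sum>v\<in>V. f v) = f \<alpha> + (\<Sum>v\<in>V-{\<alpha>}. f v)" for f :: "'v \<Rightarrow> nat"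
    using assms(1) \<alpha> by (simp add: sum.remove)
  show s: "w' u \<alpha> + w' u \<beta> = w u \<alpha>" if "u \<in> V - {\<alpha>}" for u
    using that le[of u] wsym[of u \<alpha>] \<alpha> \<beta> ab unfolding w'_def split_vertex_def by auto
  have degu: "(\<Sum>v\<in>insert \<beta> V. w' u v) = (\<Sum>v\<in>V. w u v)" if "u \<in> V - {\<alpha>}" for u
  proof -
    have "(\<Sum>v\<in>V-{\<alpha>}. w' u v) = (\<Sum>v\<in>V-{\<alpha>}. w u v)"
      by (rule sum.cong) (use that \<beta> in \<open>auto simp: w'_def split_vertex_def\<close>)
    then show ?thesis unfolding sumV sumV' using s[OF that] by simp
  qed
  show db: "(\<Sum>v\<in>insert \<beta> V. w' \<beta> v) = d"
  proof -
    have "(\<Sum>v\<in>V-{\<alpha>}. w' \<beta> v) = (\<Sum>v\<in>V-{\<alpha>}. y v)"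
      by (rule sum.cong) (use \<beta> in \<open>auto simp: w'_def split_vertex_def\<close>)
    moreover have "w' \<beta> \<beta> = 0" "w' \<beta> \<alpha> = y \<alpha>" using ab by (auto simp: w'_def split_vertex_def)
    ultimately show ?thesis unfolding sumV using d(1) sumV'[of y] by simp
  qed
  show da: "(\<Sum>v\<in>insert \<beta> V. w' \<alpha> v) + d = (\<Sum>v\<in>V. w \<alpha> v)"
  proof -
    have "(\<Sum>v\<in>V-{\<alpha>}. w' \<alpha> v) + (\<Sum>v\<in>V-{\<alpha>}. y v) = (\<Sum>v\<in>V-{\<alpha>}. w' \<alpha> v + y v)" by (simp add: sum.distrib)
    also have "\<dots> = (\<Sum>v\<in>V-{\<alpha>}. w \<alpha> v)"
      by (rule sum.cong) (use \<beta> ab le in \<open>auto simp: w'_def split_vertex_def\<close>)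
    finally have "(\<Sum>v\<in>V-{\<alpha>}. w' \<alpha> v) + (\<Sum>v\<in>V-{\<alpha>}. y v) = (\<Sum>v\<in>V-{\<alpha>}. w \<alpha> v)" .
    moreover have "w' \<alpha> \<beta> = y \<alpha>" "w' \<alpha> \<alpha> = w \<alpha> \<alpha> - 2 * y \<alpha>" using ab by (auto simp: w'_def split_vertex_def)
    ultimately show ?thesis unfolding sumV sumV'[of "w \<alpha>"] using d(1) sumV'[of y] le2 by simp
  qed
  have mf: "multiplicity_fun (insert \<beta> V) w'"
    unfolding multiplicity_fun_def
  proof (intro conjI ballI)
    fix u v assume "u \<in> insert \<beta> V" "v \<in> insert \<beta> V"
    then show "w' u v = w' v u" using wsym \<alpha> unfolding w'_def split_vertex_def by auto
  next
    fix u assume "u \<in> insert \<beta> V"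
    then show "even (w' u u)" using wev \<alpha> le2 unfolding w'_def split_vertex_def by auto
  qed
  have ev: "even (\<Sum>v\<in>insert \<beta> V. w' u v)" if u: "u \<in> insert \<beta> V" for u
  proof -
    consider "u = \<beta>" | "u = \<alpha>" | "u \<in> V - {\<alpha>}" using u by blast
    then show ?thesis
    proof cases
      case 1 then show ?thesis using db d(3) by simp
    next
      case 2
      have "even ((\<Sum>v\<in>insert \<beta> V. w' \<alpha> v) + d)" unfolding da using wdeg[OF \<alpha>] .
      then show ?thesis using d(3) 2 by simp
    next
      case 3 then show ?thesis using degu wdeg by simp
    qed
  qed
  let ?R = "adj (insert \<beta> V) w'"
  have symR: "sym (?R\<^sup>*)" by (rule sym_rtrancl[OF sym_adj[OF mf]])
  \<comment> \<open>As \<open>d\<close> is positive, \<open>\<beta>\<close> has a neighbor: either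
    \<open>\<alpha>\<close> itself, or a vertex whose component still reaches
    \<open>\<alpha>\<close> by \<open>link\<close>.\<close>
  have ab_conn: "(\<beta>, \<alpha>) \<in> ?R\<^sup>*"
  proof -
    have "\<exists>v\<in>V. y v \<noteq> 0"
    proof (rule ccontr)
      assume "\<not> ?thesis"
      then have "(\<Sum>v\<in>V. y v) = 0" by simp
      with d show False by simp
    qed
    then obtain v where v: "v \<in> V" "y v > 0" by blast
    have bv: "(\<beta>, v) \<in> ?R" using v \<beta> unfolding adj_def w'_def split_vertex_def by auto
    show ?thesis
    proof (cases "v = \<alpha>")
      case True then show ?thesis using bv by blast
    next
      case False
      with link[of v] v obtain u where u: "u \<in> V - {\<alpha>}" "(v, u) \<in> (adj (V - {\<alpha>}) w)\<^sup>*" "y u < w \<alpha> u" by blast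
      have "adj (V - {\<alpha>}) w \<subseteq> ?R" using \<beta> unfolding adj_def w'_def split_vertex_def by auto
      then have "(v, u) \<in> ?R\<^sup>*" using u(2) rtrancl_mono by blast
      moreover have "(u, \<alpha>) \<in> ?R" using u wsym[of u \<alpha>] \<alpha> \<beta> ab unfolding adj_def w'_def split_vertex_def by auto
      ultimately show ?thesis using bv by (meson converse_rtrancl_into_rtrancl rtrancl.rtrancl_into_rtrancl)
    qed
  qed
  \<comment> \<open>A walk to \<open>\<alpha>\<close> survives the splitting except that a step into
    \<open>\<alpha>\<close> may now end in \<open>\<beta>\<close>, from where
    \<open>\<alpha>\<close> is reached by \<open>ab_conn\<close>.\<close>
  have toa: "(u, \<alpha>) \<in> ?R\<^sup>*" if "u \<in> V" for u
    using wconn[OF that \<alpha>]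
  proof (induction rule: converse_rtrancl_induct)
    case (step u z)
    have uz: "u \<in> V" "z \<in> V" "w u z > 0" using step(1) unfolding adj_def by auto
    consider "u = \<alpha>" | "u \<noteq> \<alpha>" "z = \<alpha>" | "u \<noteq> \<alpha>" "z \<noteq> \<alpha>" by blast
    then show ?case
    proof cases
      case 2
      then have "w' u \<alpha> > 0 \<or> w' u \<beta> > 0" using s[of u] uz by auto
      then have "(u, \<alpha>) \<in> ?R \<or> (u, \<beta>) \<in> ?R" using uz \<alpha> unfolding adj_def by auto
      then show ?thesis using ab_conn by (meson converse_rtrancl_into_rtrancl r_into_rtrancl)
    next
      case 3
      then have "(u, z) \<in> ?R" using uz \<beta> unfolding adj_def w'_def split_vertex_def by auto
      then show ?thesis using step(3) by (meson converse_rtrancl_into_rtrancl)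
    qed simp
  qed simp
  have "connected_on (insert \<beta> V) w'" unfolding connected_on_def
    using toa ab_conn symR by (metis insertE symE rtrancl_trans)
  with mf ev show "connected_even (insert \<beta> V) w'" unfolding connected_even_def by blast
qed

text \<open>
  Removing one of \<open>h\<close> vertices amalgamated into \<open>\<alpha>\<close>: every component of a colour class minus
  \<open>\<alpha>\<close> is joined to \<open>\<alpha>\<close> by an even number of edges, so giving at most a rounded \<open>h\<close>-th part of them to
  \<open>\<beta>\<close> leaves at least one of them at \<open>\<alpha>\<close>.
\<close>

lemma split_off_vertex:
  fixes w :: "'j \<Rightarrow> 'v \<Rightarrow> 'v \<Rightarrow> nat"
  assumes finJ: "finite J" and finV: "finite V" and \<alpha>: "\<alpha> \<in> V" and \<beta>: "\<beta> \<notin> V" and h: "h \<ge> 2"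
    and w: "\<And>j. j \<in> J \<Longrightarrow> connected_even V (w j)"
    and d: "\<And>j. j \<in> J \<Longrightarrow> (\<Sum>v\<in>V. w j \<alpha> v) = h * d j \<and> d j \<ge> 1 \<and> even (d j)"
    and m: "\<And>v. v \<in> V - {\<alpha>} \<Longrightarrow> (\<Sum>j\<in>J. w j \<alpha> v) = h * m v"
    and l: "(\<Sum>j\<in>J. w j \<alpha> \<alpha>) = h * ((h - 1) * l)"
  obtains w' where "\<And>j. j \<in> J \<Longrightarrow> connected_even (insert \<beta> V) (w' j)"
    and "\<And>j u v. u \<in> V - {\<alpha>} \<Longrightarrow> v \<in> V - {\<alpha>} \<Longrightarrow> w' j u v = w j u v"
    and "\<And>j u. j \<in> J \<Longrightarrow> u \<in> V - {\<alpha>} \<Longrightarrow> w' j u \<alpha> + w' j u \<beta> = w j u \<alpha>"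
    and "\<And>j. j \<in> J \<Longrightarrow> (\<Sum>v\<in>insert \<beta> V. w' j \<beta> v) = d j"
    and "\<And>j. j \<in> J \<Longrightarrow> (\<Sum>v\<in>insert \<beta> V. w' j \<alpha> v) = (h - 1) * d j"
    and "\<And>v. v \<in> V - {\<alpha>} \<Longrightarrow> (\<Sum>j\<in>J. w' j \<beta> v) = m v"
    and "\<And>v. v \<in> V - {\<alpha>} \<Longrightarrow> (\<Sum>j\<in>J. w' j \<alpha> v) = (h - 1) * m v"
    and "(\<Sum>j\<in>J. w' j \<alpha> \<beta>) = (h - 1) * l"
    and "(\<Sum>j\<in>J. w' j \<alpha> \<alpha>) = (h - 1) * ((h - 2) * l)"
    and "\<And>j. w' j \<beta> \<beta> = 0"
proof -
  have h1: "h \<ge> 1" using h by simp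
  have ab: "\<alpha> \<noteq> \<beta>" using \<alpha> \<beta> by blast
  \<comment> \<open>Blocks are the components of the color class without \<open>\<alpha>\<close>,
    each given as a vertex set. The singleton of \<open>\<alpha>\<close> is a block of its own, so
    that loops are shared out fairly too.\<close>
  define blk where "blk j v = (if v = \<alpha> then {\<alpha>} else {u \<in> V - {\<alpha>}. (v, u) \<in> (adj (V - {\<alpha>}) (w j))\<^sup>*})" for j v
  obtain y where yle: "\<And>j v. j \<in> J \<Longrightarrow> v \<in> V \<Longrightarrow> y j v \<le> w j \<alpha> v"
    and yrow: "\<And>j q. j \<in> J \<Longrightarrow> (\<Sum>v\<in>V. w j \<alpha> v) = h * q \<Longrightarrow> (\<Sum>v\<in>V. y j v) = q"
    and ycol: "\<And>v q. v \<in> V \<Longrightarrow> (\<Sum>j\<in>J. w j \<alpha> v) = h * q \<Longrightarrow> (\<Sum>j\<in>J. y j v) = q"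
    and yblk: "\<And>j b. j \<in> J \<Longrightarrow> h * (\<Sum>v\<in>{v\<in>V. blk j v = b}. y j v) < (\<Sum>v\<in>{v\<in>V. blk j v = b}. w j \<alpha> v) + h"
    using equitable_matrix[OF finJ finV h1, where W = "\<lambda>j v. w j \<alpha> v" and blk = blk] by blast
  have yd: "(\<Sum>v\<in>V. y j v) = d j" "d j \<ge> 1" "even (d j)" if "j \<in> J" for j
    using yrow[OF that] d[OF that] by blast+
  have mf: "multiplicity_fun V (w j)" if "j \<in> J" for j using w[OF that] unfolding connected_even_def by blast
  \<comment> \<open>Of \<open>t\<close> loops, that is \<open>2 * t\<close> half-edges, at most a
    rounded \<open>h\<close>-th part moves. As \<open>h \<ge> 2\<close> this is at most
    \<open>t\<close>, so one half of each loop can stay at \<open>\<alpha>\<close>.\<close>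
  have le2: "2 * y j \<alpha> \<le> w j \<alpha> \<alpha>" if j: "j \<in> J" for j
  proof -
    have "blk j v = {\<alpha>} \<longleftrightarrow> v = \<alpha>" if "v \<in> V" for v unfolding blk_def by auto
    then have "{v\<in>V. blk j v = {\<alpha>}} = {\<alpha>}" using \<alpha> by auto
    with yblk[OF j, of "{\<alpha>}"] have *: "h * y j \<alpha> < w j \<alpha> \<alpha> + h" by simp
    obtain t where t: "w j \<alpha> \<alpha> = 2 * t" using mf[OF j] \<alpha> unfolding multiplicity_fun_def by (meson evenE)
    have "2 * t \<le> h * t" using h by (rule mult_right_mono) simp
    then have "h * y j \<alpha> < h * t + h" using * unfolding t by linarith
    then have "h * y j \<alpha> < h * (t + 1)" by simp
    then have "y j \<alpha> < t + 1" using mult_less_cancel1 by blast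
    then show ?thesis unfolding t by simp
  qed
  have link: "\<exists>u\<in>V - {\<alpha>}. (v, u) \<in> (adj (V - {\<alpha>}) (w j))\<^sup>* \<and> y j u < w j \<alpha> u"
    if j: "j \<in> J" and v: "v \<in> V - {\<alpha>}" and pos: "y j v > 0" for j v
  proof (rule ccontr)
    assume neg: "\<not> ?thesis"
    let ?A = "adj (V - {\<alpha>}) (w j)"
    define C where "C = blk j v"
    have C: "C = {u \<in> V - {\<alpha>}. (v, u) \<in> ?A\<^sup>*}" unfolding C_def blk_def using v by simp
    have mf': "multiplicity_fun (V - {\<alpha>}) (w j)" using mf[OF j] unfolding multiplicity_fun_def by blast
    have symA: "sym (?A\<^sup>*)" by (rule sym_rtrancl[OF sym_adj[OF mf']])
    have Ceq: "{u\<in>V. blk j u = C} = C"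
    proof (intro equalityI subsetI)
      fix u assume "u \<in> {u\<in>V. blk j u = C}"
      then have u: "u \<in> V" "blk j u = C" by auto
      show "u \<in> C"
      proof (cases "u = \<alpha>")
        case True then show ?thesis using u(2) unfolding blk_def C by auto
      next
        case False
        then have "u \<in> blk j u" using u(1) unfolding blk_def by auto
        then show ?thesis using u(2) by simp
      qed
    next
      fix u assume u: "u \<in> C"
      then have vu: "u \<in> V - {\<alpha>}" "(v, u) \<in> ?A\<^sup>*" unfolding C by auto
      then have uv: "(u, v) \<in> ?A\<^sup>*" using symA by (blast dest: symD)
      have "(v, x) \<in> ?A\<^sup>* \<longleftrightarrow> (u, x) \<in> ?A\<^sup>*" for x
        by (rule iffI[OF rtrancl_trans[OF uv] rtrancl_trans[OF vu(2)]])
      then have "blk j u = C" unfolding C blk_def using vu(1) by simp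
      then show "u \<in> {u\<in>V. blk j u = C}" using u unfolding C by auto
    qed
    have finC: "finite C" unfolding C using finV by simp
    have vC: "v \<in> C" unfolding C using v by simp
    have CV: "C \<subseteq> V - {\<alpha>}" unfolding C by blast
    \<comment> \<open>If the claim fails, all \<open>e\<close> half-edges between
      \<open>\<alpha>\<close> and the component \<open>C\<close> of \<open>v\<close> move to
      \<open>\<beta>\<close>.\<close>
    define e where "e = (\<Sum>u\<in>C. w j \<alpha> u)"
    have ys: "(\<Sum>u\<in>C. y j u) = e" unfolding e_def
    proof (rule sum.cong)
      fix u assume "u \<in> C"
      then have "\<not> y j u < w j \<alpha> u" "u \<in> V" using neg unfolding C by auto
      then show "y j u = w j \<alpha> u" using yle[OF j, of u] by simp
    qed simp
    have "y j v \<le> e" unfolding ys[symmetric] by (rule member_le_sum[OF vC _ finC]) simp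
    with pos have e0: "e > 0" by simp
    \<comment> \<open>Edges leaving \<open>C\<close> can only go to \<open>\<alpha>\<close>, so
      \<open>e\<close> is the degree sum over \<open>C\<close> minus the half-edges inside
      \<open>C\<close>, and both are even.\<close>
    have "even e"
    proof -
      have "(\<Sum>x\<in>V. w j u x) = w j u \<alpha> + (\<Sum>x\<in>C. w j u x)" if u: "u \<in> C" for u
      proof -
        have "w j u x = 0" if x: "x \<in> V - insert \<alpha> C" for x
        proof (rule ccontr)
          assume "w j u x \<noteq> 0"
          then have "(u, x) \<in> ?A" using u x CV unfolding adj_def by auto
          then have "x \<in> C" using u x unfolding C by (auto intro: rtrancl.rtrancl_into_rtrancl)
          then show False using x by blast
        qed
        then have "(\<Sum>x\<in>V. w j u x) = (\<Sum>x\<in>insert \<alpha> C. w j u x)"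
          by (intro sum.mono_neutral_right[OF finV]) (use CV \<alpha> in auto)
        moreover have "\<alpha> \<notin> C" using CV by blast
        ultimately show ?thesis using finC by simp
      qed
      then have "(\<Sum>u\<in>C. \<Sum>x\<in>V. w j u x) = (\<Sum>u\<in>C. w j u \<alpha>) + (\<Sum>u\<in>C. \<Sum>x\<in>C. w j u x)"
        by (simp add: sum.distrib)
      moreover have "even (\<Sum>u\<in>C. \<Sum>x\<in>V. w j u x)"
        by (rule dvd_sum) (use w[OF j] CV in \<open>auto simp: connected_even_def\<close>)
      moreover have "even (\<Sum>u\<in>C. \<Sum>x\<in>C. w j u x)"
        by (rule even_sum_symmetric[OF finC]) (use mf[OF j] CV in \<open>auto simp: multiplicity_fun_def\<close>)
      moreover have "(\<Sum>u\<in>C. w j u \<alpha>) = e" unfolding e_def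
        by (rule sum.cong[OF refl]) (use mf[OF j] CV \<alpha> in \<open>unfold multiplicity_fun_def, blast\<close>)
      ultimately show ?thesis by simp
    qed
    \<comment> \<open>The rounding bound \<open>h * e < e + h\<close> says
      \<open>(h - 1) * (e - 1) < 1\<close>. Parity excludes \<open>e = 1\<close>, the only positive
      value that would satisfy it.\<close>
    with e0 obtain t where t: "e = 2 * t" "t \<ge> 1" by (auto elim!: evenE)
    have "h * e < e + h" using yblk[OF j, of C] unfolding Ceq ys e_def[symmetric] .
    moreover have "e + h \<le> h * e"
    proof -
      obtain h' where h': "h = h' + 2" using h le_Suc_ex by (metis add.commute)
      have lin: "x * 2 \<le> s \<Longrightarrow> q = s + 2 * t \<Longrightarrow> x = h' + 1 \<Longrightarrow> 2 * t + (h' + 2) \<le> q" for x s q :: nat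
        by linarith
      have "(h' + 1) * 2 \<le> (h' + 1) * (2 * t)" using t(2) by (intro mult_left_mono) auto
      moreover have "(h' + 2) * (2 * t) = (h' + 1) * (2 * t) + 2 * t" by (simp add: algebra_simps)
      ultimately show ?thesis unfolding t(1) h' by (rule lin) simp
    qed
    ultimately show False by simp
  qed
  define w' where "w' j = split_vertex \<alpha> \<beta> (y j) (w j)" for j
  have split: "connected_even (insert \<beta> V) (w' j)"
    "\<And>u. u \<in> V - {\<alpha>} \<Longrightarrow> w' j u \<alpha> + w' j u \<beta> = w j u \<alpha>"
    "(\<Sum>v\<in>insert \<beta> V. w' j \<beta> v) = d j"
    "(\<Sum>v\<in>insert \<beta> V. w' j \<alpha> v) + d j = (\<Sum>v\<in>V. w j \<alpha> v)" if j: "j \<in> J" for j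
    unfolding w'_def
    using connected_even_split_vertex[OF finV \<alpha> \<beta> w[OF j] yle[OF j] le2[OF j] yd[OF j] link[OF j]] by blast+
  have yv: "(\<Sum>j\<in>J. y j v) = m v" if "v \<in> V - {\<alpha>}" for v using ycol m that by blast
  \<comment> \<open>The half-edges moved from loops become the edges between \<open>\<alpha>\<close>
    and \<open>\<beta>\<close>: \<open>l\<close> for each of the \<open>h - 1\<close> vertices still
    amalgamated in \<open>\<alpha>\<close>.\<close>
  have y\<alpha>: "(\<Sum>j\<in>J. y j \<alpha>) = (h - 1) * l" using ycol[OF \<alpha> l] .
  have w'v: "w' j \<beta> v = y j v" "w' j \<alpha> v + y j v = w j \<alpha> v" if "v \<in> V - {\<alpha>}" "j \<in> J" for j v
    using that yle[of j v] \<beta> ab unfolding w'_def split_vertex_def by auto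
  obtain h' where h': "h = h' + 2" using h le_Suc_ex by (metis add.commute)
  show ?thesis
  proof (rule that[of w'])
    show "connected_even (insert \<beta> V) (w' j)" if "j \<in> J" for j using split that by blast
    show "w' j u v = w j u v" if "u \<in> V - {\<alpha>}" "v \<in> V - {\<alpha>}" for j u v
      using that \<beta> unfolding w'_def split_vertex_def by auto
    show "w' j u \<alpha> + w' j u \<beta> = w j u \<alpha>" if "j \<in> J" "u \<in> V - {\<alpha>}" for j u using split that by blast
    show "(\<Sum>v\<in>insert \<beta> V. w' j \<beta> v) = d j" if "j \<in> J" for j using split that by blast
    show "(\<Sum>v\<in>insert \<beta> V. w' j \<alpha> v) = (h - 1) * d j" if "j \<in> J" for j
      using split(4)[OF that] d[OF that] unfolding h' by simp
    show m1: "(\<Sum>j\<in>J. w' j \<beta> v) = m v" if "v \<in> V - {\<alpha>}" for v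
      unfolding yv[OF that, symmetric] by (rule sum.cong) (use w'v that in auto)
    show "(\<Sum>j\<in>J. w' j \<alpha> v) = (h - 1) * m v" if v: "v \<in> V - {\<alpha>}" for v
    proof -
      have "(\<Sum>j\<in>J. w' j \<alpha> v) + (\<Sum>j\<in>J. y j v) = (\<Sum>j\<in>J. w j \<alpha> v)"
        unfolding sum.distrib[symmetric] by (rule sum.cong) (use w'v v in auto)
      then show ?thesis unfolding yv[OF v] m[OF v] h' by simp
    qed
    show "(\<Sum>j\<in>J. w' j \<alpha> \<beta>) = (h - 1) * l"
      unfolding y\<alpha>[symmetric] using ab by (intro sum.cong) (auto simp: w'_def split_vertex_def)
    show "(\<Sum>j\<in>J. w' j \<alpha> \<alpha>) = (h - 1) * ((h - 2) * l)"
    proof -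
      have "w' j \<alpha> \<alpha> + 2 * y j \<alpha> = w j \<alpha> \<alpha>" if "j \<in> J" for j
        using le2[OF that] ab unfolding w'_def split_vertex_def by simp
      then have "(\<Sum>j\<in>J. w' j \<alpha> \<alpha>) + 2 * (\<Sum>j\<in>J. y j \<alpha>) = (\<Sum>j\<in>J. w j \<alpha> \<alpha>)"
        unfolding sum_distrib_left sum.distrib[symmetric] by (intro sum.cong) auto
      then show ?thesis unfolding y\<alpha> l h' by (simp add: algebra_simps)
    qed
    show "w' j \<beta> \<beta> = 0" for j unfolding w'_def split_vertex_def by simp
  qed
qed

text \<open>\<open>B\<close> consists of the vertices that \<open>\<alpha>\<close> stands for,
  \<open>\<alpha>\<close> among them. They are to be joined pairwise by \<open>l\<close> edges,
  which accounts for \<open>card B * (card B - 1) * l\<close> half-edges in loops, and to each other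
  vertex \<open>v\<close> by \<open>m v\<close> edges. The vertices are split off one after another,
  with the remaining degree and multiplicities at \<open>\<alpha>\<close> always divisible by the
  number of vertices left in it.\<close>

lemma detach_vertex:
  fixes w :: "'j \<Rightarrow> 'v \<Rightarrow> 'v \<Rightarrow> nat"
  assumes finJ: "finite J" and finV: "finite V" and \<alpha>: "\<alpha> \<in> V" and finB: "finite B" and VB: "V \<inter> B = {\<alpha>}"
    and w: "\<And>j. j \<in> J \<Longrightarrow> connected_even V (w j)"
    and d: "\<And>j. j \<in> J \<Longrightarrow> (\<Sum>v\<in>V. w j \<alpha> v) = card B * d j \<and> d j \<ge> 1 \<and> even (d j)"
    and m: "\<And>v. v \<in> V - {\<alpha>} \<Longrightarrow> (\<Sum>j\<in>J. w j \<alpha> v) = card B * m v"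
    and l: "(\<Sum>j\<in>J. w j \<alpha> \<alpha>) = card B * ((card B - 1) * l)"
  obtains w' where "\<And>j. j \<in> J \<Longrightarrow> connected_even (V \<union> B) (w' j)"
    and "\<And>j u v. u \<in> V - {\<alpha>} \<Longrightarrow> v \<in> V - {\<alpha>} \<Longrightarrow> w' j u v = w j u v"
    and "\<And>j u. j \<in> J \<Longrightarrow> u \<in> V - {\<alpha>} \<Longrightarrow> (\<Sum>b\<in>B. w' j u b) = w j u \<alpha>"
    and "\<And>j b. j \<in> J \<Longrightarrow> b \<in> B \<Longrightarrow> (\<Sum>v\<in>V \<union> B. w' j b v) = d j"
    and "\<And>b v. b \<in> B \<Longrightarrow> v \<in> V - {\<alpha>} \<Longrightarrow> (\<Sum>j\<in>J. w' j b v) = m v"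
    and "\<And>b b'. b \<in> B \<Longrightarrow> b' \<in> B \<Longrightarrow> b \<noteq> b' \<Longrightarrow> (\<Sum>j\<in>J. w' j b b') = l"
    and "\<And>b. b \<in> B \<Longrightarrow> (\<Sum>j\<in>J. w' j b b) = 0"
proof -
  \<comment> \<open>\<open>B\<close>, \<open>V\<close>, \<open>w\<close> and \<open>m\<close> are
    parameters since all of them change when a vertex is split off; \<open>d\<close> and
    \<open>l\<close> stay the same.\<close>
  define Q where "Q B V w m w' \<longleftrightarrow> (\<forall>j\<in>J. connected_even (V \<union> B) (w' j)) \<and>
    (\<forall>j. \<forall>u\<in>V - {\<alpha>}. \<forall>v\<in>V - {\<alpha>}. w' j u v = w j u v) \<and>
    (\<forall>j\<in>J. \<forall>u\<in>V - {\<alpha>}. (\<Sum>b\<in>B. w' j u b) = w j u \<alpha>) \<and>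
    (\<forall>j\<in>J. \<forall>b\<in>B. (\<Sum>v\<in>V \<union> B. w' j b v) = d j) \<and>
    (\<forall>b\<in>B. \<forall>v\<in>V - {\<alpha>}. (\<Sum>j\<in>J. w' j b v) = m v) \<and>
    (\<forall>b\<in>B. \<forall>b'\<in>B. b \<noteq> b' \<longrightarrow> (\<Sum>j\<in>J. w' j b b') = l) \<and>
    (\<forall>b\<in>B. (\<Sum>j\<in>J. w' j b b) = 0)" for B V and w w' :: "'j \<Rightarrow> 'v \<Rightarrow> 'v \<Rightarrow> nat" and m
  have "\<exists>w'. Q B V w m w'"
    using finV \<alpha> finB VB w d m l
  proof (induction "card B" arbitrary: B V w m)
    case 0
    then have "B = {}" by simp
    with 0(5) show ?case by simp
  next
    case (Suc h B V w m)
    show ?case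
    proof (cases "h = 0")
      case True
      with Suc.hyps(2) have "card B = 1" by simp
      with Suc.prems(4) have B: "B = {\<alpha>}" by (metis card_1_singletonE Int_iff singletonD singletonI)
      then have "V \<union> B = V" using Suc.prems(2) by blast
      with B Suc.prems show ?thesis unfolding Q_def by (intro exI[of _ w]) auto
    next
      case False
      let ?h = "card B"
      have h2: "?h \<ge> 2" using False Suc.hyps(2) by simp
      have "\<alpha> \<in> B" using Suc.prems(4) by blast
      have "card (B - {\<alpha>}) = h" using Suc.hyps(2) \<open>\<alpha> \<in> B\<close> Suc.prems(3) by simp
      with False obtain \<beta> where "\<beta> \<in> B - {\<alpha>}" by (metis card.empty ex_in_conv)
      then have \<beta>: "\<beta> \<in> B" "\<beta> \<noteq> \<alpha>" "\<beta> \<notin> V" using Suc.prems(4) by auto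
      from split_off_vertex[OF finJ Suc.prems(1,2) \<beta>(3) h2 Suc.prems(5,6,7,8)] obtain w1 where
        w1: "\<And>j. j \<in> J \<Longrightarrow> connected_even (insert \<beta> V) (w1 j)"
        "\<And>j u v. u \<in> V - {\<alpha>} \<Longrightarrow> v \<in> V - {\<alpha>} \<Longrightarrow> w1 j u v = w j u v"
        "\<And>j u. j \<in> J \<Longrightarrow> u \<in> V - {\<alpha>} \<Longrightarrow> w1 j u \<alpha> + w1 j u \<beta> = w j u \<alpha>"
        "\<And>j. j \<in> J \<Longrightarrow> (\<Sum>v\<in>insert \<beta> V. w1 j \<beta> v) = d j"
        "\<And>j. j \<in> J \<Longrightarrow> (\<Sum>v\<in>insert \<beta> V. w1 j \<alpha> v) = (?h - 1) * d j"
        "\<And>v. v \<in> V - {\<alpha>} \<Longrightarrow> (\<Sum>j\<in>J. w1 j \<beta> v) = m v"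
        "\<And>v. v \<in> V - {\<alpha>} \<Longrightarrow> (\<Sum>j\<in>J. w1 j \<alpha> v) = (?h - 1) * m v"
        "(\<Sum>j\<in>J. w1 j \<alpha> \<beta>) = (?h - 1) * l"
        "(\<Sum>j\<in>J. w1 j \<alpha> \<alpha>) = (?h - 1) * ((?h - 2) * l)"
        "\<And>j. w1 j \<beta> \<beta> = 0" by blast
      define B' where "B' = B - {\<beta>}"
      define V' where "V' = insert \<beta> V"
      \<comment> \<open>Once split off, \<open>\<beta>\<close> counts as an ordinary vertex, to be
        joined by \<open>l\<close> edges to each vertex still in \<open>\<alpha>\<close>.\<close>
      define m' where "m' = m(\<beta> := l)"
      have cB': "card B' = h" unfolding B'_def using Suc.hyps(2) \<beta>(1) Suc.prems(3) by simp
      have h1: "?h - 1 = h" "?h - 2 = h - 1" using Suc.hyps(2) by simp_all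
      have V'a: "V' - {\<alpha>} = insert \<beta> (V - {\<alpha>})" unfolding V'_def using \<beta> by blast
      have VB': "V' \<union> B' = V \<union> B" unfolding V'_def B'_def using \<beta> by blast
      have Bb: "B = insert \<beta> B'" "\<beta> \<notin> B'" unfolding B'_def using \<beta> by auto
      have finB': "finite B'" unfolding B'_def using Suc.prems(3) by simp
      have p: "h = card B'" "finite V'" "\<alpha> \<in> V'" "finite B'" "V' \<inter> B' = {\<alpha>}"
        "\<And>j. j \<in> J \<Longrightarrow> connected_even V' (w1 j)"
        "\<And>j. j \<in> J \<Longrightarrow> (\<Sum>v\<in>V'. w1 j \<alpha> v) = card B' * d j \<and> d j \<ge> 1 \<and> even (d j)"
        "(\<Sum>j\<in>J. w1 j \<alpha> \<alpha>) = card B' * ((card B' - 1) * l)"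
        using cB' Suc.prems \<beta> w1 h1 finB' unfolding V'_def B'_def by auto
      have p': "(\<Sum>j\<in>J. w1 j \<alpha> v) = card B' * m' v" if "v \<in> V' - {\<alpha>}" for v
        using that w1(7,8) \<beta> unfolding V'a cB' m'_def h1 by auto
      have "\<exists>w2. Q B' V' w1 m' w2" by (rule Suc.hyps(1); fact p p')
      then obtain w2 where w2Q: "Q B' V' w1 m' w2" by blast
      have w2: "\<And>j. j \<in> J \<Longrightarrow> connected_even (V \<union> B) (w2 j)"
        "\<And>j u v. u \<in> V' - {\<alpha>} \<Longrightarrow> v \<in> V' - {\<alpha>} \<Longrightarrow> w2 j u v = w1 j u v"
        "\<And>j u. j \<in> J \<Longrightarrow> u \<in> V' - {\<alpha>} \<Longrightarrow> (\<Sum>b\<in>B'. w2 j u b) = w1 j u \<alpha>"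
        "\<And>j b. j \<in> J \<Longrightarrow> b \<in> B' \<Longrightarrow> (\<Sum>v\<in>V \<union> B. w2 j b v) = d j"
        "\<And>b v. b \<in> B' \<Longrightarrow> v \<in> V' - {\<alpha>} \<Longrightarrow> (\<Sum>j\<in>J. w2 j b v) = m' v"
        "\<And>b b'. b \<in> B' \<Longrightarrow> b' \<in> B' \<Longrightarrow> b \<noteq> b' \<Longrightarrow> (\<Sum>j\<in>J. w2 j b b') = l"
        "\<And>b. b \<in> B' \<Longrightarrow> (\<Sum>j\<in>J. w2 j b b) = 0"
        using w2Q unfolding Q_def VB' by blast+
      have sym2: "w2 j u v = w2 j v u" if "j \<in> J" "u \<in> V \<union> B" "v \<in> V \<union> B" for j u v
        using w2(1)[OF that(1)] that unfolding connected_even_def multiplicity_fun_def by blast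
      have \<beta>B': "(\<Sum>j\<in>J. w2 j b \<beta>) = l" if "b \<in> B'" for b
        using w2(5)[OF that, of \<beta>] unfolding V'a m'_def by simp
      have \<beta>B'2: "(\<Sum>j\<in>J. w2 j \<beta> b) = l" if "b \<in> B'" for b
        unfolding \<beta>B'[OF that, symmetric] by (rule sum.cong) (use sym2 that Bb in auto)
      show ?thesis unfolding Q_def
      proof (intro exI[of _ w2] conjI ballI allI impI)
        show "connected_even (V \<union> B) (w2 j)" if "j \<in> J" for j using w2 that by blast
        show "w2 j u v = w j u v" if "u \<in> V - {\<alpha>}" "v \<in> V - {\<alpha>}" for j u v
          using w2(2)[of u v j] w1(2)[of u v j] that unfolding V'a by simp
        show "(\<Sum>b\<in>B. w2 j u b) = w j u \<alpha>" if "j \<in> J" "u \<in> V - {\<alpha>}" for j u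
          using w2(2)[of u \<beta> j] w2(3)[of j u] w1(3)[of j u] that finB' Bb unfolding V'a by simp
        show "(\<Sum>v\<in>V \<union> B. w2 j b v) = d j" if j: "j \<in> J" and b: "b \<in> B" for j b
        proof (cases "b = \<beta>")
          case True
          \<comment> \<open>The later splittings only spread the edges between
            \<open>\<beta>\<close> and \<open>\<alpha>\<close> over \<open>B'\<close>, so the degree
            of \<open>\<beta>\<close> stays as it was when \<open>\<beta>\<close> was
            created.\<close>
          have "V \<union> B = (insert \<beta> (V - {\<alpha>})) \<union> B'" using Bb \<beta> Suc.prems(4) unfolding B'_def by auto
          moreover have "insert \<beta> (V - {\<alpha>}) \<inter> B' = {}" using Suc.prems(4) \<beta> unfolding B'_def by auto
          ultimately have "(\<Sum>v\<in>V \<union> B. w2 j b v) = (\<Sum>v\<in>insert \<beta> (V - {\<alpha>}). w2 j b v) + (\<Sum>v\<in>B'. w2 j b v)"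
            using finB' Suc.prems(1) by (simp only: sum.union_disjoint finite_insert finite_Diff)
          also have "(\<Sum>v\<in>B'. w2 j b v) = w1 j \<beta> \<alpha>" unfolding True using w2(3)[OF j, of \<beta>] unfolding V'a by simp
          also have "(\<Sum>v\<in>insert \<beta> (V - {\<alpha>}). w2 j b v) = (\<Sum>v\<in>insert \<beta> (V - {\<alpha>}). w1 j \<beta> v)"
            unfolding True by (rule sum.cong) (use w2(2) in \<open>auto simp: V'a\<close>)
          also have "(\<Sum>v\<in>insert \<beta> (V - {\<alpha>}). w1 j \<beta> v) + w1 j \<beta> \<alpha> = (\<Sum>v\<in>insert \<beta> V. w1 j \<beta> v)"
            using Suc.prems(1,2) \<beta> by (simp add: sum.remove)
          finally show ?thesis using w1(4)[OF j] by simp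
        next
          case False
          then show ?thesis using w2(4)[OF j, of b] b Bb by blast
        qed
        show "(\<Sum>j\<in>J. w2 j b v) = m v" if b: "b \<in> B" and v: "v \<in> V - {\<alpha>}" for b v
        proof (cases "b = \<beta>")
          case True
          have "(\<Sum>j\<in>J. w2 j \<beta> v) = (\<Sum>j\<in>J. w1 j \<beta> v)"
            by (rule sum.cong) (use w2(2) v in \<open>auto simp: V'a\<close>)
          then show ?thesis using w1(6)[OF v] True by simp
        next
          case False
          have "v \<noteq> \<beta>" using v \<beta> by blast
          then show ?thesis using w2(5)[of b v] False b v Bb unfolding V'a m'_def by simp
        qed
        show "(\<Sum>j\<in>J. w2 j b b') = l" if "b \<in> B" "b' \<in> B" "b \<noteq> b'" for b b'
          using that \<beta>B' \<beta>B'2 w2(6) Bb by blast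
        show "(\<Sum>j\<in>J. w2 j b b) = 0" if "b \<in> B" for b
        proof (cases "b = \<beta>")
          case True
          have "w2 j \<beta> \<beta> = 0" for j using w2(2)[of \<beta> \<beta> j] w1(10)[of j] unfolding V'a by simp
          then show ?thesis using True by simp
        next
          case False
          then show ?thesis using w2(7) that Bb by blast
        qed
      qed
    qed
  qed
  then obtain w' where "Q B V w m w'" by blast
  then show ?thesis unfolding Q_def by (intro that[of w']) blast+
qed

section \<open>Multigraphs with maximum degree two\<close>

definition edge_count :: "('v, 'e) multigraph \<Rightarrow> 'v \<Rightarrow> 'v \<Rightarrow> nat" where
  "edge_count H u v = card {e \<in> edges H. ends H e = {u, v}}"

definition degree :: "('v, 'e) multigraph \<Rightarrow> 'v \<Rightarrow> nat" where
  "degree H u = card {e \<in> edges H. u \<in> ends H e}"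

definition finite_loopless :: "('v, 'e) multigraph \<Rightarrow> bool" where
  "finite_loopless H \<longleftrightarrow> finite (vertices H) \<and> finite (edges H) \<and> loopless H"

lemma loopless_ends:
  assumes "loopless H" "e \<in> edges H"
  obtains u v where "ends H e = {u, v}" "u \<noteq> v" "u \<in> vertices H" "v \<in> vertices H"
  using assms unfolding loopless_def by (auto simp: card_2_iff)

lemma edge_count_self: "loopless H \<Longrightarrow> edge_count H u u = 0"
  unfolding edge_count_def loopless_def by (auto simp: card_eq_0_iff)

lemma edge_count_commute: "edge_count H u v = edge_count H v u"
  unfolding edge_count_def by (simp add: insert_commute)

lemma multiplicity_fun_edge_count: "loopless H \<Longrightarrow> multiplicity_fun V (edge_count H)"
  unfolding multiplicity_fun_def by (simp add: edge_count_self edge_count_commute)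

lemma degree_eq_sum_edge_count:
  assumes H: "finite_loopless H" and u: "u \<in> vertices H"
  shows "degree H u = (\<Sum>v\<in>vertices H. edge_count H u v)"
proof -
  have fin: "finite (vertices H)" "finite (edges H)" and ll: "loopless H"
    using H unfolding finite_loopless_def by auto
  have "{e \<in> edges H. u \<in> ends H e} = (\<Union>v\<in>vertices H. {e \<in> edges H. ends H e = {u, v}})"
  proof (intro equalityI subsetI)
    fix e assume e: "e \<in> {e \<in> edges H. u \<in> ends H e}"
    then obtain x y where "ends H e = {x, y}" "x \<in> vertices H" "y \<in> vertices H"
      using loopless_ends[OF ll, of e] by blast
    with e show "e \<in> (\<Union>v\<in>vertices H. {e \<in> edges H. ends H e = {u, v}})" by (auto simp: insert_commute)
  qed auto
  moreover have "card (\<Union>v\<in>vertices H. {e \<in> edges H. ends H e = {u, v}}) =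
      (\<Sum>v\<in>vertices H. card {e \<in> edges H. ends H e = {u, v}})"
    by (rule card_UN_disjoint) (use fin in \<open>auto simp: doubleton_eq_iff\<close>)
  ultimately show ?thesis unfolding degree_def edge_count_def by simp
qed

text \<open>Identifies the relation in \<open>connectedness\<close>, given by individual edges, with
  the one used for multiplicity functions.\<close>

lemma edge_relation_eq_adj:
  assumes H: "finite_loopless H"
  shows "{(x, y). \<exists>e\<in>edges H. ends H e = {x, y}} = adj (vertices H) (edge_count H)"
proof -
  have "x \<in> vertices H \<and> y \<in> vertices H" if "e \<in> edges H" "ends H e = {x, y}" for e x y
    using that H unfolding finite_loopless_def loopless_def by blast
  moreover have "edge_count H x y > 0 \<longleftrightarrow> (\<exists>e\<in>edges H. ends H e = {x, y})" for x y
    using H unfolding edge_count_def finite_loopless_def by (auto simp: card_gt_0_iff)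
  ultimately show ?thesis unfolding adj_def by blast
qed

lemma handshake:
  assumes H: "finite_loopless H"
  shows "(\<Sum>u\<in>vertices H. degree H u) = 2 * card (edges H)"
proof -
  have fin: "finite (vertices H)" "finite (edges H)" and ll: "loopless H"
    using H unfolding finite_loopless_def by auto
  have "(\<Sum>u\<in>vertices H. degree H u) = (\<Sum>u\<in>vertices H. \<Sum>e\<in>{e \<in> edges H. u \<in> ends H e}. 1::nat)"
    unfolding degree_def by simp
  also have "\<dots> = (\<Sum>e\<in>edges H. \<Sum>u\<in>{u \<in> vertices H. u \<in> ends H e}. 1)"
    by (rule sum.swap_restrict[OF fin])
  also have "\<dots> = (\<Sum>e\<in>edges H. 2)"
  proof (rule sum.cong[OF refl])
    fix e assume e: "e \<in> edges H"
    then have "{u \<in> vertices H. u \<in> ends H e} = ends H e" "card (ends H e) = 2"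
      using ll unfolding loopless_def by blast+
    then show "(\<Sum>u\<in>{u \<in> vertices H. u \<in> ends H e}. 1) = (2::nat)" by simp
  qed
  finally show ?thesis by simp
qed

section \<open>Connected multigraphs of maximum degree two are paths or cycles\<close>

lemma two_neighbours:
  assumes "finite S" "card S \<le> 2" "a \<in> S" "b \<in> S" "c \<in> S"
  shows "a = b \<or> a = c \<or> b = c"
proof (rule ccontr)
  assume "\<not> ?thesis"
  then have "card {a, b, c} = 3" by simp
  moreover have "card {a, b, c} \<le> card S" by (rule card_mono) (use assms in auto)
  ultimately show False using assms(2) by simp
qed

text \<open>A longest path is closed under taking neighbors, hence spans the connected graph, and
  the degree bound leaves no room for a chord except between its two ends.\<close>

lemma ex_spanning_walk:
  fixes V :: "'v set"
  assumes fin: "finite V" and ne: "V \<noteq> {}" and AV: "A \<subseteq> V \<times> V" and symA: "sym A"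
    and conn: "\<And>u v. u \<in> V \<Longrightarrow> v \<in> V \<Longrightarrow> (u, v) \<in> A\<^sup>*"
    and deg: "\<And>u. u \<in> V \<Longrightarrow> card {v. (u, v) \<in> A} \<le> 2"
  obtains vs where "distinct vs" "set vs = V"
    "\<And>i. Suc i < length vs \<Longrightarrow> (vs ! i, vs ! Suc i) \<in> A"
    "\<And>i j. i < j \<Longrightarrow> j < length vs \<Longrightarrow> (vs ! i, vs ! j) \<in> A \<Longrightarrow> j = Suc i \<or> i = 0 \<and> Suc j = length vs"
proof -
  define P where "P vs \<longleftrightarrow> vs \<noteq> [] \<and> distinct vs \<and> set vs \<subseteq> V \<and>
    (\<forall>i. Suc i < length vs \<longrightarrow> (vs ! i, vs ! Suc i) \<in> A)" for vs
  obtain x0 where "x0 \<in> V" using ne by blast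
  then have Px0: "P [x0]" unfolding P_def by simp
  have bound: "\<forall>vs. P vs \<longrightarrow> length vs < Suc (card V)"
  proof (intro allI impI)
    fix vs assume "P vs"
    then have "distinct vs" "set vs \<subseteq> V" unfolding P_def by auto
    then show "length vs < Suc (card V)" using card_mono[OF fin, of "set vs"] distinct_card[of vs] by simp
  qed
  obtain vs where "P vs \<and> (\<forall>ys. P ys \<longrightarrow> length ys \<le> length vs)"
    using ex_has_greatest_nat[of P "[x0]" length "Suc (card V)", OF Px0 bound] by (rule exE)
  then have vs: "P vs" and max: "\<And>ys. P ys \<Longrightarrow> length ys \<le> length vs" by simp_all
  let ?n = "length vs"
  have dist: "distinct vs" and sub: "set vs \<subseteq> V" and ne: "vs \<noteq> []"
    and step: "\<And>i. Suc i < ?n \<Longrightarrow> (vs ! i, vs ! Suc i) \<in> A" using vs unfolding P_def by blast+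
  have step': "(vs ! Suc i, vs ! i) \<in> A" if "Suc i < ?n" for i using step[OF that] symA by (blast dest: symD)
  have finN: "finite {v. (u, v) \<in> A}" for u by (rule finite_subset[OF _ fin]) (use AV in auto)
  have inV: "vs ! i \<in> V" if "i < ?n" for i using that sub nth_mem by blast
  have nb: "a = b \<or> a = c \<or> b = c" if "i < ?n" "(vs ! i, a) \<in> A" "(vs ! i, b) \<in> A" "(vs ! i, c) \<in> A" for i a b c
    using two_neighbours[OF finN deg[OF inV[OF that(1)]], of a b c] that by simp
  have idx: "vs ! i = vs ! j \<longleftrightarrow> i = j" if "i < ?n" "j < ?n" for i j
    using dist that by (rule nth_eq_iff_index_eq)
  \<comment> \<open>A neighbor off the path would extend the path at an end and be a third neighbor
    at an inner vertex.\<close>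
  have closed: "x \<in> set vs" if i: "i < ?n" and x: "(vs ! i, x) \<in> A" for i x
  proof (rule ccontr)
    assume nx: "x \<notin> set vs"
    have xV: "x \<in> V" using x AV by auto
    consider "i = 0" | "Suc i = ?n" | "i > 0" "Suc i < ?n" using i by linarith
    then show False
    proof cases
      case 1
      have "P (x # vs)" unfolding P_def
      proof (intro conjI allI impI)
        fix k assume k: "Suc k < length (x # vs)"
        show "((x # vs) ! k, (x # vs) ! Suc k) \<in> A"
          using x 1 symA k step by (cases k) (auto dest: symD)
      qed (use nx xV sub dist in auto)
      from max[OF this] show False by simp
    next
      case 2
      have "P (vs @ [x])" unfolding P_def
      proof (intro conjI allI impI)
        fix k assume k: "Suc k < length (vs @ [x])"
        show "((vs @ [x]) ! k, (vs @ [x]) ! Suc k) \<in> A"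
        proof (cases "Suc k < ?n")
          case True then show ?thesis using step by (simp add: nth_append)
        next
          case False
          then have "k = i" using k 2 by simp
          then show ?thesis using x 2 by (simp add: nth_append)
        qed
      qed (use nx xV sub dist in auto)
      from max[OF this] show False by simp
    next
      case 3
      have "(vs ! i, vs ! (i - 1)) \<in> A" using step'[of "i - 1"] 3 by simp
      from nb[OF i this step[OF 3(2)] x] have "vs ! (i - 1) = vs ! Suc i \<or> x \<in> set vs"
        using 3 nth_mem[of "i - 1" vs] nth_mem[of "Suc i" vs] by auto
      with nx have "i - 1 = Suc i" using idx[of "i - 1" "Suc i"] 3 by simp
      then show False by simp
    qed
  qed
  have "set vs = V"
  proof
    show "V \<subseteq> set vs"
    proof
      fix v assume "v \<in> V"
      with conn[OF inV[of 0]] ne have "(vs ! 0, v) \<in> A\<^sup>*" by simp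
      then show "v \<in> set vs"
      proof (induction rule: rtrancl_induct)
        case base show ?case using ne by simp
      next
        case (step y z)
        then show ?case using closed by (metis in_set_conv_nth)
      qed
    qed
  qed (rule sub)
  \<comment> \<open>A forbidden chord has an end in the interior of the path, which then has this
    chord besides its two path neighbors.\<close>
  moreover have "j = Suc i \<or> i = 0 \<and> Suc j = ?n" if ij: "i < j" "j < ?n" and A: "(vs ! i, vs ! j) \<in> A" for i j
  proof (rule ccontr)
    assume neg: "\<not> ?thesis"
    then have j: "j > Suc i" using ij by simp
    show False
    proof (cases "i = 0")
      case False
      have "(vs ! i, vs ! (i - 1)) \<in> A" using step'[of "i - 1"] False ij by simp
      from nb[OF _ this step A] ij j idx[of "i - 1" "Suc i"] idx[of "i - 1" j] idx[of "Suc i" j]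
      show False by auto
    next
      case True
      then have Sj: "Suc j < ?n" using neg ij by simp
      have "(vs ! j, vs ! (j - 1)) \<in> A" using step'[of "j - 1"] ij by simp
      moreover have "(vs ! j, vs ! i) \<in> A" using A symA by (blast dest: symD)
      ultimately show False
        using nb[OF ij(2) _ step[OF Sj], of "vs ! (j - 1)" "vs ! i"] ij j True Sj
          idx[of "j - 1" "Suc j"] idx[of "j - 1" i] idx[of "Suc j" i] by (cases vs) auto
    qed
  qed
  ultimately show ?thesis using that[OF dist _ step] by blast
qed

text \<open>Supplies the edge lists that the definitions of path and cycle demand: when no two edges
  share their end pair, the order of the pairs determines the order of the edges.\<close>

lemma edge_list_of_bij:
  assumes inj: "inj_on P {..<m}" and bij: "bij_betw (ends H) (edges H) (P ` {..<m})"
  obtains es where "distinct es" "set es = edges H" "length es = m" "\<And>i. i < m \<Longrightarrow> ends H (es ! i) = P i"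
proof -
  define f where "f = inv_into (edges H) (ends H) \<circ> P"
  have f: "bij_betw f {..<m} (edges H)" unfolding f_def
    by (rule bij_betw_trans[OF inj_on_imp_bij_betw[OF inj] bij_betw_inv_into[OF bij]])
  have "ends H (f i) = P i" if "i < m" for i
    unfolding f_def using that bij by (simp add: bij_betw_inv_into_right)
  moreover have "distinct (map f [0..<m])" "set (map f [0..<m]) = edges H"
    using f by (auto simp: bij_betw_def distinct_map atLeast0LessThan)
  ultimately show ?thesis by (intro that[of "map f [0..<m]"]) auto
qed

text \<open>The relation \<open>A\<close> forgets parallel edges. Double edges are therefore
  excluded separately before a walk along \<open>A\<close> is turned into a list of edges.\<close>

locale connected_degree_two =
  fixes H :: "('v, 'e) multigraph"
  assumes fl: "finite_loopless H" and ne: "vertices H \<noteq> {}"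
    and conn: "connected_on (vertices H) (edge_count H)"
    and deg: "\<And>u. u \<in> vertices H \<Longrightarrow> degree H u \<le> 2"
begin

abbreviation "A \<equiv> adj (vertices H) (edge_count H)"

lemma fin: "finite (vertices H)" "finite (edges H)" and ll: "loopless H"
  using fl unfolding finite_loopless_def by auto

lemma neighbours_subset: "{v. (u, v) \<in> A} \<subseteq> vertices H"
  unfolding adj_def by auto

lemma card_neighbours_le:
  assumes "u \<in> vertices H"
  shows "card {v. (u, v) \<in> A} \<le> degree H u"
proof -
  have "card {v. (u, v) \<in> A} = (\<Sum>v\<in>{v. (u, v) \<in> A}. 1)" by simp
  also have "\<dots> \<le> (\<Sum>v\<in>{v. (u, v) \<in> A}. edge_count H u v)"
    by (rule sum_mono) (auto simp: adj_def)
  also have "\<dots> \<le> (\<Sum>v\<in>vertices H. edge_count H u v)"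
    by (rule sum_mono2) (use fin neighbours_subset in auto)
  finally show ?thesis using degree_eq_sum_edge_count[OF fl assms] by simp
qed

lemma two_le_degree:
  assumes "(u, v) \<in> A" "(u, v') \<in> A" "v \<noteq> v'"
  shows "2 \<le> degree H u"
proof -
  have u: "u \<in> vertices H" using assms(1) unfolding adj_def by auto
  have "card {v, v'} \<le> card {v. (u, v) \<in> A}"
    by (rule card_mono[OF finite_subset[OF neighbours_subset fin(1)]]) (use assms in auto)
  with card_neighbours_le[OF u] assms(3) show ?thesis by simp
qed

lemma sym_A: "(u, v) \<in> A \<Longrightarrow> (v, u) \<in> A"
  using sym_adj[OF multiplicity_fun_edge_count[OF ll]] by (blast dest: symD)

text \<open>Two parallel edges exhaust the degree of both their ends, so by connectedness there is
  no further vertex.\<close>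

lemma double_edge:
  assumes uv: "u \<in> vertices H" "v \<in> vertices H" and two: "2 \<le> edge_count H u v"
  shows "vertices H = {u, v}" and "2 \<le> degree H u" and "2 \<le> degree H v"
proof -
  have only: "y = x'" if x: "x \<in> vertices H" "x' \<in> vertices H" "2 \<le> edge_count H x x'" and y: "(x, y) \<in> A" for x x' y
  proof (rule ccontr)
    assume "y \<noteq> x'"
    then have "edge_count H x x' + edge_count H x y = (\<Sum>z\<in>{x', y}. edge_count H x z)" by simp
    also have "\<dots> \<le> (\<Sum>z\<in>vertices H. edge_count H x z)"
      by (rule sum_mono2) (use fin x y in \<open>auto simp: adj_def\<close>)
    also have "\<dots> \<le> 2" using deg[OF x(1)] degree_eq_sum_edge_count[OF fl x(1)] by simp
    finally show False using x y unfolding adj_def by auto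
  qed
  have two': "2 \<le> edge_count H v u" using two edge_count_commute by metis
  have "x \<in> {u, v}" if "x \<in> vertices H" for x
  proof -
    have "(u, x) \<in> A\<^sup>*" using conn uv(1) that unfolding connected_on_def by blast
    then show ?thesis
      by (induction rule: rtrancl_induct) (use only[OF uv two] only[OF uv(2,1) two'] in auto)
  qed
  then show "vertices H = {u, v}" using uv by blast
  have "edge_count H x y \<le> degree H x" if "x \<in> vertices H" "y \<in> vertices H" for x y
    unfolding degree_eq_sum_edge_count[OF fl that(1)] by (rule member_le_sum) (use that fin in auto)
  from this[OF uv] this[OF uv(2,1)] two two' show "2 \<le> degree H u" "2 \<le> degree H v" by auto
qed

lemma inj_on_ends:
  assumes "\<And>u v. u \<in> vertices H \<Longrightarrow> v \<in> vertices H \<Longrightarrow> edge_count H u v \<le> 1"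
  shows "inj_on (ends H) (edges H)"
proof (rule inj_onI)
  fix e e' assume e: "e \<in> edges H" "e' \<in> edges H" "ends H e = ends H e'"
  obtain u v where uv: "ends H e = {u, v}" "u \<in> vertices H" "v \<in> vertices H"
    using loopless_ends[OF ll e(1)] by metis
  have "card {e \<in> edges H. ends H e = {u, v}} \<le> Suc 0" using assms[OF uv(2,3)] unfolding edge_count_def by simp
  then show "e = e'" using e uv fin by (subst (asm) card_le_Suc0_iff_eq) auto
qed

lemma spanning_walk:
  obtains vs where "distinct vs" "set vs = vertices H" "vs \<noteq> []"
    "\<And>i. Suc i < length vs \<Longrightarrow> (vs ! i, vs ! Suc i) \<in> A"
    "\<And>i j. i < j \<Longrightarrow> j < length vs \<Longrightarrow> (vs ! i, vs ! j) \<in> A \<Longrightarrow> j = Suc i \<or> i = 0 \<and> Suc j = length vs"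
proof -
  have AV: "A \<subseteq> vertices H \<times> vertices H" unfolding adj_def by auto
  have c: "(u, v) \<in> A\<^sup>*" if "u \<in> vertices H" "v \<in> vertices H" for u v
    using conn that unfolding connected_on_def by blast
  have d: "card {v. (u, v) \<in> A} \<le> 2" if "u \<in> vertices H" for u
    using card_neighbours_le[OF that] deg[OF that] by simp
  from ex_spanning_walk[OF fin(1) ne AV sym_adj[OF multiplicity_fun_edge_count[OF ll]] c d]
  obtain vs where "distinct vs" "set vs = vertices H"
    "\<And>i. Suc i < length vs \<Longrightarrow> (vs ! i, vs ! Suc i) \<in> A"
    "\<And>i j. i < j \<Longrightarrow> j < length vs \<Longrightarrow> (vs ! i, vs ! j) \<in> A \<Longrightarrow> j = Suc i \<or> i = 0 \<and> Suc j = length vs" by blast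
  moreover from this(2) ne have "vs \<noteq> []" by auto
  ultimately show ?thesis using that by blast
qed

lemma ends_of_pair:
  assumes "(u, v) \<in> A"
  shows "{u, v} \<in> ends H ` edges H"
proof -
  have "(u, v) \<in> {(x, y). \<exists>e\<in>edges H. ends H e = {x, y}}" unfolding edge_relation_eq_adj[OF fl] by (rule assms)
  then obtain e where "e \<in> edges H" "ends H e = {u, v}" by blast
  then show ?thesis by (intro image_eqI[of _ _ e]) simp_all
qed

lemma pair_of_edge:
  assumes "e \<in> edges H" "set vs = vertices H" "distinct vs"
  obtains i j where "i < j" "j < length vs" "ends H e = {vs ! i, vs ! j}" "(vs ! i, vs ! j) \<in> A"
proof -
  obtain u v where uv: "ends H e = {u, v}" "u \<noteq> v" "u \<in> vertices H" "v \<in> vertices H"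
    by (rule loopless_ends[OF ll assms(1)])
  then have A: "(u, v) \<in> A" using edge_relation_eq_adj[OF fl] assms(1) by blast
  obtain i j where ij: "i < length vs" "j < length vs" "u = vs ! i" "v = vs ! j"
    using uv assms(2) by (metis in_set_conv_nth)
  then have "i \<noteq> j" using uv by blast
  then consider "i < j" | "j < i" by linarith
  then show ?thesis
    by cases (use that[of i j] that[of j i] ij uv A sym_A[OF A] in \<open>auto simp: insert_commute\<close>)
qed

text \<open>The vertex \<open>z\<close> of degree at most 1 rules out both a double edge and an edge
  closing the spanning walk to a cycle.\<close>

lemma is_path_graph:
  assumes z: "z \<in> vertices H" "degree H z \<le> 1"
  shows "is_path_graph H"
proof -
  have le1: "edge_count H u v \<le> 1" if "u \<in> vertices H" "v \<in> vertices H" for u v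
  proof (rule ccontr)
    assume "\<not> ?thesis"
    then have "2 \<le> edge_count H u v" by simp
    from double_edge[OF that this] z show False by auto
  qed
  from spanning_walk obtain vs where vs: "distinct vs" "set vs = vertices H" "vs \<noteq> []"
    "\<And>i. Suc i < length vs \<Longrightarrow> (vs ! i, vs ! Suc i) \<in> A"
    "\<And>i j. i < j \<Longrightarrow> j < length vs \<Longrightarrow> (vs ! i, vs ! j) \<in> A \<Longrightarrow> j = Suc i \<or> i = 0 \<and> Suc j = length vs"
    by blast
  define m where "m = length vs - 1"
  have n: "length vs = Suc m" using vs(3) unfolding m_def by (cases vs) auto
  define P where "P i = {vs ! i, vs ! Suc i}" for i
  have idx: "vs ! i = vs ! j \<longleftrightarrow> i = j" if "i < length vs" "j < length vs" for i j
    using vs(1) that by (rule nth_eq_iff_index_eq)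
  have inj: "inj_on P {..<m}"
    by (rule inj_onI) (auto simp: P_def doubleton_eq_iff idx n)
  \<comment> \<open>If the ends were adjacent, every vertex, including \<open>z\<close>, would have
    two neighbors. For \<open>m = 1\<close> the pair in question is the path edge itself.\<close>
  have no_chord: "(vs ! 0, vs ! m) \<notin> A" if "m \<ge> 2"
  proof
    assume ch: "(vs ! 0, vs ! m) \<in> A"
    obtain k where k: "k \<le> m" "z = vs ! k" using z(1) vs(2) n by (metis in_set_conv_nth less_Suc_eq_le)
    have "\<exists>v v'. (z, v) \<in> A \<and> (z, v') \<in> A \<and> v \<noteq> v'"
    proof -
      consider "k = 0" | "k = m" | "0 < k" "k < m" using k by linarith
      then show ?thesis
      proof cases
        case 1
        then show ?thesis using ch vs(4)[of 0] k n that idx[of m 1] by (intro exI[of _ "vs ! m"] exI[of _ "vs ! 1"]) auto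
      next
        case 2
        then show ?thesis using sym_A[OF ch] sym_A[OF vs(4)[of "m - 1"]] k n that idx[of 0 "m - 1"]
          by (intro exI[of _ "vs ! 0"] exI[of _ "vs ! (m - 1)"]) auto
      next
        case 3
        then show ?thesis using vs(4)[of k] sym_A[OF vs(4)[of "k - 1"]] k n idx[of "Suc k" "k - 1"]
          by (intro exI[of _ "vs ! Suc k"] exI[of _ "vs ! (k - 1)"]) auto
      qed
    qed
    then show False using two_le_degree z by fastforce
  qed
  have "ends H ` edges H = P ` {..<m}"
  proof (intro equalityI subsetI)
    fix p assume "p \<in> ends H ` edges H"
    then obtain e where e: "e \<in> edges H" "p = ends H e" by blast
    obtain i j where ij: "i < j" "j < length vs" "ends H e = {vs ! i, vs ! j}" "(vs ! i, vs ! j) \<in> A"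
      by (rule pair_of_edge[OF e(1) vs(2,1)])
    have "j = Suc i"
    proof (rule ccontr)
      assume "j \<noteq> Suc i"
      then have "i = 0" "j = m" "m \<ge> 2" using vs(5)[OF ij(1,2,4)] n ij by auto
      then show False using no_chord ij by blast
    qed
    then show "p \<in> P ` {..<m}" using ij e n unfolding P_def by auto
  next
    fix p assume "p \<in> P ` {..<m}"
    then show "p \<in> ends H ` edges H" using ends_of_pair[OF vs(4)] n unfolding P_def by auto
  qed
  with inj_on_ends[OF le1] have "bij_betw (ends H) (edges H) (P ` {..<m})" unfolding bij_betw_def by blast
  from edge_list_of_bij[OF inj this] obtain es where
    "distinct es" "set es = edges H" "length es = m" "\<And>i. i < m \<Longrightarrow> ends H (es ! i) = P i" by blast
  then show ?thesis unfolding is_path_graph_def P_def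
    using vs(1-3) n by (intro exI[of _ vs] exI[of _ es]) auto
qed

lemma is_cycle_graph:
  assumes deg2: "\<And>u. u \<in> vertices H \<Longrightarrow> degree H u = 2" and card3: "card (vertices H) \<ge> 3"
  shows "is_cycle_graph H"
proof -
  have le1: "edge_count H u v \<le> 1" if "u \<in> vertices H" "v \<in> vertices H" for u v
  proof (rule ccontr)
    assume "\<not> ?thesis"
    then have "2 \<le> edge_count H u v" by simp
    from double_edge(1)[OF that this] have "card (vertices H) = card {u, v}" by simp
    also have "\<dots> \<le> 2" by (simp add: card_insert_if)
    finally show False using card3 by simp
  qed
  have nb2: "card {v. (u, v) \<in> A} = 2" if u: "u \<in> vertices H" for u
  proof -
    have "2 = (\<Sum>v\<in>vertices H. edge_count H u v)"
      using deg2[OF u] degree_eq_sum_edge_count[OF fl u] by simp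
    also have "\<dots> = (\<Sum>v\<in>{v. (u, v) \<in> A}. edge_count H u v)"
      by (rule sum.mono_neutral_right) (use fin u in \<open>auto simp: adj_def\<close>)
    also have "\<dots> = (\<Sum>v\<in>{v. (u, v) \<in> A}. 1)"
      by (rule sum.cong) (use le1 in \<open>force simp: adj_def\<close>)+
    finally show ?thesis by simp
  qed
  from spanning_walk obtain vs where vs: "distinct vs" "set vs = vertices H" "vs \<noteq> []"
    "\<And>i. Suc i < length vs \<Longrightarrow> (vs ! i, vs ! Suc i) \<in> A"
    "\<And>i j. i < j \<Longrightarrow> j < length vs \<Longrightarrow> (vs ! i, vs ! j) \<in> A \<Longrightarrow> j = Suc i \<or> i = 0 \<and> Suc j = length vs"
    by blast
  let ?n = "length vs"
  have n3: "?n \<ge> 3" using card3 vs(1,2) by (metis distinct_card)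
  define P where "P i = {vs ! i, vs ! ((i + 1) mod ?n)}" for i
  have md: "(i + 1) mod ?n = (if i + 1 = ?n then 0 else i + 1)" if "i < ?n" for i using that by auto
  have idx: "vs ! i = vs ! j \<longleftrightarrow> i = j" if "i < ?n" "j < ?n" for i j
    using vs(1) that by (rule nth_eq_iff_index_eq)
  \<comment> \<open>This needs \<open>n3\<close>: for length 2 the pairs \<open>P 0\<close> and
    \<open>P 1\<close> would coincide.\<close>
  have inj: "inj_on P {..<?n}"
  proof (rule inj_onI)
    fix i j assume ij: "i \<in> {..<?n}" "j \<in> {..<?n}" and "P i = P j"
    have "(i + 1) mod ?n < ?n" "(j + 1) mod ?n < ?n" by (rule mod_less_divisor, use n3 in linarith)+
    with \<open>P i = P j\<close> have "i = j \<or> i = (j + 1) mod ?n \<and> (i + 1) mod ?n = j"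
      using idx ij unfolding P_def doubleton_eq_iff by auto
    moreover have "i < ?n" "j < ?n" using ij by simp_all
    moreover from this have "(i + 1) mod ?n = (if i + 1 = ?n then 0 else i + 1)" "(j + 1) mod ?n = (if j + 1 = ?n then 0 else j + 1)"
      using md by blast+
    ultimately show "i = j" using n3 by (auto split: if_splits)
  qed
  \<comment> \<open>Without parallel edges the first vertex has two distinct neighbors, and the only
    vertices available for this are the second and the last one.\<close>
  have close: "(vs ! 0, vs ! (?n - 1)) \<in> A"
  proof -
    have v0: "vs ! 0 \<in> vertices H" using vs(2,3) by (metis length_greater_0_conv nth_mem)
    have "{v. (vs ! 0, v) \<in> A} \<subseteq> {vs ! 1, vs ! (?n - 1)}"
    proof
      fix v assume "v \<in> {v. (vs ! 0, v) \<in> A}"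
      then have v: "(vs ! 0, v) \<in> A" by simp
      then have "v \<in> set vs" "v \<noteq> vs ! 0" using vs(2) edge_count_self[OF ll] unfolding adj_def by auto
      then obtain j where j: "j < ?n" "v = vs ! j" "j > 0" by (metis in_set_conv_nth not_gr_zero)
      with vs(5)[of 0 j] v have "j = 1 \<or> j = ?n - 1" by auto
      then show "v \<in> {vs ! 1, vs ! (?n - 1)}" using j by blast
    qed
    moreover have "card {v. (vs ! 0, v) \<in> A} \<ge> card {vs ! 1, vs ! (?n - 1)}"
      unfolding nb2[OF v0] by (simp add: card_insert_if)
    ultimately have "{v. (vs ! 0, v) \<in> A} = {vs ! 1, vs ! (?n - 1)}"
      by (intro card_seteq) auto
    then show ?thesis by blast
  qed
  have "ends H ` edges H = P ` {..<?n}"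
  proof (intro equalityI subsetI)
    fix p assume "p \<in> ends H ` edges H"
    then obtain e where e: "e \<in> edges H" "p = ends H e" by blast
    obtain i j where ij: "i < j" "j < ?n" "ends H e = {vs ! i, vs ! j}" "(vs ! i, vs ! j) \<in> A"
      by (rule pair_of_edge[OF e(1) vs(2,1)])
    from vs(5)[OF ij(1,2,4)] show "p \<in> P ` {..<?n}"
    proof
      assume "j = Suc i"
      then have "P i = p" using ij e unfolding P_def by simp
      then show ?thesis using ij by auto
    next
      assume "i = 0 \<and> Suc j = ?n"
      then have "P j = p" using ij e unfolding P_def by auto
      then show ?thesis using ij by auto
    qed
  next
    fix p assume "p \<in> P ` {..<?n}"
    then obtain i where i: "i < ?n" "p = P i" by blast
    show "p \<in> ends H ` edges H"
    proof (cases "i + 1 = ?n")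
      case True
      then have "i = ?n - 1" "(i + 1) mod ?n = 0" by simp_all
      then have "p = {vs ! (?n - 1), vs ! 0}" using i unfolding P_def by simp
      then show ?thesis using ends_of_pair[OF sym_A[OF close]] by simp
    next
      case False
      then show ?thesis using ends_of_pair[OF vs(4)[of i]] i unfolding P_def by simp
    qed
  qed
  with inj_on_ends[OF le1] have "bij_betw (ends H) (edges H) (P ` {..<?n})" unfolding bij_betw_def by blast
  from edge_list_of_bij[OF inj this] obtain es where
    "distinct es" "set es = edges H" "length es = ?n" "\<And>i. i < ?n \<Longrightarrow> ends H (es ! i) = P i" by blast
  then show ?thesis unfolding is_cycle_graph_def P_def
    using vs(1-3) n3 by (intro exI[of _ vs] exI[of _ es]) auto
qed

end

section \<open>Degrees in paths and cycles\<close>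

lemma is_path_graph_degrees:
  assumes ll: "loopless D" and p: "is_path_graph D"
  shows "finite_loopless D" and "card (edges D) + 1 = card (vertices D)"
    and "\<And>u. u \<in> vertices D \<Longrightarrow> degree D u \<le> 2"
    and "\<exists>u\<in>vertices D. degree D u \<le> 1"
proof -
  obtain vs es where vs: "vs \<noteq> []" "distinct vs" "set vs = vertices D"
    and es: "distinct es" "set es = edges D" "length vs = length es + 1"
      "\<And>i. i < length es \<Longrightarrow> ends D (es ! i) = {vs ! i, vs ! (i + 1)}"
    using p unfolding is_path_graph_def by blast
  show "finite_loopless D" unfolding finite_loopless_def using ll by (simp flip: vs(3) es(2))
  show "card (edges D) + 1 = card (vertices D)"
    using vs es distinct_card by metis
  \<comment> \<open>Only the edges with index \<open>k - 1\<close> and \<open>k\<close> can meet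
    \<open>vs ! k\<close>. Index \<open>k\<close> may lie past the end of \<open>es\<close>, hence
    only an upper bound; for \<open>k = 0\<close> a single index is left.\<close>
  have inc: "degree D (vs ! k) \<le> card {j. j = k \<or> j + 1 = k \<and> k > 0}" if k: "k < length vs" for k
  proof -
    let ?I = "{j. j = k \<or> j + 1 = k \<and> k > 0}"
    have fin: "finite ?I" by (rule finite_subset[of _ "{..k}"]) auto
    have "{e \<in> edges D. vs ! k \<in> ends D e} \<subseteq> (\<lambda>j. es ! j) ` ?I"
    proof
      fix e assume "e \<in> {e \<in> edges D. vs ! k \<in> ends D e}"
      then have e: "e \<in> set es" "vs ! k \<in> ends D e" using es(2) by auto
      from e(1) obtain j where "j < length es" "es ! j = e" unfolding in_set_conv_nth by blast
      with e(2) es(4) have j: "j < length es" "e = es ! j" "vs ! k \<in> {vs ! j, vs ! (j + 1)}" by auto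
      then have "k = j \<or> k = j + 1" using k es(3) nth_eq_iff_index_eq[OF vs(2)] by auto
      then show "e \<in> (\<lambda>j. es ! j) ` ?I" using j(2) by auto
    qed
    then show ?thesis unfolding degree_def using fin by (meson card_image_le card_mono finite_imageI le_trans)
  qed
  show "degree D u \<le> 2" if "u \<in> vertices D" for u
  proof -
    from that obtain k where k: "k < length vs" "u = vs ! k" unfolding vs(3)[symmetric] in_set_conv_nth by blast
    have "card {j. j = k \<or> j + 1 = k \<and> k > 0} \<le> card {k, k - 1}"
      by (rule card_mono) auto
    also have "\<dots> \<le> 2" by (simp add: card_insert_if)
    finally show ?thesis using inc[OF k(1)] k(2) by simp
  qed
  have "vs ! 0 \<in> vertices D" using vs by (metis length_greater_0_conv nth_mem)
  moreover have "degree D (vs ! 0) \<le> 1" using inc[of 0] vs(1) by simp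
  ultimately show "\<exists>u\<in>vertices D. degree D u \<le> 1" by blast
qed

lemma is_cycle_graph_degrees:
  assumes ll: "loopless D" and c: "is_cycle_graph D"
  shows "finite_loopless D" and "\<And>u. u \<in> vertices D \<Longrightarrow> degree D u = 2"
    and "connected_on (vertices D) (edge_count D)"
proof -
  obtain vs es where vs: "2 \<le> length vs" "distinct vs" "set vs = vertices D"
    and es: "distinct es" "set es = edges D" "length vs = length es"
      "\<And>i. i < length es \<Longrightarrow> ends D (es ! i) = {vs ! i, vs ! ((i + 1) mod length vs)}"
    using c unfolding is_cycle_graph_def by blast
  let ?n = "length vs"
  show fl: "finite_loopless D" unfolding finite_loopless_def using ll by (simp flip: vs(3) es(2))
  have md: "(i + 1) mod ?n = (if i + 1 = ?n then 0 else i + 1)" if "i < ?n" for i using that by auto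
  have idx: "vs ! i = vs ! j \<longleftrightarrow> i = j" if "i < ?n" "j < ?n" for i j
    using vs(2) that by (rule nth_eq_iff_index_eq)
  show "degree D u = 2" if "u \<in> vertices D" for u
  proof -
    from that obtain k where k: "k < ?n" "u = vs ! k" unfolding vs(3)[symmetric] in_set_conv_nth by blast
    \<comment> \<open>The cyclic predecessor of \<open>k\<close>, the index of the other edge at
      \<open>vs ! k\<close>. It differs from \<open>k\<close> because the length is at least
      2.\<close>
    define k' where "k' = (if k = 0 then ?n - 1 else k - 1)"
    have k': "k' < ?n" "k' \<noteq> k" using k vs(1) unfolding k'_def by auto
    have inc: "u \<in> ends D (es ! j) \<longleftrightarrow> j \<in> {k, k'}" if j: "j < ?n" for j
    proof -
      have "(j + 1) mod ?n < ?n" by (rule mod_less_divisor) (use vs(1) in linarith)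
      then have "u \<in> ends D (es ! j) \<longleftrightarrow> k = j \<or> k = (j + 1) mod ?n"
        using es(3,4) j idx k by auto
      also have "k = (j + 1) mod ?n \<longleftrightarrow> j = k'" unfolding md[OF j] k'_def using j k(1) vs(1) by auto
      finally show ?thesis by auto
    qed
    have "{e \<in> edges D. u \<in> ends D e} = (\<lambda>j. es ! j) ` {k, k'}"
    proof (intro equalityI subsetI)
      fix e assume e: "e \<in> {e \<in> edges D. u \<in> ends D e}"
      then have "e \<in> set es" using es(2) by simp
      then obtain j where j: "j < ?n" "e = es ! j" unfolding in_set_conv_nth es(3)[symmetric] by blast
      then show "e \<in> (\<lambda>j. es ! j) ` {k, k'}" using inc[OF j(1)] e by blast
    next
      fix e assume "e \<in> (\<lambda>j. es ! j) ` {k, k'}"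
      then obtain j where j: "j \<in> {k, k'}" "e = es ! j" by blast
      then have "j < ?n" using k k' by auto
      then show "e \<in> {e \<in> edges D. u \<in> ends D e}" using inc[of j] j es(2,3) nth_mem[of j es] by auto
    qed
    moreover have "inj_on (\<lambda>j. es ! j) {k, k'}"
      using es(1,3) k k' by (auto simp: inj_on_def nth_eq_iff_index_eq)
    ultimately show ?thesis unfolding degree_def using k'(2) by (simp add: card_image)
  qed
  let ?A = "adj (vertices D) (edge_count D)"
  have step: "(vs ! i, vs ! Suc i) \<in> ?A" if "Suc i < ?n" for i
  proof -
    have "es ! i \<in> edges D" "ends D (es ! i) = {vs ! i, vs ! Suc i}"
      using that es(2,3) nth_mem[of i es] es(4)[of i] by auto
    then show ?thesis using edge_relation_eq_adj[OF fl] by blast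
  qed
  have from0: "(vs ! 0, vs ! i) \<in> ?A\<^sup>*" if "i < ?n" for i
    using that
  proof (induction i)
    case (Suc i)
    then show ?case using step[OF Suc.prems] by (meson Suc_lessD rtrancl.rtrancl_into_rtrancl)
  qed simp
  have "sym (?A\<^sup>*)" by (rule sym_rtrancl[OF sym_adj[OF multiplicity_fun_edge_count[OF ll]]])
  then have "(vs ! i, vs ! j) \<in> ?A\<^sup>*" if "i < ?n" "j < ?n" for i j
    using from0[OF that(1)] from0[OF that(2)] by (meson rtrancl_trans symD)
  then show "connected_on (vertices D) (edge_count D)"
    unfolding connected_on_def vs(3)[symmetric] by (metis in_set_conv_nth)
qed

section \<open>Components as equivalence classes\<close>

lemma connectedness_eq:
  assumes "finite_loopless H"
  shows "connectedness H = {(u, v). u \<in> vertices H \<and> v \<in> vertices H \<and> (u, v) \<in> (adj (vertices H) (edge_count H))\<^sup>*}"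
  unfolding connectedness_def edge_relation_eq_adj[OF assms] by simp

lemma equiv_connectedness:
  assumes H: "finite_loopless H"
  shows "equiv (vertices H) (connectedness H)"
proof (rule equivI)
  have "sym ((adj (vertices H) (edge_count H))\<^sup>*)"
    using H unfolding finite_loopless_def by (intro sym_rtrancl[OF sym_adj[OF multiplicity_fun_edge_count]]) auto
  then show "sym (connectedness H)" unfolding connectedness_eq[OF H] sym_def by blast
  show "trans (connectedness H)" unfolding connectedness_eq[OF H] trans_def by (auto intro: rtrancl_trans)
  show "refl_on (vertices H) (connectedness H)" unfolding connectedness_eq[OF H] refl_on_def by auto
  show "connectedness H \<subseteq> vertices H \<times> vertices H" unfolding connectedness_eq[OF H] by auto
qed

lemma class_mem:
  assumes "finite_loopless H" and "X \<in> vertices H // connectedness H" and "u \<in> X" "(u, v) \<in> connectedness H"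
  shows "v \<in> X"
  using assms(2-4) equiv_connectedness[OF assms(1)] by (auto simp: quotient_def equiv_def dest: transD)

lemma class_closed:
  assumes H: "finite_loopless H" and X: "X \<in> vertices H // connectedness H"
    and uv: "u \<in> X" "(u, v) \<in> adj (vertices H) (edge_count H)"
  shows "v \<in> X"
proof -
  have "(u, v) \<in> connectedness H" using uv(2) unfolding connectedness_eq[OF H] by (auto simp: adj_def)
  then show ?thesis by (rule class_mem[OF H X uv(1)])
qed

text \<open>Every edge meeting a class lies entirely inside it, so the induced subgraph inherits
  degrees and connecting walks.\<close>

lemma induced_class:
  assumes H: "finite_loopless H" and X: "X \<in> vertices H // connectedness H"
  defines "D \<equiv> induced_subgraph H X"
  shows "X \<subseteq> vertices H" and "vertices D = X" and "finite_loopless D"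
    and "\<And>u. u \<in> X \<Longrightarrow> degree D u = degree H u"
    and "connected_on X (edge_count D)" and "X \<noteq> {}"
proof -
  show XV: "X \<subseteq> vertices H" using X equiv_connectedness[OF H] by (metis Union_quotient Union_upper)
  then show vD: "vertices D = X" unfolding D_def induced_subgraph_def by auto
  have eD: "edges D = {e \<in> edges H. ends H e \<subseteq> X}" and endsD: "ends D = ends H"
    unfolding D_def induced_subgraph_def by auto
  show fl: "finite_loopless D"
    using H XV unfolding finite_loopless_def loopless_def vD eD endsD by (auto intro: finite_subset)
  show "X \<noteq> {}" using X equiv_connectedness[OF H] in_quotient_imp_non_empty by blast
  have cl: "ends H e \<subseteq> X" if u: "u \<in> X" "e \<in> edges H" "u \<in> ends H e" for e u
  proof -
    obtain x y where xy: "ends H e = {x, y}" using loopless_ends[of H e] u H unfolding finite_loopless_def by metis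
    then have "(x, y) \<in> adj (vertices H) (edge_count H)" "(y, x) \<in> adj (vertices H) (edge_count H)"
      using edge_relation_eq_adj[OF H] u(2) by (auto simp: insert_commute)
    with class_closed[OF H X] u(1) have "u = x \<Longrightarrow> y \<in> X" "u = y \<Longrightarrow> x \<in> X" by blast+
    then show ?thesis using u xy by auto
  qed
  show "degree D u = degree H u" if "u \<in> X" for u
  proof -
    have "{e \<in> edges D. u \<in> ends D e} = {e \<in> edges H. u \<in> ends H e}" unfolding eD endsD using cl[OF that] by blast
    then show ?thesis unfolding degree_def by simp
  qed
  have sub: "(u, v) \<in> adj X (edge_count D)" if u: "u \<in> X" and uv: "(u, v) \<in> adj (vertices H) (edge_count H)" for u v
  proof -
    obtain e where e: "e \<in> edges H" "ends H e = {u, v}" using uv edge_relation_eq_adj[OF H] by blast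
    then have "e \<in> edges D" "ends D e = {u, v}" using cl[OF u e(1)] unfolding eD endsD by auto
    then show ?thesis using edge_relation_eq_adj[OF fl] vD by blast
  qed
  show "connected_on X (edge_count D)" unfolding connected_on_def
  proof (intro ballI)
    fix u v assume uv: "u \<in> X" "v \<in> X"
    then have "(u, v) \<in> connectedness H" using quotient_eq_iff[OF equiv_connectedness[OF H] X X] by simp
    then have "(u, v) \<in> (adj (vertices H) (edge_count H))\<^sup>*" unfolding connectedness_eq[OF H] by simp
    then have "(u, v) \<in> (adj X (edge_count D))\<^sup>* \<and> v \<in> X"
    proof (induction rule: rtrancl_induct)
      case base then show ?case using uv by simp
    next
      case (step y z)
      then show ?case using sub class_closed[OF H X] by (meson rtrancl.rtrancl_into_rtrancl)
    qed
    then show "(u, v) \<in> (adj X (edge_count D))\<^sup>*" by blast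
  qed
qed

text \<open>Maximum degree two leaves only paths and cycles; \<open>low\<close> puts into every
  component a vertex of degree at most 1, which no cycle has.\<close>

lemma components_are_paths:
  assumes H: "finite_loopless H" and deg: "\<And>u. u \<in> vertices H \<Longrightarrow> degree H u \<le> 2"
    and low: "\<And>u. u \<in> vertices H \<Longrightarrow> \<exists>v. (u, v) \<in> connectedness H \<and> degree H v \<le> 1"
    and D: "D \<in> components_of H"
  shows "is_path_graph D"
proof -
  obtain X where X: "X \<in> vertices H // connectedness H" "D = induced_subgraph H X"
    using D unfolding components_of_def by blast
  note IC = induced_class[OF H X(1), folded X(2)]
  interpret connected_degree_two D
    using IC deg by unfold_locales auto
  obtain u where u: "u \<in> X" using IC(6) by blast
  then obtain v where v: "(u, v) \<in> connectedness H" "degree H v \<le> 1" using low IC(1) by blast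
  have "v \<in> X" by (rule class_mem[OF H X(1) u v(1)])
  then show ?thesis using is_path_graph[of v] IC(2,4) v(2) by simp
qed

text \<open>A path on n vertices has n - 1 edges and degree sum 2n - 2. Each component thus falls
  short of two per vertex by exactly 2, and this yields the number of edges that a color must send
  to the new vertices.\<close>

lemma path_components_degrees:
  assumes H: "finite_loopless H" and paths: "\<And>D. D \<in> components_of H \<Longrightarrow> is_path_graph D"
  shows "\<And>u. u \<in> vertices H \<Longrightarrow> degree H u \<le> 2"
    and "\<And>u. u \<in> vertices H \<Longrightarrow> \<exists>v. (u, v) \<in> connectedness H \<and> degree H v \<le> 1"
    and "(\<Sum>u\<in>vertices H. degree H u) + 2 * num_components H = 2 * card (vertices H)"
proof -
  let ?Q = "vertices H // connectedness H"
  note eq = equiv_connectedness[OF H]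
  have fin: "finite (vertices H)" using H unfolding finite_loopless_def by simp
  have path: "is_path_graph (induced_subgraph H X)" if "X \<in> ?Q" for X
    using paths that unfolding components_of_def by blast
  have ll: "loopless (induced_subgraph H X)" if "X \<in> ?Q" for X
    using induced_class(3)[OF H that] unfolding finite_loopless_def by simp
  have cls: "\<exists>X\<in>?Q. u \<in> X" if "u \<in> vertices H" for u
    using that Union_quotient[OF eq] by blast
  show "degree H u \<le> 2" if "u \<in> vertices H" for u
  proof -
    from cls[OF that] obtain X where X: "X \<in> ?Q" "u \<in> X" by blast
    show ?thesis using is_path_graph_degrees(3)[OF ll[OF X(1)] path[OF X(1)], of u] induced_class(2,4)[OF H X(1)] X(2) by simp
  qed
  show "\<exists>v. (u, v) \<in> connectedness H \<and> degree H v \<le> 1" if "u \<in> vertices H" for u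
  proof -
    from cls[OF that] obtain X where X: "X \<in> ?Q" "u \<in> X" by blast
    obtain v where v: "v \<in> X" "degree H v \<le> 1"
      using is_path_graph_degrees(4)[OF ll[OF X(1)] path[OF X(1)]] induced_class(2,4)[OF H X(1)] by auto
    then have "(u, v) \<in> connectedness H" using quotient_eq_iff[OF eq X(1) X(1) X(2)] by simp
    then show ?thesis using v by blast
  qed
  have finQ: "finite ?Q" using fin by (rule finite_quotient) (use eq in \<open>auto simp: equiv_def refl_on_def connectedness_eq[OF H]\<close>)
  have V: "vertices H = \<Union> ?Q" using Union_quotient[OF eq] by simp
  have part: "(\<Sum>u\<in>vertices H. f u) = (\<Sum>X\<in>?Q. \<Sum>u\<in>X. f u)" for f :: "'a \<Rightarrow> nat"
  proof -
    have "(\<Sum>u\<in>\<Union> ?Q. f u) = (\<Sum>X\<in>?Q. \<Sum>u\<in>X. f u)"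
    proof (subst sum.Union_disjoint)
      show "\<forall>X\<in>?Q. finite X" using induced_class(1)[OF H] fin finite_subset by blast
      show "\<forall>X\<in>?Q. \<forall>Y\<in>?Q. X \<noteq> Y \<longrightarrow> X \<inter> Y = {}" using quotient_disj[OF eq] by blast
    qed simp
    then show ?thesis using V by simp
  qed
  have one: "(\<Sum>u\<in>X. degree H u) + 2 = 2 * card X" if X: "X \<in> ?Q" for X
  proof -
    let ?D = "induced_subgraph H X"
    have "(\<Sum>u\<in>X. degree H u) = (\<Sum>u\<in>vertices ?D. degree ?D u)"
      using induced_class(2,4)[OF H X] by simp
    also have "\<dots> = 2 * card (edges ?D)" by (rule handshake[OF induced_class(3)[OF H X]])
    finally show ?thesis
      using is_path_graph_degrees(2)[OF ll[OF X] path[OF X]] induced_class(2)[OF H X] by simp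
  qed
  \<comment> \<open>\<open>num_components\<close> counts subgraphs instead of classes; the vertex
    set of a component recovers its class.\<close>
  have "inj_on (induced_subgraph H) ?Q"
    by (rule inj_onI) (metis induced_class(2)[OF H])
  then have num: "num_components H = card ?Q" unfolding num_components_def components_of_def by (rule card_image)
  have "(\<Sum>u\<in>vertices H. degree H u) + 2 * num_components H = (\<Sum>X\<in>?Q. (\<Sum>u\<in>X. degree H u) + 2)"
    unfolding part num sum.distrib by simp
  also have "\<dots> = (\<Sum>X\<in>?Q. 2 * card X)" by (rule sum.cong) (use one in auto)
  also have "\<dots> = 2 * (\<Sum>u\<in>vertices H. 1)" unfolding part by (simp add: sum_distrib_left)
  finally show "(\<Sum>u\<in>vertices H. degree H u) + 2 * num_components H = 2 * card (vertices H)" by simp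
qed

section \<open>Embedding path colorings of \<open>K\<close>\<close>

definition multiplicity_K_fun :: "nat \<Rightarrow> nat \<Rightarrow> nat \<times> nat \<Rightarrow> nat \<times> nat \<Rightarrow> nat" where
  "multiplicity_K_fun lam mu u v = (if u = v then 0 else if fst u = fst v then lam else mu)"

lemma color_class_simps [simp]:
  "vertices (color_class G c j) = vertices G"
  "edges (color_class G c j) = {e \<in> edges G. c e = j}"
  "ends (color_class G c j) = ends G"
  unfolding color_class_def by simp_all

lemma K_simps [simp]:
  "vertices (K a q lam mu) = {..<q} \<times> {..<a}"
  "ends (K a q lam mu) = fst"
  unfolding K_def by simp_all

lemma finite_loopless_K: "finite_loopless (K a q lam mu)"
proof -
  have "edges (K a q lam mu) \<subseteq> (\<lambda>(u, v, n). ({u, v}, n)) `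
      (({..<q} \<times> {..<a}) \<times> ({..<q} \<times> {..<a}) \<times> {..<max lam mu})"
  proof
    fix e assume "e \<in> edges (K a q lam mu)"
    then obtain u v n where e: "e = ({u, v}, n)" "u \<in> {..<q} \<times> {..<a}" "v \<in> {..<q} \<times> {..<a}"
      "n < (if fst u = fst v then lam else mu)" unfolding edges_K by blast
    then have "n < max lam mu" by (simp split: if_splits)
    with e show "e \<in> (\<lambda>(u, v, n). ({u, v}, n)) ` (({..<q} \<times> {..<a}) \<times> ({..<q} \<times> {..<a}) \<times> {..<max lam mu})"
      by (intro image_eqI[of _ _ "(u, v, n)"]) auto
  qed
  then have "finite (edges (K a q lam mu))" by (rule finite_subset) auto
  then show ?thesis unfolding finite_loopless_def using loopless_K by auto
qed

lemma finite_loopless_color_class: "finite_loopless G \<Longrightarrow> finite_loopless (color_class G c j)"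
  unfolding finite_loopless_def loopless_def by auto

lemma edges_K_subset:
  "edges (K a p lam mu) = {e \<in> edges (K a (p + r) lam mu). fst e \<subseteq> {..<p} \<times> {..<a}}"
  using arg_cong[OF K_induced_subgraph[of a p lam mu r], of edges] by (simp add: induced_subgraph_def)

lemma sum_edge_count_color_classes:
  assumes "edge_coloring (K a q lam mu) k c" "u \<in> {..<q} \<times> {..<a}" "v \<in> {..<q} \<times> {..<a}"
  shows "(\<Sum>j\<in>{1..k}. edge_count (color_class (K a q lam mu) c j) u v) = multiplicity_K_fun lam mu u v"
proof (cases "u = v")
  case True
  have "edge_count (color_class (K a q lam mu) c j) u u = 0" for j
    using finite_loopless_color_class[OF finite_loopless_K] unfolding finite_loopless_def by (blast intro: edge_count_self)
  then show ?thesis using True unfolding multiplicity_K_fun_def by simp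
next
  case False
  let ?G = "K a q lam mu"
  have fin: "finite (edges ?G)" using finite_loopless_K unfolding finite_loopless_def by blast
  have "{e \<in> edges ?G. ends ?G e = {u, v}} = (\<Union>j\<in>{1..k}. {e \<in> edges (color_class ?G c j). ends (color_class ?G c j) e = {u, v}})"
    using assms(1) unfolding edge_coloring_def by auto
  then have "card {e \<in> edges ?G. ends ?G e = {u, v}} =
      card (\<Union>j\<in>{1..k}. {e \<in> edges (color_class ?G c j). ends (color_class ?G c j) e = {u, v}})" by (rule arg_cong)
  also have "\<dots> = (\<Sum>j\<in>{1..k}. edge_count (color_class ?G c j) u v)"
    unfolding edge_count_def by (rule card_UN_disjoint) (use fin in auto)
  finally show ?thesis using multiplicity_K[of u a q lam mu v] assms(2,3) False unfolding multiplicity_K_fun_def by simp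
qed

lemma sum_multiplicity_K_fun:
  assumes "u \<in> {..<q} \<times> {..<a}"
  shows "(\<Sum>v\<in>{..<q} \<times> {..<a}. multiplicity_K_fun lam mu u v) = lam * (a - 1) + mu * a * (q - 1)"
proof -
  obtain i x where u: "u = (i, x)" "i < q" "x < a" using assms by auto
  have part: "(\<Sum>y<a. multiplicity_K_fun lam mu u (i', y)) = (if i' = i then lam * (a - 1) else mu * a)" for i'
  proof (cases "i' = i")
    case True
    have "(\<Sum>y<a. multiplicity_K_fun lam mu u (i', y)) = (\<Sum>y\<in>{..<a} - {x}. lam)"
      using True u by (intro sum.mono_neutral_cong_right) (auto simp: multiplicity_K_fun_def)
    then show ?thesis using True u by (simp add: mult.commute)
  next
    case False
    have "(\<Sum>y<a. multiplicity_K_fun lam mu u (i', y)) = (\<Sum>y<a. mu)"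
      by (rule sum.cong) (use False u in \<open>auto simp: multiplicity_K_fun_def\<close>)
    then show ?thesis using False by (simp add: mult.commute)
  qed
  have "(\<Sum>v\<in>{..<q} \<times> {..<a}. multiplicity_K_fun lam mu u v) = (\<Sum>i'<q. \<Sum>y<a. multiplicity_K_fun lam mu u (i', y))"
    by (simp add: sum.cartesian_product)
  also have "\<dots> = (\<Sum>i'<q. if i' = i then lam * (a - 1) else mu * a)" unfolding part ..
  also have "\<dots> = lam * (a - 1) + (\<Sum>i'\<in>{..<q} - {i}. mu * a)"
    using u(2) by (subst sum.remove[of _ i]) auto
  also have "\<dots> = lam * (a - 1) + mu * a * (q - 1)" using u(2) by (simp add: mult.commute)
  finally show ?thesis .
qed

text \<open>Cuts \<open>{..<N}\<close> into consecutive intervals of lengths \<open>f j\<close>. It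
  serves to color parallel edges, which are numbered, with prescribed color frequencies.\<close>

lemma ex_function_with_fibre_cards:
  assumes "finite J" "(\<Sum>j\<in>J. f j) = N"
  shows "\<exists>\<phi>. (\<forall>n<N. \<phi> n \<in> J) \<and> (\<forall>j\<in>J. card {n. n < N \<and> \<phi> n = j} = f j)"
  using assms
proof (induction J arbitrary: N)
  case (insert x J)
  from insert.IH[OF refl] obtain \<phi> where \<phi>: "\<forall>n<sum f J. \<phi> n \<in> J" "\<forall>j\<in>J. card {n. n < sum f J \<and> \<phi> n = j} = f j" by blast
  define \<psi> where "\<psi> n = (if n < sum f J then \<phi> n else x)" for n
  have N: "N = f x + sum f J" using insert by simp
  have "card {n. n < N \<and> \<psi> n = j} = f j" if "j \<in> insert x J" for j
  proof (cases "j = x")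
    case True
    have iff: "\<psi> n = x \<longleftrightarrow> sum f J \<le> n" for n
    proof (cases "n < sum f J")
      case True
      then have "\<phi> n \<noteq> x" using \<phi>(1) insert.hyps(2) by blast
      then show ?thesis using True unfolding \<psi>_def by simp
    qed (simp add: \<psi>_def)
    have "{n. n < N \<and> \<psi> n = j} = {sum f J..<N}"
      unfolding True iff by (rule set_eqI) (simp only: mem_Collect_eq atLeastLessThan_iff conj_commute)
    then show ?thesis using N True by simp
  next
    case False
    have "{n. n < N \<and> \<psi> n = j} = {n. n < sum f J \<and> \<phi> n = j}"
      unfolding \<psi>_def using False N by auto
    then show ?thesis using \<phi>(2) that False by simp
  qed
  moreover have "\<forall>n<N. \<psi> n \<in> insert x J" unfolding \<psi>_def using \<phi>(1) by simp
  ultimately show ?case by blast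
qed simp

text \<open>New parallel edges are interchangeable, so an extension of the coloring is determined
  well enough by how often each color joins each pair. Connectedness and degree 2 on at least three
  vertices then make every color class a Hamiltonian cycle.\<close>

lemma embeds_if_multiplicities:
  fixes a p r :: nat and w :: "nat \<Rightarrow> nat \<times> nat \<Rightarrow> nat \<times> nat \<Rightarrow> nat"
  defines "V \<equiv> {..<p + r} \<times> {..<a}"
  assumes size: "3 \<le> a * (p + r)"
    and coloring: "edge_coloring (K a p lam mu) k c"
    and conn: "\<And>j. j \<in> {1..k} \<Longrightarrow> connected_even V (w j)"
    and deg: "\<And>j u. j \<in> {1..k} \<Longrightarrow> u \<in> V \<Longrightarrow> (\<Sum>v\<in>V. w j u v) = 2"
    and tot: "\<And>u v. u \<in> V \<Longrightarrow> v \<in> V \<Longrightarrow> (\<Sum>j\<in>{1..k}. w j u v) = multiplicity_K_fun lam mu u v"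
    and old: "\<And>j u v. j \<in> {1..k} \<Longrightarrow> u \<in> {..<p} \<times> {..<a} \<Longrightarrow> v \<in> {..<p} \<times> {..<a} \<Longrightarrow>
      w j u v = edge_count (color_class (K a p lam mu) c j) u v"
  shows "embeds_into_ham_decomposition (K a p lam mu) k c (K a (p + r) lam mu)"
proof -
  let ?G = "K a p lam mu" and ?G' = "K a (p + r) lam mu" and ?U = "{..<p} \<times> {..<a}"
  note edges0 = edges_K_subset[of a p lam mu r]
  \<comment> \<open>Stated for the unordered pair \<open>s\<close>, since edges are identified by
    end set and number; symmetry of \<open>w j\<close> makes the two orderings of a pair agree. For
    other sets \<open>s\<close> it holds trivially.\<close>
  define good where "good s \<phi> \<longleftrightarrow> (\<forall>u v. s = {u, v} \<longrightarrow> u \<in> V \<longrightarrow> v \<in> V \<longrightarrow> u \<noteq> v \<longrightarrow>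
      (\<forall>n<multiplicity_K_fun lam mu u v. \<phi> n \<in> {1..k}) \<and>
      (\<forall>j\<in>{1..k}. card {n. n < multiplicity_K_fun lam mu u v \<and> \<phi> n = j} = w j u v))"
    for s :: "(nat \<times> nat) set" and \<phi> :: "nat \<Rightarrow> nat"
  have ex_good: "\<exists>\<phi>. good s \<phi>" for s
  proof (cases "\<exists>u v. s = {u, v} \<and> u \<in> V \<and> v \<in> V \<and> u \<noteq> v")
    case True
    then obtain u v where uv: "s = {u, v}" "u \<in> V" "v \<in> V" "u \<noteq> v" by blast
    from ex_function_with_fibre_cards[OF finite_atLeastAtMost tot[OF uv(2,3)]]
    obtain \<phi> where \<phi>: "\<forall>n<multiplicity_K_fun lam mu u v. \<phi> n \<in> {1..k}"
      "\<forall>j\<in>{1..k}. card {n. n < multiplicity_K_fun lam mu u v \<and> \<phi> n = j} = w j u v" by blast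
    have com: "multiplicity_K_fun lam mu v u = multiplicity_K_fun lam mu u v" unfolding multiplicity_K_fun_def by auto
    have "w j v u = w j u v" if "j \<in> {1..k}" for j
      using conn[OF that] uv unfolding connected_even_def multiplicity_fun_def by blast
    then have "good s \<phi>" unfolding good_def uv(1) doubleton_eq_iff using \<phi> com by auto
    then show ?thesis by blast
  next
    case False
    then show ?thesis unfolding good_def by blast
  qed
  define \<phi> where "\<phi> s = (SOME \<phi>. good s \<phi>)" for s
  have good: "good s (\<phi> s)" for s unfolding \<phi>_def by (rule someI_ex[OF ex_good])
  have goodD: "(\<forall>n<multiplicity_K_fun lam mu u v. \<phi> {u, v} n \<in> {1..k}) \<and>
      (\<forall>j\<in>{1..k}. card {n. n < multiplicity_K_fun lam mu u v \<and> \<phi> {u, v} n = j} = w j u v)"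
    if "u \<in> V" "v \<in> V" "u \<noteq> v" for u v
    using good[of "{u, v}"] that unfolding good_def by blast
  define c' where "c' e = (if fst e \<subseteq> ?U then c e else \<phi> (fst e) (snd e))" for e
  have col': "edge_coloring ?G' k c'" unfolding edge_coloring_def
  proof
    fix e assume e: "e \<in> edges ?G'"
    show "c' e \<in> {1..k}"
    proof (cases "fst e \<subseteq> ?U")
      case True
      then have "e \<in> edges ?G" using e edges0 by simp
      then show ?thesis using coloring True unfolding edge_coloring_def c'_def by simp
    next
      case False
      obtain u v n where uv: "e = ({u, v}, n)" "u \<in> V" "v \<in> V" "u \<noteq> v" "n < (if fst u = fst v then lam else mu)"
        using e unfolding edges_K V_def by blast
      then have "n < multiplicity_K_fun lam mu u v" unfolding multiplicity_K_fun_def by simp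
      then have "\<phi> (fst e) (snd e) \<in> {1..k}" using goodD[OF uv(2-4)] uv(1) by simp
      then show ?thesis using False unfolding c'_def by simp
    qed
  qed
  have cnt: "edge_count (color_class ?G' c' j) u v = w j u v" if j: "j \<in> {1..k}" and u: "u \<in> V" and v: "v \<in> V" for j u v
  proof (cases "u = v")
    case True
    have "(\<Sum>j\<in>{1..k}. w j u v) = 0" using tot[OF u v] True unfolding multiplicity_K_fun_def by simp
    then have "w j u v = 0" using j by simp
    moreover have "edge_count (color_class ?G' c' j) u u = 0"
      using finite_loopless_color_class[OF finite_loopless_K] unfolding finite_loopless_def by (blast intro: edge_count_self)
    ultimately show ?thesis using True by simp
  next
    case ne: False
    show ?thesis
    proof (cases "{u, v} \<subseteq> ?U")
      case True
      have "{e \<in> edges (color_class ?G' c' j). ends (color_class ?G' c' j) e = {u, v}} =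
        {e \<in> edges (color_class ?G c j). ends (color_class ?G c j) e = {u, v}}"
        using True edges0 unfolding c'_def by auto
      then show ?thesis using old[OF j, of u v] True unfolding edge_count_def by simp
    next
      case False
      have "{e \<in> edges (color_class ?G' c' j). ends (color_class ?G' c' j) e = {u, v}} =
        Pair {u, v} ` {n. n < multiplicity_K_fun lam mu u v \<and> \<phi> {u, v} n = j}"
      proof (intro equalityI subsetI)
        fix e assume "e \<in> {e \<in> edges (color_class ?G' c' j). ends (color_class ?G' c' j) e = {u, v}}"
        then have e: "e \<in> edges ?G'" "c' e = j" "fst e = {u, v}" by auto
        then obtain x y n where xy: "e = ({x, y}, n)" "n < (if fst x = fst y then lam else mu)" unfolding edges_K by blast
        then have "{x, y} = {u, v}" using e by simp
        then have "n < multiplicity_K_fun lam mu u v" using xy ne unfolding multiplicity_K_fun_def doubleton_eq_iff by auto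
        moreover have en: "e = ({u, v}, n)" using xy e(3) by simp
        moreover have "\<phi> {u, v} n = j" using e(2) False unfolding c'_def en fst_conv snd_conv by (simp only: if_False)
        ultimately show "e \<in> Pair {u, v} ` {n. n < multiplicity_K_fun lam mu u v \<and> \<phi> {u, v} n = j}" by blast
      next
        fix e assume "e \<in> Pair {u, v} ` {n. n < multiplicity_K_fun lam mu u v \<and> \<phi> {u, v} n = j}"
        then obtain n where n: "e = ({u, v}, n)" "n < multiplicity_K_fun lam mu u v" "\<phi> {u, v} n = j" by blast
        have "n < (if fst u = fst v then lam else mu)" using n(2) ne unfolding multiplicity_K_fun_def by simp
        then have "e \<in> edges ?G'" unfolding edges_K using n(1) u v ne unfolding V_def by blast
        moreover have "c' e = j" unfolding c'_def n(1) fst_conv snd_conv using False n(3) by (simp only: if_False)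
        ultimately show "e \<in> {e \<in> edges (color_class ?G' c' j). ends (color_class ?G' c' j) e = {u, v}}"
          using n(1) by simp
      qed
      moreover have "card (Pair {u, v} ` {n. n < multiplicity_K_fun lam mu u v \<and> \<phi> {u, v} n = j}) =
          card {n. n < multiplicity_K_fun lam mu u v \<and> \<phi> {u, v} n = j}"
        by (rule card_image) (simp add: inj_on_def)
      ultimately show ?thesis using goodD[OF u v ne] j unfolding edge_count_def by simp
    qed
  qed
  have "is_cycle_graph (color_class ?G' c' j)" if j: "j \<in> {1..k}" for j
  proof -
    let ?H = "color_class ?G' c' j"
    have fl: "finite_loopless ?H" by (rule finite_loopless_color_class[OF finite_loopless_K])
    have vH: "vertices ?H = V" unfolding V_def by simp
    have deg2: "degree ?H u = 2" if "u \<in> V" for u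
      using degree_eq_sum_edge_count[OF fl, of u] cnt[OF j that] deg[OF j that] that unfolding vH by simp
    have "adj V (edge_count ?H) = adj V (w j)" unfolding adj_def using cnt[OF j] by auto
    then have "connected_on V (edge_count ?H)" using conn[OF j] unfolding connected_even_def connected_on_def by simp
    moreover have cV: "card V = a * (p + r)" unfolding V_def by (simp add: card_cartesian_product)
    moreover have "V \<noteq> {}" using cV size by auto
    ultimately interpret connected_degree_two ?H
      using fl deg2 vH by unfold_locales auto
    show ?thesis using is_cycle_graph deg2 cV size unfolding vH by simp
  qed
  moreover have "\<forall>e\<in>edges ?G. c' e = c e" using edges0 unfolding c'_def by simp
  ultimately show ?thesis unfolding embeds_into_ham_decomposition_def using col' by blast
qed

section \<open>Necessity of the conditions\<close>

lemma connected_on_cut: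
  assumes "connected_on V w" "S \<subseteq> V" "S \<noteq> {}" "S \<noteq> V"
  shows "\<exists>u\<in>S. \<exists>v\<in>V - S. w u v > 0"
proof (rule ccontr)
  assume neg: "\<not> ?thesis"
  obtain u v where uv: "u \<in> S" "v \<in> V - S" using assms by blast
  then have "(u, v) \<in> (adj V w)\<^sup>*" using assms unfolding connected_on_def by blast
  then have "v \<in> S"
  proof (induction rule: rtrancl_induct)
    case (step y z)
    then have "z \<in> V" "w y z > 0" unfolding adj_def by auto
    then show ?case using neg step.IH by blast
  qed (rule uv)
  then show False using uv by blast
qed

text \<open>The first claim counts degrees at one vertex. For the second, a Hamiltonian cycle has at
  most \<open>a - 1\<close> edges inside a part. For the third, the cycle must leave each component
  of \<open>G(j)\<close>, and it can do so only towards a new vertex. For the fourth,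
  \<open>2 * \<omega>\<^sub>j\<close> edges of color j lead to the \<open>a * r\<close> new
  vertices, each of which takes at most two.\<close>

lemma embedding_necessary:
  assumes a: "a > 1" and p: "p \<ge> 1" and r: "r \<ge> 1"
    and emb: "embeds_into_ham_decomposition (K a p lam mu) k c (K a (p + r) lam mu)"
  shows "2 * k = lam * (a - 1) + mu * a * (p + r - 1)"
    and "lam \<le> mu * a * (p + r - 1)"
    and "\<And>j D. j \<in> {1..k} \<Longrightarrow> D \<in> components_of (color_class (K a p lam mu) c j) \<Longrightarrow> is_path_graph D"
    and "\<And>j. j \<in> {1..k} \<Longrightarrow> num_components (color_class (K a p lam mu) c j) \<le> a * r"
proof -
  let ?G = "K a p lam mu" and ?G' = "K a (p + r) lam mu"
  let ?U = "{..<p} \<times> {..<a}" and ?V = "{..<p + r} \<times> {..<a}"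
  note edges0 = edges_K_subset[of a p lam mu r]
  obtain c' where col': "edge_coloring ?G' k c'" and ext: "\<And>e. e \<in> edges ?G \<Longrightarrow> c' e = c e"
    and cyc: "\<And>j. j \<in> {1..k} \<Longrightarrow> is_cycle_graph (color_class ?G' c' j)"
    using emb unfolding embeds_into_ham_decomposition_def by blast
  let ?H = "\<lambda>j. color_class ?G c j" and ?H' = "\<lambda>j. color_class ?G' c' j"
  have fl: "finite_loopless (?H j)" "finite_loopless (?H' j)" for j
    by (rule finite_loopless_color_class[OF finite_loopless_K])+
  have ll: "loopless (?H' j)" for j using fl unfolding finite_loopless_def by blast
  define w where "w j u v = edge_count (?H' j) u v" for j u v
  have deg': "degree (?H' j) u = 2" if "j \<in> {1..k}" "u \<in> ?V" for j u
    using is_cycle_graph_degrees(2)[OF ll cyc[OF that(1)], of u] that(2) by simp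
  have deg: "(\<Sum>v\<in>?V. w j u v) = 2" if "j \<in> {1..k}" "u \<in> ?V" for j u
    using deg'[OF that] degree_eq_sum_edge_count[OF fl(2), of u j] that(2) unfolding w_def by simp
  have conn: "connected_on ?V (w j)" if "j \<in> {1..k}" for j
    using is_cycle_graph_degrees(3)[OF ll cyc[OF that]] unfolding w_def by simp
  have tot: "(\<Sum>j\<in>{1..k}. w j u v) = multiplicity_K_fun lam mu u v" if "u \<in> ?V" "v \<in> ?V" for u v
    unfolding w_def by (rule sum_edge_count_color_classes[OF col' that])
  have mf: "multiplicity_fun X (w j)" for X j
    using multiplicity_fun_edge_count[OF ll] unfolding w_def[abs_def] .
  have eH: "edges (?H j) = {e \<in> edges (?H' j). fst e \<subseteq> ?U}" for j
    using edges0 ext by auto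
  have fin': "finite (edges (?H' j))" for j using fl unfolding finite_loopless_def by blast
  have ec: "edge_count (?H j) u v = w j u v" if "u \<in> ?U" "v \<in> ?U" for j u v
  proof -
    have "{e \<in> edges (?H j). ends (?H j) e = {u, v}} = {e \<in> edges (?H' j). ends (?H' j) e = {u, v}}"
      unfolding eH using that by auto
    then show ?thesis unfolding w_def edge_count_def by simp
  qed
  have V0V: "?U \<subseteq> ?V" by auto
  have finV: "finite ?V" by simp
  have dH: "degree (?H j) u + (\<Sum>v\<in>?V - ?U. w j u v) = 2" if "j \<in> {1..k}" "u \<in> ?U" for j u
  proof -
    have uV: "u \<in> ?V" using that(2) V0V by blast
    have "degree (?H j) u = (\<Sum>v\<in>?U. w j u v)"
      using degree_eq_sum_edge_count[OF fl(1), of u j] that(2) ec by simp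
    then have "degree (?H j) u + (\<Sum>v\<in>?V - ?U. w j u v) = (\<Sum>v\<in>?V. w j u v)"
      using sum.subset_diff[OF V0V finV, of "w j u"] by simp
    then show ?thesis unfolding deg[OF that(1) uV] .
  qed
  have zero: "(0, 0) \<in> ?V" using a p by auto
  show k2: "2 * k = lam * (a - 1) + mu * a * (p + r - 1)"
  proof -
    have "2 * k = (\<Sum>j\<in>{1..k}. \<Sum>v\<in>?V. w j (0, 0) v)" using deg[OF _ zero] by simp
    also have "\<dots> = (\<Sum>v\<in>?V. \<Sum>j\<in>{1..k}. w j (0, 0) v)" by (rule sum.swap)
    also have "\<dots> = (\<Sum>v\<in>?V. multiplicity_K_fun lam mu (0, 0) v)"
      by (rule sum.cong[OF refl], rule tot[OF zero])
    also have "\<dots> = lam * (a - 1) + mu * a * (p + r - 1)" by (rule sum_multiplicity_K_fun[OF zero])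
    finally show ?thesis .
  qed
  show "lam \<le> mu * a * (p + r - 1)"
  proof -
    let ?P = "{0::nat} \<times> {..<a}"
    have PV: "?P \<subseteq> ?V" using p by auto
    have "(1, 0) \<in> ?V" "(1, 0) \<notin> ?P" using p r a by auto
    then have PnV: "?P \<noteq> ?V" by blast
    have Pne: "?P \<noteq> {}" using a by auto
    have cP: "card ?P = a" by (simp add: card_cartesian_product)
    \<comment> \<open>As the cycle leaves the part, fewer than \<open>2 * a\<close> half-edges stay
      inside; their number is even, hence at most \<open>2 * a - 2\<close>.\<close>
    have inner: "(\<Sum>u\<in>?P. \<Sum>v\<in>?P. w j u v) \<le> 2 * (a - 1)" if j: "j \<in> {1..k}" for j
    proof -
      from connected_on_cut[OF conn[OF j] PV Pne PnV] obtain u v where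
        uv: "u \<in> ?P" "v \<in> ?V - ?P" "w j u v > 0" by blast
      have "2 * a = (\<Sum>u\<in>?P. \<Sum>v\<in>?V. w j u v)"
      proof -
        have "(\<Sum>u\<in>?P. \<Sum>v\<in>?V. w j u v) = (\<Sum>u\<in>?P. 2)"
          by (rule sum.cong[OF refl], rule deg[OF j]) (use PV in blast)
        then show ?thesis using cP by simp
      qed
      also have "\<dots> = (\<Sum>u\<in>?P. (\<Sum>v\<in>?V - ?P. w j u v) + (\<Sum>v\<in>?P. w j u v))"
        by (rule sum.cong[OF refl]) (rule sum.subset_diff[OF PV finV])
      also have "\<dots> = (\<Sum>u\<in>?P. \<Sum>v\<in>?V - ?P. w j u v) + (\<Sum>u\<in>?P. \<Sum>v\<in>?P. w j u v)"
        by (rule sum.distrib)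
      finally have eq: "2 * a = (\<Sum>u\<in>?P. \<Sum>v\<in>?V - ?P. w j u v) + (\<Sum>u\<in>?P. \<Sum>v\<in>?P. w j u v)" .
      have "w j u v \<le> (\<Sum>v\<in>?V - ?P. w j u v)" by (rule member_le_sum) (use uv in auto)
      also have "\<dots> \<le> (\<Sum>u\<in>?P. \<Sum>v\<in>?V - ?P. w j u v)"
        by (rule member_le_sum[of u]) (use uv in auto)
      finally have "(\<Sum>u\<in>?P. \<Sum>v\<in>?P. w j u v) < 2 * a" using eq uv(3) by linarith
      moreover have "even (\<Sum>u\<in>?P. \<Sum>v\<in>?P. w j u v)" by (rule even_sum_symmetric[OF _ mf]) simp
      ultimately show ?thesis by (auto elim!: evenE)
    qed
    have "a * (lam * (a - 1)) = (\<Sum>u\<in>?P. \<Sum>v\<in>?P. multiplicity_K_fun lam mu u v)"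
    proof -
      have "(\<Sum>v\<in>?P. multiplicity_K_fun lam mu u v) = lam * (a - 1)" if "u \<in> ?P" for u
      proof -
        have "(\<Sum>v\<in>{..<1} \<times> {..<a}. multiplicity_K_fun lam mu u v) = lam * (a - 1) + mu * a * (1 - 1)"
          by (rule sum_multiplicity_K_fun) (use that in auto)
        moreover have "{..<1} = {0::nat}" by auto
        ultimately show ?thesis by simp
      qed
      then show ?thesis using cP by simp
    qed
    also have "\<dots> = (\<Sum>u\<in>?P. \<Sum>v\<in>?P. \<Sum>j\<in>{1..k}. w j u v)"
      by (intro sum.cong[OF refl], rule tot[symmetric]) (use PV in blast)+
    also have "\<dots> = (\<Sum>j\<in>{1..k}. \<Sum>u\<in>?P. \<Sum>v\<in>?P. w j u v)"
      by (subst sum.swap, subst sum.swap) (rule refl)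
    also have "\<dots> \<le> (\<Sum>j\<in>{1..k}. 2 * (a - 1))" by (rule sum_mono) (rule inner)
    also have "\<dots> = (a - 1) * (2 * k)" by simp
    \<comment> \<open>Dividing by \<open>a - 1\<close> gives \<open>a * lam \<le> 2 * k\<close>;
      inserting the value of \<open>2 * k\<close> cancels all but one of the \<open>a\<close> copies
      of \<open>lam\<close>.\<close>
    finally have "(a - 1) * (a * lam) \<le> (a - 1) * (2 * k)" by (simp add: ac_simps)
    then have "a * lam \<le> 2 * k" using a by simp
    moreover obtain b where "a = Suc b" using a by (cases a) auto
    ultimately show ?thesis unfolding k2 by (simp add: algebra_simps)
  qed
  have deg_le: "degree (?H j) u \<le> 2" if "j \<in> {1..k}" "u \<in> vertices (?H j)" for j u
    using dH[OF that(1), of u] that(2) by simp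
  show paths: "is_path_graph D" if j: "j \<in> {1..k}" and D: "D \<in> components_of (?H j)" for j D
  proof (rule components_are_paths[OF fl(1) deg_le[OF j] _ D])
    fix u assume "u \<in> vertices (?H j)"
    then have u: "u \<in> ?U" by simp
    define X where "X = connectedness (?H j) `` {u}"
    have X: "X \<in> vertices (?H j) // connectedness (?H j)" unfolding X_def using u by (intro quotientI) simp
    note IC = induced_class[OF fl(1) X]
    have XV0: "X \<subseteq> ?U" using IC(1) by simp
    \<comment> \<open>A new vertex shows that \<open>X\<close> is not everything, so the cycle has
      an edge leaving \<open>X\<close>.\<close>
    have "(p, 0) \<in> ?V" "(p, 0) \<notin> ?U" using r a by auto
    then have "X \<noteq> ?V" using XV0 by blast
    from connected_on_cut[OF conn[OF j] _ IC(6) this] XV0 V0V obtain x y where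
      xy: "x \<in> X" "y \<in> ?V - X" "w j x y > 0" by blast
    have xV0: "x \<in> ?U" using xy XV0 by blast
    have "y \<notin> ?U"
    proof
      assume y: "y \<in> ?U"
      then have "(x, y) \<in> adj (vertices (?H j)) (edge_count (?H j))"
        using xy xV0 ec unfolding adj_def by simp
      from class_closed[OF fl(1) X xy(1) this] show False using xy by blast
    qed
    then have "w j x y \<le> (\<Sum>v\<in>?V - ?U. w j x v)" using xy by (intro member_le_sum) auto
    then have "degree (?H j) x \<le> 1" using dH[OF j xV0] xy by linarith
    moreover have "(u, x) \<in> connectedness (?H j)" using xy(1) unfolding X_def by simp
    ultimately show "\<exists>v. (u, v) \<in> connectedness (?H j) \<and> degree (?H j) v \<le> 1" by blast
  qed
  show "num_components (?H j) \<le> a * r" if j: "j \<in> {1..k}" for j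
  proof -
    have cV0: "card ?U = p * a" "card (?V - ?U) = r * a"
      by (simp_all add: card_cartesian_product card_Diff_subset V0V algebra_simps)
    have "(\<Sum>u\<in>?U. degree (?H j) u) + 2 * num_components (?H j) = 2 * (p * a)"
      using path_components_degrees(3)[OF fl(1) paths[OF j], of j] cV0 by simp
    moreover have "(\<Sum>u\<in>?U. degree (?H j) u) + (\<Sum>u\<in>?U. \<Sum>v\<in>?V - ?U. w j u v) = 2 * (p * a)"
      unfolding sum.distrib[symmetric] using dH[OF j] cV0 by simp
    moreover have "(\<Sum>u\<in>?U. \<Sum>v\<in>?V - ?U. w j u v) \<le> 2 * (r * a)"
    proof -
      have "(\<Sum>u\<in>?U. \<Sum>v\<in>?V - ?U. w j u v) = (\<Sum>v\<in>?V - ?U. \<Sum>u\<in>?U. w j v u)"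
        by (subst sum.swap) (simp add: w_def edge_count_commute)
      also have "\<dots> \<le> (\<Sum>v\<in>?V - ?U. \<Sum>u\<in>?V. w j v u)"
        by (intro sum_mono sum_mono2) (use V0V in auto)
      also have "\<dots> = (\<Sum>v\<in>?V - ?U. 2)" by (rule sum.cong[OF refl], rule deg[OF j]) blast
      finally show ?thesis using cV0 by simp
    qed
    ultimately have "2 * num_components (?H j) \<le> 2 * (r * a)" by linarith
    then show ?thesis by (simp add: mult.commute)
  qed
qed

section \<open>Sufficiency: choosing the loops, splitting and reassembling the parts\<close>

lemma ex_bounded_sum:
  fixes q :: "'a \<Rightarrow> nat"
  assumes "finite J" "L \<le> (\<Sum>j\<in>J. q j)"
  shows "\<exists>x. (\<forall>j\<in>J. x j \<le> q j) \<and> (\<Sum>j\<in>J. x j) = L"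
  using assms
proof (induction J arbitrary: L)
  case (insert i J)
  \<comment> \<open>Greedy choice: \<open>i\<close> takes as much of \<open>L\<close> as its bound
    allows.\<close>
  then have "L - min (q i) L \<le> (\<Sum>j\<in>J. q j)" by simp
  from insert.IH[OF this] obtain x where x: "\<forall>j\<in>J. x j \<le> q j" "(\<Sum>j\<in>J. x j) = L - min (q i) L" by blast
  let ?x = "x(i := min (q i) L)"
  have "(\<Sum>j\<in>J. ?x j) = (\<Sum>j\<in>J. x j)" by (rule sum.cong) (use insert.hyps in auto)
  then have "(\<Sum>j\<in>insert i J. ?x j) = L" using insert.hyps x(2) by simp
  moreover have "\<forall>j\<in>insert i J. ?x j \<le> q j" using x(1) by simp
  ultimately show ?case by blast
qed simp

lemma connected_even_add_loops:
  assumes "finite V" "connected_even V w"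
  shows "connected_even V (\<lambda>u v. w u v + (if u = v then 2 * f u else 0))"
    and "\<And>u. u \<in> V \<Longrightarrow> (\<Sum>v\<in>V. w u v + (if u = v then 2 * f u else 0)) = (\<Sum>v\<in>V. w u v) + 2 * f u"
proof -
  let ?w = "\<lambda>u v. w u v + (if u = v then 2 * f u else 0)"
  show sum: "(\<Sum>v\<in>V. ?w u v) = (\<Sum>v\<in>V. w u v) + 2 * f u" if "u \<in> V" for u
    using assms(1) that by (simp add: sum.distrib)
  have "adj V w \<subseteq> adj V ?w" unfolding adj_def by auto
  then have "connected_on V ?w" using assms(2) rtrancl_mono unfolding connected_even_def connected_on_def by blast
  moreover have "multiplicity_fun V ?w" using assms(2) unfolding connected_even_def multiplicity_fun_def by simp
  moreover have "even (\<Sum>v\<in>V. ?w u v)" if "u \<in> V" for u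
    unfolding sum[OF that] using assms(2) that unfolding connected_even_def by simp
  ultimately show "connected_even V ?w" unfolding connected_even_def by blast
qed

text \<open>
  After \<open>t\<close> steps the vertex \<open>(i, 0)\<close> with \<open>i \<ge> p + t\<close> still stands for a whole part; \<open>g t u\<close> is the
  number of vertices for which \<open>u\<close> stands.
\<close>

lemma detach_parts:
  fixes p r a lam mu :: nat and w :: "nat \<Rightarrow> nat \<times> nat \<Rightarrow> nat \<times> nat \<Rightarrow> nat"
  defines "V \<equiv> \<lambda>t. {..<p + t} \<times> {..<a} \<union> {p + t..<p + r} \<times> {0}"
    and "g \<equiv> \<lambda>t (u :: nat \<times> nat). if fst u < p + t then 1 else a"
  defines "tot \<equiv> \<lambda>t u v. if u = v then g t u * ((g t u - 1) * lam)
      else if fst u = fst v then lam else g t u * g t v * mu"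
  assumes a: "a \<ge> 1" and finJ: "finite J" and t: "t \<le> r"
    and conn: "\<And>j. j \<in> J \<Longrightarrow> connected_even (V 0) (w j)"
    and deg: "\<And>j u. j \<in> J \<Longrightarrow> u \<in> V 0 \<Longrightarrow> (\<Sum>v\<in>V 0. w j u v) = 2 * g 0 u"
    and tot: "\<And>u v. u \<in> V 0 \<Longrightarrow> v \<in> V 0 \<Longrightarrow> (\<Sum>j\<in>J. w j u v) = tot 0 u v"
  shows "\<exists>w'. (\<forall>j\<in>J. connected_even (V t) (w' j)) \<and>
     (\<forall>j\<in>J. \<forall>u\<in>V t. (\<Sum>v\<in>V t. w' j u v) = 2 * g t u) \<and>
     (\<forall>u\<in>V t. \<forall>v\<in>V t. (\<Sum>j\<in>J. w' j u v) = tot t u v) \<and>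
     (\<forall>j. \<forall>u\<in>{..<p} \<times> {..<a}. \<forall>v\<in>{..<p} \<times> {..<a}. w' j u v = w j u v)"
  using t
proof (induction t)
  case 0
  show ?case by (intro exI[of _ w]) (simp add: conn deg tot)
next
  case (Suc t)
  from Suc.IH[OF Suc_leD[OF Suc.prems]] obtain w1 where
    w1: "\<And>j. j \<in> J \<Longrightarrow> connected_even (V t) (w1 j)"
      "\<And>j u. j \<in> J \<Longrightarrow> u \<in> V t \<Longrightarrow> (\<Sum>v\<in>V t. w1 j u v) = 2 * g t u"
      "\<And>u v. u \<in> V t \<Longrightarrow> v \<in> V t \<Longrightarrow> (\<Sum>j\<in>J. w1 j u v) = tot t u v"
      "\<And>j u v. u \<in> {..<p} \<times> {..<a} \<Longrightarrow> v \<in> {..<p} \<times> {..<a} \<Longrightarrow> w1 j u v = w j u v"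
    by blast
  define \<alpha> where "\<alpha> = (p + t, 0 :: nat)"
  define B where "B = {p + t} \<times> {..<a}"
  have finV: "finite (V t)" unfolding V_def by simp
  have \<alpha>V: "\<alpha> \<in> V t" using Suc.prems unfolding \<alpha>_def V_def by simp
  have finB: "finite B" and cB: "card B = a" unfolding B_def by (simp_all add: card_cartesian_product)
  have VB: "V t \<inter> B = {\<alpha>}" using Suc.prems a unfolding \<alpha>_def V_def B_def by auto
  have VS: "V t \<union> B = V (Suc t)" using Suc.prems a unfolding V_def B_def by (auto simp: less_Suc_eq)
  have fstV: "fst v \<noteq> p + t" if "v \<in> V t - {\<alpha>}" for v using that unfolding V_def \<alpha>_def by auto
  have g\<alpha>: "g t \<alpha> = a" unfolding g_def \<alpha>_def by simp
  have gB: "g (Suc t) b = 1" if "b \<in> B" for b using that unfolding g_def B_def by auto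
  have gV: "g (Suc t) v = g t v" if "v \<in> V t - {\<alpha>}" for v using fstV[OF that] unfolding g_def by auto
  have fstB: "fst b = p + t" if "b \<in> B" for b using that unfolding B_def by auto
  have d: "(\<Sum>v\<in>V t. w1 j \<alpha> v) = card B * 2 \<and> (2::nat) \<ge> 1 \<and> even (2::nat)" if "j \<in> J" for j
    using w1(2)[OF that \<alpha>V] unfolding g\<alpha> cB by simp
  \<comment> \<open>Here \<open>\<alpha>\<close> stands for \<open>a\<close> vertices and
    \<open>v\<close> for \<open>g t v\<close>, possibly again a whole part, so each of the
    \<open>a\<close> vertices gets \<open>g t v * mu\<close> edges to \<open>v\<close>.\<close>
  have m: "(\<Sum>j\<in>J. w1 j \<alpha> v) = card B * (g t v * mu)" if v: "v \<in> V t - {\<alpha>}" for v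
  proof -
    have "fst \<alpha> \<noteq> fst v" "\<alpha> \<noteq> v" using fstV[OF v] v unfolding \<alpha>_def by auto
    then show ?thesis using w1(3)[OF \<alpha>V, of v] v g\<alpha> unfolding tot_def cB by simp
  qed
  have l: "(\<Sum>j\<in>J. w1 j \<alpha> \<alpha>) = card B * ((card B - 1) * lam)"
    using w1(3)[OF \<alpha>V \<alpha>V] g\<alpha> unfolding tot_def cB by simp
  obtain w2 where
    w2: "\<And>j. j \<in> J \<Longrightarrow> connected_even (V t \<union> B) (w2 j)"
      "\<And>j u v. u \<in> V t - {\<alpha>} \<Longrightarrow> v \<in> V t - {\<alpha>} \<Longrightarrow> w2 j u v = w1 j u v"
      "\<And>j u. j \<in> J \<Longrightarrow> u \<in> V t - {\<alpha>} \<Longrightarrow> (\<Sum>b\<in>B. w2 j u b) = w1 j u \<alpha>"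
      "\<And>j b. j \<in> J \<Longrightarrow> b \<in> B \<Longrightarrow> (\<Sum>v\<in>V t \<union> B. w2 j b v) = 2"
      "\<And>b v. b \<in> B \<Longrightarrow> v \<in> V t - {\<alpha>} \<Longrightarrow> (\<Sum>j\<in>J. w2 j b v) = g t v * mu"
      "\<And>b b'. b \<in> B \<Longrightarrow> b' \<in> B \<Longrightarrow> b \<noteq> b' \<Longrightarrow> (\<Sum>j\<in>J. w2 j b b') = lam"
      "\<And>b. b \<in> B \<Longrightarrow> (\<Sum>j\<in>J. w2 j b b) = 0"
    using detach_vertex[where d = "\<lambda>_. 2" and m = "\<lambda>v. g t v * mu", OF finJ finV \<alpha>V finB VB w1(1) d m l] by blast
  have split: "u \<in> B \<or> u \<in> V t - {\<alpha>}" if "u \<in> V (Suc t)" for u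
    using that VB unfolding VS[symmetric] by blast
  have sym2: "w2 j u v = w2 j v u" if "j \<in> J" "u \<in> V (Suc t)" "v \<in> V (Suc t)" for j u v
    using w2(1)[OF that(1)] that unfolding connected_even_def multiplicity_fun_def VS by blast
  have degV: "(\<Sum>v\<in>V (Suc t). w2 j u v) = 2 * g (Suc t) u" if j: "j \<in> J" and u: "u \<in> V t - {\<alpha>}" for j u
  proof -
    have "V (Suc t) = (V t - {\<alpha>}) \<union> B" "(V t - {\<alpha>}) \<inter> B = {}" using VB unfolding VS[symmetric] by blast+
    then have "(\<Sum>v\<in>V (Suc t). w2 j u v) = (\<Sum>v\<in>V t - {\<alpha>}. w2 j u v) + (\<Sum>v\<in>B. w2 j u v)"
      using finV finB by (simp add: sum.union_disjoint)
    also have "\<dots> = (\<Sum>v\<in>V t - {\<alpha>}. w1 j u v) + w1 j u \<alpha>"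
      using w2(2)[OF u] w2(3)[OF j u] by simp
    also have "\<dots> = (\<Sum>v\<in>V t. w1 j u v)" using finV \<alpha>V by (simp add: sum.remove)
    finally show ?thesis using w1(2)[OF j, of u] u gV[OF u] by simp
  qed
  have totBV: "(\<Sum>j\<in>J. w2 j b v) = tot (Suc t) b v \<and> tot (Suc t) b v = tot (Suc t) v b"
    if "b \<in> B" "v \<in> V t - {\<alpha>}" for b v
  proof -
    have "fst b \<noteq> fst v" using fstB[OF that(1)] fstV[OF that(2)] by simp
    then show ?thesis using w2(5)[OF that] gB[OF that(1)] gV[OF that(2)] unfolding tot_def by auto
  qed
  have tot2: "(\<Sum>j\<in>J. w2 j u v) = tot (Suc t) u v" if u: "u \<in> V (Suc t)" and v: "v \<in> V (Suc t)" for u v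
  proof -
    consider "u \<in> B" "v \<in> B" | "u \<in> B" "v \<in> V t - {\<alpha>}" | "u \<in> V t - {\<alpha>}" "v \<in> B" | "u \<in> V t - {\<alpha>}" "v \<in> V t - {\<alpha>}"
      using split[OF u] split[OF v] by blast
    then show ?thesis
    proof cases
      case 1
      then show ?thesis using w2(6,7) fstB gB unfolding tot_def by auto
    next
      case 2
      then show ?thesis using totBV by blast
    next
      case 3
      have "(\<Sum>j\<in>J. w2 j u v) = (\<Sum>j\<in>J. w2 j v u)" by (rule sum.cong[OF refl], rule sym2[OF _ u v])
      then show ?thesis using totBV 3 by simp
    next
      case 4
      have "(\<Sum>j\<in>J. w2 j u v) = tot t u v" using w2(2)[OF 4] w1(3)[of u v] 4 by simp
      then show ?thesis using gV 4 unfolding tot_def by simp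
    qed
  qed
  have old: "w2 j u v = w j u v" if u: "u \<in> {..<p} \<times> {..<a}" and v: "v \<in> {..<p} \<times> {..<a}" for j u v
  proof -
    have "u \<in> V t - {\<alpha>}" "v \<in> V t - {\<alpha>}" using u v unfolding V_def \<alpha>_def by auto
    then show ?thesis using w2(2) w1(4)[OF u v] by simp
  qed
  show ?case
  proof (intro exI[of _ w2] conjI ballI allI)
    show "connected_even (V (Suc t)) (w2 j)" if "j \<in> J" for j using w2(1)[OF that] unfolding VS .
    show "(\<Sum>v\<in>V (Suc t). w2 j u v) = 2 * g (Suc t) u" if "j \<in> J" "u \<in> V (Suc t)" for j u
      using split[OF that(2)]
    proof
      assume "u \<in> B"
      from w2(4)[OF that(1) this] gB[OF this] show ?thesis unfolding VS by simp
    qed (rule degV[OF that(1)])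
  qed (use tot2 old in auto)
qed

text \<open>
  The only place where the lower bound on the sum of the residues \<open>s j\<close> is needed.
\<close>

lemma loop_capacity:
  fixes a r k mu L :: nat and om s :: "nat \<Rightarrow> nat"
  assumes r: "r \<ge> 1" and om: "\<And>j. j \<in> {1..k} \<Longrightarrow> om j \<le> a * r"
    and s: "\<And>j. j \<in> {1..k} \<Longrightarrow> [s j = om j] (mod r) \<and> 1 \<le> s j \<and> s j \<le> r"
    and sum_s: "(\<Sum>j=1..k. int (s j)) \<ge> int k * int r - int mu * int a ^ 2 * int (r choose 2)"
    and tot: "(\<Sum>j\<in>{1..k}. a * r - om j) = r * L + mu * a ^ 2 * (r choose 2)"
  shows "L \<le> (\<Sum>j\<in>{1..k}. (a * r - om j) div r)"
proof -
  \<comment> \<open>Since \<open>om j\<close> and \<open>s j\<close> are congruent,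
    \<open>a * r - om j\<close> leaves remainder \<open>r - s j\<close> modulo \<open>r\<close>. The
    range from 1 to \<open>r\<close> for \<open>s j\<close> puts this remainder between 0 and
    \<open>r - 1\<close>.\<close>
  have q: "r * ((a * r - om j) div r) + r = (a * r - om j) + s j" if j: "j \<in> {1..k}" for j
  proof -
    have "(a * r - om j + s j) mod r = (a * r - om j + om j) mod r"
      using s[OF j] unfolding cong_def by (metis mod_add_right_eq)
    then have "r dvd a * r - om j + s j" using om[OF j] by (simp add: mod_eq_0_iff_dvd)
    then obtain t where t: "a * r - om j + s j = r * t" by (rule dvdE)
    have "t \<noteq> 0"
    proof
      assume "t = 0"
      with t s[OF j] show False by simp
    qed
    then obtain t' where t': "t = Suc t'" by (cases t) auto
    have "a * r - om j = (r - s j) + r * t'" using t s[OF j] unfolding t' by simp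
    moreover have "r - s j < r" using s[OF j] r by simp
    ultimately have "(a * r - om j) div r = t'" using r by simp
    then show ?thesis using t unfolding t' by simp
  qed
  let ?Q = "\<Sum>j\<in>{1..k}. (a * r - om j) div r"
  have "r * ?Q + k * r = (\<Sum>j\<in>{1..k}. r * ((a * r - om j) div r) + r)"
    by (simp add: sum.distrib sum_distrib_left)
  also have "\<dots> = (\<Sum>j\<in>{1..k}. a * r - om j) + (\<Sum>j\<in>{1..k}. s j)"
    unfolding sum.distrib[symmetric] by (rule sum.cong[OF refl]) (rule q)
  finally have eq: "r * ?Q + k * r = r * L + mu * a ^ 2 * (r choose 2) + (\<Sum>j\<in>{1..k}. s j)" unfolding tot .
  have "int (k * r) \<le> int ((\<Sum>j\<in>{1..k}. s j) + mu * a ^ 2 * (r choose 2))" using sum_s by simp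
  then have "k * r \<le> (\<Sum>j\<in>{1..k}. s j) + mu * a ^ 2 * (r choose 2)" by linarith
  then have "r * L \<le> r * ?Q" using eq by linarith
  then show ?thesis using r by simp
qed

locale path_colouring =
  fixes a p r k lam mu :: nat and c :: "(nat \<times> nat) set \<times> nat \<Rightarrow> nat"
  assumes a: "a > 1" and p: "p \<ge> 1" and r: "r \<ge> 1"
    and coloring: "edge_coloring (K a p lam mu) k c"
    and k2: "2 * k = lam * (a - 1) + mu * a * (p + r - 1)"
    and paths: "\<And>j D. j \<in> {1..k} \<Longrightarrow> D \<in> components_of (color_class (K a p lam mu) c j) \<Longrightarrow> is_path_graph D"
    and le: "\<And>j. j \<in> {1..k} \<Longrightarrow> num_components (color_class (K a p lam mu) c j) \<le> a * r"
begin

abbreviation "U \<equiv> {..<p} \<times> {..<a}"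
abbreviation "H j \<equiv> color_class (K a p lam mu) c j"
abbreviation "om j \<equiv> num_components (H j)"
text \<open>The number of edges of color j that join \<open>u\<close> to \<open>\<alpha>\<close> in
  the amalgamated graph. The subtraction is not truncated, as degrees are at most 2 in a union of
  paths.\<close>

definition "deficiency j u = 2 - degree (H j) u"

lemma fl: "finite_loopless (H j)"
  by (rule finite_loopless_color_class[OF finite_loopless_K])

lemma card_U: "card U = p * a" by (simp add: card_cartesian_product)

lemma degree_deficiency:
  assumes j: "j \<in> {1..k}" and u: "u \<in> U"
  shows "degree (H j) u + deficiency j u = 2"
  using path_components_degrees(1)[OF fl[of j] paths[OF j], of u] u unfolding deficiency_def by simp

text \<open>Each path component lacks two half-edges: one at each end, or both at an isolated
  vertex.\<close>

lemma sum_deficiency_vertices: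
  assumes j: "j \<in> {1..k}"
  shows "(\<Sum>u\<in>U. deficiency j u) = 2 * om j"
proof -
  have "(\<Sum>u\<in>U. degree (H j) u) + (\<Sum>u\<in>U. deficiency j u) = (\<Sum>u\<in>U. 2)"
    unfolding sum.distrib[symmetric] by (rule sum.cong[OF refl], rule degree_deficiency[OF j])
  moreover have "(\<Sum>u\<in>U. degree (H j) u) + 2 * om j = 2 * card U"
    using path_components_degrees(3)[OF fl[of j] paths[OF j]] by simp
  ultimately show ?thesis by simp
qed

text \<open>An end of the path containing \<open>u\<close>. It is the reason why every component is
  attached to \<open>\<alpha>\<close> in the amalgamated color class.\<close>

lemma ex_deficient:
  assumes j: "j \<in> {1..k}" and u: "u \<in> U"
  obtains v where "v \<in> U" "(u, v) \<in> (adj U (edge_count (H j)))\<^sup>*" "deficiency j v \<ge> 1"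
proof -
  obtain v where v: "(u, v) \<in> connectedness (H j)" "degree (H j) v \<le> 1"
    using path_components_degrees(2)[OF fl[of j] paths[OF j], of u] u by auto
  then have "v \<in> U" "(u, v) \<in> (adj U (edge_count (H j)))\<^sup>*" unfolding connectedness_eq[OF fl] by auto
  moreover have "deficiency j v \<ge> 1" using v(2) unfolding deficiency_def by simp
  ultimately show ?thesis using that by blast
qed

text \<open>Needed to keep the number of loops held back for a part below \<open>a\<close>.\<close>

lemma om_pos:
  assumes j: "j \<in> {1..k}"
  shows "om j \<ge> 1"
proof -
  have "(0, 0) \<in> U" using a p by auto
  from ex_deficient[OF j this] obtain v where v: "v \<in> U" "deficiency j v \<ge> 1" by blast
  have "deficiency j v \<le> (\<Sum>u\<in>U. deficiency j u)" by (rule member_le_sum) (use v in auto)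
  then show ?thesis using v sum_deficiency_vertices[OF j] by simp
qed

text \<open>By the value of \<open>k\<close>, what an old vertex lacks over all colors is its
  \<open>mu * a\<close> edges to each of the \<open>r\<close> new parts.\<close>

lemma sum_deficiency_colors:
  assumes u: "u \<in> U"
  shows "(\<Sum>j\<in>{1..k}. deficiency j u) = r * (mu * a)"
proof -
  have "(\<Sum>j\<in>{1..k}. degree (H j) u) = (\<Sum>j\<in>{1..k}. \<Sum>v\<in>U. edge_count (H j) u v)"
    using degree_eq_sum_edge_count[OF fl, of u] u by simp
  also have "\<dots> = (\<Sum>v\<in>U. \<Sum>j\<in>{1..k}. edge_count (H j) u v)" by (rule sum.swap)
  also have "\<dots> = (\<Sum>v\<in>U. multiplicity_K_fun lam mu u v)"
    by (rule sum.cong[OF refl], rule sum_edge_count_color_classes[OF coloring u])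
  also have "\<dots> = lam * (a - 1) + mu * a * (p - 1)" by (rule sum_multiplicity_K_fun[OF u])
  finally have "(\<Sum>j\<in>{1..k}. degree (H j) u) = lam * (a - 1) + mu * a * (p - 1)" .
  moreover have "(\<Sum>j\<in>{1..k}. degree (H j) u) + (\<Sum>j\<in>{1..k}. deficiency j u) = (\<Sum>j\<in>{1..k}. 2)"
    unfolding sum.distrib[symmetric] by (rule sum.cong[OF refl], rule degree_deficiency[OF _ u])
  ultimately have "lam * (a - 1) + mu * a * (p - 1) + (\<Sum>j\<in>{1..k}. deficiency j u) = lam * (a - 1) + mu * a * (p + r - 1)"
    using k2 by simp
  moreover have "mu * a * (p + r - 1) = mu * a * (p - 1) + r * (mu * a)"
  proof -
    have "p + r - 1 = (p - 1) + r" using p by simp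
    then show ?thesis by (simp add: algebra_simps)
  qed
  ultimately show ?thesis by simp
qed

text \<open>The loops at \<open>\<alpha>\<close> correspond to the edges among new vertices,
  \<open>lam * a * (a - 1) / 2\<close> inside each of the \<open>r\<close> parts and
  \<open>mu * a ^ 2\<close> between any two parts. Everything is doubled to avoid division.\<close>

lemma sum_loops:
  "2 * (\<Sum>j\<in>{1..k}. a * r - om j) = r * (lam * (a * (a - 1))) + r * ((r - 1) * (mu * a ^ 2))"
proof -
  have "2 * (\<Sum>j\<in>{1..k}. om j) = (\<Sum>j\<in>{1..k}. \<Sum>u\<in>U. deficiency j u)"
    unfolding sum_distrib_left by (rule sum.cong[OF refl], rule sum_deficiency_vertices[symmetric])
  also have "\<dots> = (\<Sum>u\<in>U. \<Sum>j\<in>{1..k}. deficiency j u)" by (rule sum.swap)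
  also have "\<dots> = (\<Sum>u\<in>U. r * (mu * a))" by (rule sum.cong[OF refl], rule sum_deficiency_colors)
  also have "\<dots> = p * a * (r * (mu * a))" using card_U by simp
  finally have om2: "2 * (\<Sum>j\<in>{1..k}. om j) = p * a * (r * (mu * a))" .
  have "(\<Sum>j\<in>{1..k}. a * r - om j) + (\<Sum>j\<in>{1..k}. om j) = (\<Sum>j\<in>{1..k}. a * r)"
    unfolding sum.distrib[symmetric] by (rule sum.cong[OF refl]) (use le in simp)
  then have "2 * ((\<Sum>j\<in>{1..k}. a * r - om j) + (\<Sum>j\<in>{1..k}. om j)) = a * r * (2 * k)"
    by (simp only: sum_constant card_atLeastAtMost) simp
  then have "2 * (\<Sum>j\<in>{1..k}. a * r - om j) + 2 * (\<Sum>j\<in>{1..k}. om j) = a * r * (2 * k)"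
    by (simp only: distrib_left)
  then have eq: "2 * (\<Sum>j\<in>{1..k}. a * r - om j) + p * a * (r * (mu * a)) = a * r * (lam * (a - 1) + mu * a * (p + r - 1))"
    unfolding om2 k2 .
  obtain r' where r': "r = Suc r'" using r by (cases r) auto
  have "p + r - 1 = p + r'" unfolding r' by simp
  then have "a * r * (lam * (a - 1) + mu * a * (p + r - 1)) =
      p * a * (r * (mu * a)) + (r * (lam * (a * (a - 1))) + r * ((r - 1) * (mu * a ^ 2)))"
    unfolding r' by (simp add: algebra_simps power2_eq_square)
  with eq show ?thesis by linarith
qed

lemma embeds:
  assumes s: "\<And>j. j \<in> {1..k} \<Longrightarrow> [s j = om j] (mod r) \<and> 1 \<le> s j \<and> s j \<le> r"
    and sum_s: "(\<Sum>j=1..k. int (s j)) \<ge> int k * int r - int mu * int a ^ 2 * int (r choose 2)"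
  shows "embeds_into_ham_decomposition (K a p lam mu) k c (K a (p + r) lam mu)"
proof -
  \<comment> \<open>The number of edges inside one new part.\<close>
  define L where "L = lam * (a * (a - 1)) div 2"
  have L: "2 * L = lam * (a * (a - 1))"
  proof -
    have "even (a * (a - 1))" using a by auto
    then show ?thesis unfolding L_def by simp
  qed
  have C: "2 * (r choose 2) = r * (r - 1)"
  proof -
    have "even (r * (r - 1))" using r by auto
    then show ?thesis unfolding choose_two by simp
  qed
  have half: "2 * m = 2 * n \<Longrightarrow> n = m" for m n :: nat by simp
  have tot: "(\<Sum>j\<in>{1..k}. a * r - om j) = r * L + mu * a ^ 2 * (r choose 2)"
  proof -
    have "2 * (r * L + mu * a ^ 2 * (r choose 2)) = r * (2 * L) + mu * a ^ 2 * (2 * (r choose 2))" by simp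
    also have "\<dots> = 2 * (\<Sum>j\<in>{1..k}. a * r - om j)" unfolding L C sum_loops by simp
    finally show ?thesis by (rule half)
  qed
  have "L \<le> (\<Sum>j\<in>{1..k}. (a * r - om j) div r)" by (rule loop_capacity[OF r le s sum_s tot])
  from ex_bounded_sum[OF finite_atLeastAtMost this] obtain x where
    x: "\<And>j. j \<in> {1..k} \<Longrightarrow> x j \<le> (a * r - om j) div r" "(\<Sum>j\<in>{1..k}. x j) = L" by blast
  have rx: "r * x j \<le> a * r - om j" if "j \<in> {1..k}" for j
    using mult_le_mono2[OF x(1)[OF that], of r] times_div_less_eq_dividend[of r "a * r - om j"] by linarith
  \<comment> \<open>Equality would need \<open>om j = 0\<close>. Strictness makes the degree
    \<open>2 * a - 2 * x j\<close> positive, as splitting requires.\<close>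
  have xa: "x j < a" if j: "j \<in> {1..k}" for j
  proof -
    have "a * r - om j < a * r" using om_pos[OF j] le[OF j] by linarith
    then have "r * x j < r * a" using rx[OF j] by (simp only: mult.commute[of r a])
    then show ?thesis by simp
  qed
  define \<alpha> where "\<alpha> = (p, 0 :: nat)"
  \<comment> \<open>The amalgamated color class with the \<open>r * x j\<close> held-back loops left
    out; a loop counts as two half-edges.\<close>
  define w0 where "w0 j u v = (if u = \<alpha> then (if v = \<alpha> then 2 * (a * r - om j - r * x j) else deficiency j v)
      else if v = \<alpha> then deficiency j u else edge_count (H j) u v)" for j u v
  have \<alpha>U: "\<alpha> \<notin> U" unfolding \<alpha>_def by simp
  have finU: "finite (insert \<alpha> U)" by simp
  have sumU: "(\<Sum>v\<in>insert \<alpha> U. f v) = f \<alpha> + (\<Sum>v\<in>U. f v)" for f :: "nat \<times> nat \<Rightarrow> nat"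
    using \<alpha>U by simp
  have w0U: "w0 j u v = edge_count (H j) u v" if "u \<in> U" "v \<in> U" for j u v
    using that \<alpha>U unfolding w0_def by auto
  have w0\<alpha>: "w0 j u \<alpha> = deficiency j u" "w0 j \<alpha> u = deficiency j u" if "u \<in> U" for j u
    using that \<alpha>U unfolding w0_def by auto
  have degU: "(\<Sum>v\<in>insert \<alpha> U. w0 j u v) = 2" if j: "j \<in> {1..k}" and u: "u \<in> U" for j u
  proof -
    have "(\<Sum>v\<in>U. w0 j u v) = degree (H j) u"
      using degree_eq_sum_edge_count[OF fl, of u j] w0U[OF u] u by simp
    then show ?thesis unfolding sumU w0\<alpha>[OF u] using degree_deficiency[OF j u] by simp
  qed
  \<comment> \<open>The \<open>2 * om j\<close> edges to old vertices and the remaining loops add up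
    to a multiple of \<open>r\<close>, because a multiple of \<open>r\<close> loops was left
    out.\<close>
  have deg\<alpha>: "(\<Sum>v\<in>insert \<alpha> U. w0 j \<alpha> v) = r * (2 * a - 2 * x j)" if j: "j \<in> {1..k}" for j
  proof -
    have "(\<Sum>v\<in>U. w0 j \<alpha> v) = 2 * om j" unfolding sum_deficiency_vertices[OF j, symmetric]
      by (rule sum.cong[OF refl], rule w0\<alpha>(2))
    then have "(\<Sum>v\<in>insert \<alpha> U. w0 j \<alpha> v) = 2 * (a * r - om j - r * x j) + 2 * om j"
      unfolding sumU by (simp add: w0_def)
    also have "\<dots> = 2 * (a * r - r * x j)" using rx[OF j] le[OF j] by simp
    also have "\<dots> = r * (2 * a - 2 * x j)" by (simp add: algebra_simps)
    finally show ?thesis .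
  qed
  have ce0: "connected_even (insert \<alpha> U) (w0 j)" if j: "j \<in> {1..k}" for j
  proof -
    have llH: "loopless (H j)" using fl unfolding finite_loopless_def by blast
    have mf: "multiplicity_fun (insert \<alpha> U) (w0 j)"
      unfolding multiplicity_fun_def w0_def using edge_count_self[OF llH] edge_count_commute[of "H j"] by simp
    have ev: "even (\<Sum>v\<in>insert \<alpha> U. w0 j u v)" if "u \<in> insert \<alpha> U" for u
    proof (cases "u = \<alpha>")
      case True
      then show ?thesis using deg\<alpha>[OF j] by simp
    next
      case False
      then show ?thesis using degU[OF j] that by simp
    qed
    let ?R = "adj (insert \<alpha> U) (w0 j)"
    \<comment> \<open>This holds without any loops: each component of \<open>H j\<close> has a
      deficient vertex, which is adjacent to \<open>\<alpha>\<close>.\<close>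
    have to\<alpha>: "(u, \<alpha>) \<in> ?R\<^sup>*" if u: "u \<in> insert \<alpha> U" for u
    proof (cases "u = \<alpha>")
      case False
      with u have "u \<in> U" by simp
      from ex_deficient[OF j this] obtain v where
        v: "v \<in> U" "(u, v) \<in> (adj U (edge_count (H j)))\<^sup>*" "deficiency j v \<ge> 1" by blast
      have "adj U (edge_count (H j)) \<subseteq> ?R" using w0U unfolding adj_def by auto
      then have "(u, v) \<in> ?R\<^sup>*" using v(2) rtrancl_mono by blast
      moreover have "(v, \<alpha>) \<in> ?R" using v w0\<alpha>(1)[OF v(1)] unfolding adj_def by simp
      ultimately show ?thesis by (rule rtrancl.rtrancl_into_rtrancl)
    qed simp
    have "sym (?R\<^sup>*)" by (rule sym_rtrancl[OF sym_adj[OF mf]])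
    then have from\<alpha>: "(\<alpha>, u) \<in> ?R\<^sup>*" if "u \<in> insert \<alpha> U" for u using to\<alpha>[OF that] by (rule symD)
    have "connected_on (insert \<alpha> U) (w0 j)"
      unfolding connected_on_def by (intro ballI rtrancl_trans[OF to\<alpha> from\<alpha>])
    with mf ev show ?thesis unfolding connected_even_def by blast
  qed
  define B where "B = {p..<p + r} \<times> {0 :: nat}"
  have finB: "finite B" and cB: "card B = r" unfolding B_def by (simp_all add: card_cartesian_product)
  have UB: "insert \<alpha> U \<inter> B = {\<alpha>}" using r unfolding B_def \<alpha>_def by auto
  have UB': "U \<inter> B = {}" unfolding B_def by auto
  have Ua: "insert \<alpha> U - {\<alpha>} = U" using \<alpha>U by blast
  have d0: "(\<Sum>v\<in>insert \<alpha> U. w0 j \<alpha> v) = card B * (2 * a - 2 * x j) \<and> 2 * a - 2 * x j \<ge> 1 \<and> even (2 * a - 2 * x j)"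
    if j: "j \<in> {1..k}" for j
    unfolding cB deg\<alpha>[OF j] using xa[OF j] by simp
  have m0: "(\<Sum>j\<in>{1..k}. w0 j \<alpha> v) = card B * (mu * a)" if "v \<in> insert \<alpha> U - {\<alpha>}" for v
  proof -
    have "v \<in> U" using that unfolding Ua .
    then show ?thesis using sum_deficiency_colors[of v] w0\<alpha>(2)[of v] unfolding cB by simp
  qed
  \<comment> \<open>The held-back loops number \<open>r * L\<close>, all the edges inside new parts;
    what is left is \<open>mu * a ^ 2\<close> loops for each pair of parts.\<close>
  have l0: "(\<Sum>j\<in>{1..k}. w0 j \<alpha> \<alpha>) = card B * ((card B - 1) * (mu * a ^ 2))"
  proof -
    have "(\<Sum>j\<in>{1..k}. w0 j \<alpha> \<alpha>) + 2 * (r * (\<Sum>j\<in>{1..k}. x j)) = (\<Sum>j\<in>{1..k}. w0 j \<alpha> \<alpha> + 2 * (r * x j))"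
      by (simp add: sum.distrib sum_distrib_left)
    also have "\<dots> = (\<Sum>j\<in>{1..k}. 2 * (a * r - om j))"
    proof (rule sum.cong[OF refl])
      fix j assume "j \<in> {1..k}"
      then show "w0 j \<alpha> \<alpha> + 2 * (r * x j) = 2 * (a * r - om j)" using rx[of j] by (simp add: w0_def)
    qed
    also have "\<dots> = r * (lam * (a * (a - 1))) + r * ((r - 1) * (mu * a ^ 2))"
      unfolding sum_distrib_left[symmetric] sum_loops ..
    also have "lam * (a * (a - 1)) = 2 * (\<Sum>j\<in>{1..k}. x j)" unfolding x(2) L ..
    finally show ?thesis unfolding cB by simp
  qed
  obtain w1 where
    w1: "\<And>j. j \<in> {1..k} \<Longrightarrow> connected_even (insert \<alpha> U \<union> B) (w1 j)"
      "\<And>j u v. u \<in> insert \<alpha> U - {\<alpha>} \<Longrightarrow> v \<in> insert \<alpha> U - {\<alpha>} \<Longrightarrow> w1 j u v = w0 j u v"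
      "\<And>j u. j \<in> {1..k} \<Longrightarrow> u \<in> insert \<alpha> U - {\<alpha>} \<Longrightarrow> (\<Sum>b\<in>B. w1 j u b) = w0 j u \<alpha>"
      "\<And>j b. j \<in> {1..k} \<Longrightarrow> b \<in> B \<Longrightarrow> (\<Sum>v\<in>insert \<alpha> U \<union> B. w1 j b v) = 2 * a - 2 * x j"
      "\<And>b v. b \<in> B \<Longrightarrow> v \<in> insert \<alpha> U - {\<alpha>} \<Longrightarrow> (\<Sum>j\<in>{1..k}. w1 j b v) = mu * a"
      "\<And>b b'. b \<in> B \<Longrightarrow> b' \<in> B \<Longrightarrow> b \<noteq> b' \<Longrightarrow> (\<Sum>j\<in>{1..k}. w1 j b b') = mu * a ^ 2"
      "\<And>b. b \<in> B \<Longrightarrow> (\<Sum>j\<in>{1..k}. w1 j b b) = 0"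
    using detach_vertex[where d = "\<lambda>j. 2 * a - 2 * x j" and m = "\<lambda>_. mu * a" and \<alpha> = \<alpha>,
      OF finite_atLeastAtMost finU insertI1 finB UB ce0 d0 m0 l0] by blast
  define V where "V t = {..<p + t} \<times> {..<a} \<union> {p + t..<p + r} \<times> {0 :: nat}" for t
  define g where "g t u = (if fst u < p + t then 1 else a)" for t and u :: "nat \<times> nat"
  have V0: "insert \<alpha> U \<union> B = V 0" using r unfolding V_def B_def \<alpha>_def by auto
  have V0': "V 0 = U \<union> B" unfolding V_def B_def by simp
  have finV0: "finite (V 0)" unfolding V_def by simp
  note w1' = w1[unfolded Ua V0]
  \<comment> \<open>Returning \<open>x j\<close> loops to each part raises its degree from
    \<open>2 * a - 2 * x j\<close> to \<open>2 * a\<close>, two for each of its \<open>a\<close>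
    vertices. Over all colors a part then has \<open>L\<close> loops.\<close>
  define w where "w j u v = w1 j u v + (if u = v then 2 * (if u \<in> B then x j else 0) else 0)" for j u v
  have gU: "g 0 u = 1" if "u \<in> U" for u using that unfolding g_def by auto
  have gB: "g 0 u = a" if "u \<in> B" for u using that unfolding g_def B_def by auto
  have conn: "connected_even (V 0) (w j)" if "j \<in> {1..k}" for j
    unfolding w_def[abs_def] by (rule connected_even_add_loops(1)[OF finV0 w1'(1)[OF that]])
  have sym: "w1 j u v = w1 j v u" if "j \<in> {1..k}" "u \<in> V 0" "v \<in> V 0" for j u v
    using w1'(1)[OF that(1)] that unfolding connected_even_def multiplicity_fun_def by blast
  have deg: "(\<Sum>v\<in>V 0. w j u v) = 2 * g 0 u" if j: "j \<in> {1..k}" and u: "u \<in> V 0" for j u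
  proof -
    have eq: "(\<Sum>v\<in>V 0. w j u v) = (\<Sum>v\<in>V 0. w1 j u v) + 2 * (if u \<in> B then x j else 0)"
      unfolding w_def by (rule connected_even_add_loops(2)[OF finV0 w1'(1)[OF j] u])
    show ?thesis
    proof (cases "u \<in> B")
      case True
      then show ?thesis using eq w1'(4)[OF j True] gB[OF True] xa[OF j] by simp
    next
      case False
      then have uU: "u \<in> U" using u unfolding V0' by blast
      have "(\<Sum>v\<in>V 0. w1 j u v) = (\<Sum>v\<in>U. w1 j u v) + (\<Sum>b\<in>B. w1 j u b)"
        unfolding V0' by (rule sum.union_disjoint) (use UB' finB in auto)
      also have "\<dots> = (\<Sum>v\<in>U. w0 j u v) + w0 j u \<alpha>" using w1'(2)[OF uU] w1'(3)[OF j uU] by simp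
      also have "\<dots> = 2" using degU[OF j uU] unfolding sumU by simp
      finally show ?thesis using eq False gU[OF uU] by simp
    qed
  qed
  have tot0: "(\<Sum>j\<in>{1..k}. w j u v) = (if u = v then g 0 u * ((g 0 u - 1) * lam)
      else if fst u = fst v then lam else g 0 u * g 0 v * mu)" if u: "u \<in> V 0" and v: "v \<in> V 0" for u v
  proof -
    consider "u \<in> B" "v \<in> B" "u = v" | "u \<in> B" "v \<in> B" "u \<noteq> v" | "u \<in> B" "v \<in> U" | "u \<in> U" "v \<in> B" | "u \<in> U" "v \<in> U"
      using u v unfolding V0' by blast
    then show ?thesis
    proof cases
      case 1
      have "(\<Sum>j\<in>{1..k}. w j u v) = (\<Sum>j\<in>{1..k}. w1 j u u) + 2 * (\<Sum>j\<in>{1..k}. x j)"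
        using 1 unfolding w_def by (simp add: sum.distrib sum_distrib_left)
      then show ?thesis using w1'(7)[OF 1(1)] 1 gB[OF 1(1)] x(2) L by simp
    next
      case 2
      have "fst u \<noteq> fst v" using 2 unfolding B_def by auto
      moreover have "(\<Sum>j\<in>{1..k}. w j u v) = mu * a ^ 2" using w1'(6)[OF 2] 2 unfolding w_def by simp
      ultimately show ?thesis using 2 gB by (simp add: power2_eq_square)
    next
      case 3
      have ne: "fst u \<noteq> fst v" using 3 unfolding B_def by auto
      moreover from ne have "u \<noteq> v" by blast
      then have "(\<Sum>j\<in>{1..k}. w j u v) = mu * a" using w1'(5)[OF 3] unfolding w_def by simp
      ultimately show ?thesis using gB[OF 3(1)] gU[OF 3(2)] by auto
    next
      case 4
      have ne: "fst u \<noteq> fst v" using 4 unfolding B_def by auto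
      have "(\<Sum>j\<in>{1..k}. w j u v) = (\<Sum>j\<in>{1..k}. w1 j v u)"
        by (rule sum.cong[OF refl]) (use ne sym[OF _ u v] in \<open>auto simp: w_def\<close>)
      then show ?thesis using w1'(5)[OF 4(2,1)] gB[OF 4(2)] gU[OF 4(1)] ne by auto
    next
      case 5
      have "w j u v = edge_count (H j) u v" for j
        using w1'(2)[OF 5] w0U[OF 5] 5 UB' unfolding w_def by auto
      then have "(\<Sum>j\<in>{1..k}. w j u v) = multiplicity_K_fun lam mu u v"
        using sum_edge_count_color_classes[OF coloring 5] by simp
      then show ?thesis using gU[OF 5(1)] gU[OF 5(2)] unfolding multiplicity_K_fun_def by simp
    qed
  qed
  have a1: "a \<ge> 1" using a by simp
  obtain w' where
    w': "\<And>j. j \<in> {1..k} \<Longrightarrow> connected_even (V r) (w' j)"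
      "\<And>j u. j \<in> {1..k} \<Longrightarrow> u \<in> V r \<Longrightarrow> (\<Sum>v\<in>V r. w' j u v) = 2 * g r u"
      "\<And>u v. u \<in> V r \<Longrightarrow> v \<in> V r \<Longrightarrow> (\<Sum>j\<in>{1..k}. w' j u v) = (if u = v then g r u * ((g r u - 1) * lam)
        else if fst u = fst v then lam else g r u * g r v * mu)"
      "\<And>j u v. u \<in> U \<Longrightarrow> v \<in> U \<Longrightarrow> w' j u v = w j u v"
    using detach_parts[OF a1 finite_atLeastAtMost order_refl, of 1 k p r w lam mu, folded V_def g_def, OF conn deg tot0] by blast
  have Vr: "V r = {..<p + r} \<times> {..<a}" unfolding V_def by auto
  have gr: "g r u = 1" if "u \<in> V r" for u using that unfolding g_def Vr by auto
  let ?V = "{..<p + r} \<times> {..<a}"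
  show ?thesis
  proof (rule embeds_if_multiplicities[OF _ coloring, where w = w'])
    have "2 * 2 \<le> a * (p + r)" using a p r by (intro mult_le_mono) auto
    then show "3 \<le> a * (p + r)" by simp
    show "connected_even (?V) (w' j)" if "j \<in> {1..k}" for j by (rule w'(1)[unfolded Vr, OF that])
    show "(\<Sum>v\<in>?V. w' j u v) = 2" if "j \<in> {1..k}" "u \<in> ?V" for j u using w'(2)[unfolded Vr, OF that] gr[unfolded Vr, OF that(2)] by simp
    show "(\<Sum>j\<in>{1..k}. w' j u v) = multiplicity_K_fun lam mu u v" if "u \<in> ?V" "v \<in> ?V" for u v
      using w'(3)[unfolded Vr, OF that] gr[unfolded Vr, OF that(1)] gr[unfolded Vr, OF that(2)] unfolding multiplicity_K_fun_def by simp
    show "w' j u v = edge_count (H j) u v" if "j \<in> {1..k}" "u \<in> U" "v \<in> U" for j u v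
      using w'(4)[OF that(2,3)] w1'(2)[OF that(2,3)] w0U[OF that(2,3)] that UB' unfolding w_def by auto
  qed
qed

end

theorem theorem2:
  fixes a p r k lam mu :: nat
    and c :: "(nat \<times> nat) set \<times> nat \<Rightarrow> nat"
    and \<omega> s :: "nat \<Rightarrow> nat"
  assumes "a > 1" and "p \<ge> 1" and "r \<ge> 1" and "k \<ge> 1" and "mu \<ge> 1" and "lam \<noteq> mu"
    and coloring: "edge_coloring (K a p lam mu) k c"
    and omega: "\<And>j. j \<in> {1..k} \<Longrightarrow> \<omega> j = num_components (color_class (K a p lam mu) c j)"
    and s: "\<And>j. j \<in> {1..k} \<Longrightarrow> [s j = \<omega> j] (mod r) \<and> 1 \<le> s j \<and> s j \<le> r"
    and sum_s: "(\<Sum>j=1..k. int (s j)) \<ge> int k * int r - int mu * int a ^ 2 * int (r choose 2)"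
  shows "embeds_into_ham_decomposition (K a p lam mu) k c (K a (p + r) lam mu) \<longleftrightarrow>
      real k = (real lam * (real a - 1) + real mu * real a * (real p + real r - 1)) / 2 \<and>
      real lam \<le> real mu * real a * (real p + real r - 1) \<and>
      (\<forall>j\<in>{1..k}. \<forall>H \<in> components_of (color_class (K a p lam mu) c j). is_path_graph H) \<and>
      (\<forall>j\<in>{1..k}. \<omega> j \<le> a * r)"
proof -
  have real_a: "real (a - 1) = real a - 1" and real_pr: "real (p + r - 1) = real p + real r - 1"
    using assms(1-3) by simp_all
  \<comment> \<open>The subtractions on natural numbers agree with those on reals because
    \<open>a\<close> and \<open>p + r\<close> are at least 1.\<close>
  have num: "2 * k = lam * (a - 1) + mu * a * (p + r - 1) \<longleftrightarrow>
      real k = (real lam * (real a - 1) + real mu * real a * (real p + real r - 1)) / 2"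
  proof -
    have "2 * k = lam * (a - 1) + mu * a * (p + r - 1) \<longleftrightarrow>
        real (2 * k) = real (lam * (a - 1) + mu * a * (p + r - 1))" by (simp only: of_nat_eq_iff)
    also have "\<dots> \<longleftrightarrow> 2 * real k = real lam * (real a - 1) + real mu * real a * (real p + real r - 1)"
      unfolding of_nat_add of_nat_mult real_a real_pr[unfolded of_nat_add] using real_pr by simp
    finally show ?thesis by (simp add: field_simps)
  qed
  show ?thesis
  proof
    assume emb: "embeds_into_ham_decomposition (K a p lam mu) k c (K a (p + r) lam mu)"
    note nec = embedding_necessary[OF assms(1-3) emb]
    have "real lam \<le> real (mu * a * (p + r - 1))" using nec(2) by (simp only: of_nat_le_iff)
    then have "real lam \<le> real mu * real a * (real p + real r - 1)" using real_pr by simp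
    with nec(1)[unfolded num] nec(3,4) omega show "real k = (real lam * (real a - 1) + real mu * real a * (real p + real r - 1)) / 2 \<and>
      real lam \<le> real mu * real a * (real p + real r - 1) \<and>
      (\<forall>j\<in>{1..k}. \<forall>H \<in> components_of (color_class (K a p lam mu) c j). is_path_graph H) \<and>
      (\<forall>j\<in>{1..k}. \<omega> j \<le> a * r)" by simp
  next
    assume R: "real k = (real lam * (real a - 1) + real mu * real a * (real p + real r - 1)) / 2 \<and>
      real lam \<le> real mu * real a * (real p + real r - 1) \<and>
      (\<forall>j\<in>{1..k}. \<forall>H \<in> components_of (color_class (K a p lam mu) c j). is_path_graph H) \<and>
      (\<forall>j\<in>{1..k}. \<omega> j \<le> a * r)"
    interpret path_colouring a p r k lam mu c
      using assms(1-3) coloring R num omega by unfold_locales auto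
    show "embeds_into_ham_decomposition (K a p lam mu) k c (K a (p + r) lam mu)"
      by (rule embeds[OF _ sum_s]) (use s omega in simp)
  qed
qed

end
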